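(* For every uniform barrier $B$ on $\omega$, the triple $(\mathcal{E}_B,\subseteq,r)$ is a topological Ramsey space; that is, with respect to the topology on $\mathcal{E}_B$ generated by the sets $[u,X]=\{Y\in\mathcal{E}_B: Y\subseteq X \text{ and } r_n(Y)=u \text{ for some } n\}$ ($u\in\mathcal{AE}^B$, $X\in\mathcal{E}_B$), every subset of $\mathcal{E}_B$ with the property of Baire is Ramsey, and every meager subset of $\mathcal{E}_B$ is Ramsey null.
   Context: Notation. For finite $a,b\subseteq\omega$, $a\trianglelefteq b$ means $a$ is an initial segment of $b$ (i.e. $a=b$ or $a=\{x\in b: x<\min(b\setminus a)\}$), and $a\vartriangleleft b$ means $a\trianglelefteq b$, $a\neq b$. For $\hat B$ below, $\hat{B}=\{a: \exists b\in B\ (a\trianglelefteq b)\}$. Uniform barriers. A family $B$ of finite subsets of $\omega$ is a barrier on $\omega$ if $a\not\subseteq b$ for distinct $a,b\in B$ and every infinite $M\subseteq\omega$ has an initial segment in $B$. For $n\in\omega$ let $B_{\{n\}}=\{a\in[\omega]^{<\omega}:\min a>n,\ \{n\}\cup a\in B\}$. For $\alpha<\omega_1$ and infinite $M\subseteq\omega$, $B$ is $\alpha$-uniform on $M$ if: $\alpha=0$ and $B=\{\emptyset\}$; or $\alpha=\beta+1$, $\emptyset\notin B$ and $B_{\{n\}}$ is $\beta$-uniform on $M\setminus(n+1)$ for all $n\in M$; or $\alpha$ is a limit and there are ordinals $\alpha_n$ ($n\in M$) increasing to $\alpha$ with $B_{\{n\}}$ $\alpha_n$-uniform on $M\setminus(n+1)$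 for all $n\in M$. A uniform barrier on $\omega$ is a barrier on $\omega$ that is $\alpha$-uniform on $\omega$ for some $1\le\alpha<\omega_1$ (its rank). Sequences. For $a=\{a_0<\dots<a_n\}$ let $\sigma(a)=(a_0,a_1-1,\dots,a_n-n)$, $\sigma(\emptyset)=()$; $\sigma$ is a bijection from finite subsets of $\omega$ onto finite non-decreasing sequences. For such sequences, $s\prec t$ iff $\max(s)<\max(t)$, or $\max(s)=\max(t)$ and $s$ is lexicographically below $t$ (a proper initial segment counting as lexicographically smaller); $()$ is the $\prec$-least. Let $S_{\hat B}=\sigma[\hat B]$, $S_B=\sigma[B]$; $(S_{\hat B},\prec)$ has order type $\omega$, and $\nu_B:(S_{\hat B},\prec)\to(\omega,<)$ is the order isomorphism. For nonempty $s\in S_{\hat B}$ let $\psi_B(s)=\{\nu_B(s\restriction m):1\le m\le \mathrm{lh}(s)\}$, and $\rho_B=\psi_B\circ\sigma$ (with $\rho_B(\emptyset)=\emptyset$). For a set $F$ of nonempty sequences, $\widehat F=\{s\restriction m: s\in F,1\le m\le\mathrm{lh}(s)\}$; for sets $T,T'$ of sequences, $T\prec T'$ means $s\prec s'$ for all $s\in T,s'\in T'$. For $S\subseteq S_B$ and $n\in\omega$, $S_n=\{s\in S: s(0)=n\}$. Domain spaces $D_B$ and full approximations $\mathfrak a^B_k$ (recursion on rank). For rank $0$ ($B=\{\emptyset\}$): $D_B=\{\{()\}\}$, $\mathfrak a_0=\emptyset$, $\mathfrak a_k(\{()\})=\{()\}$ for $k\ge1$. For $B=[\omega]^1$: $D_B$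 is the set of infinite subsets of $S_B=\{(n):n\in\omega\}$ and $\mathfrak a^B_k(S)$ is the set of the $k$ $\prec$-least elements of $S$. For $B$ of rank $\alpha\ge2$: for each $n$ let $C^n=\{\{c-(n+1):c\in a\}: a\in B_{\{n\}}\}$ (a uniform barrier of rank $<\alpha$ or $\{\emptyset\}$), let $\upsilon_n:S_{C^n}\to S_{B_n}$ (where $B_n=\{b\in B:\min b=n\}$) be the bijection $\upsilon_n(\sigma(c))=\sigma(\{n\}\cup\{x+n+1:x\in c\})$, let $D_{B_n}=\{\upsilon_n[T]:T\in D_{C^n}\}$ and $\mathfrak a^{B_n}_k(T)=\upsilon_n[\mathfrak a^{C^n}_k(\upsilon_n^{-1}[T])]$. Then $S\subseteq S_B$ is in $D_B$ iff there are infinitely many $n$ with $S_n\neq\emptyset$, and, enumerating them increasingly as $n_0<n_1<\cdots$: (1) $S_{n_i}\in D_{B_{n_i}}$ for every $i$; and (2) setting $\mathfrak a^B_0(S)=\emptyset$, $\mathfrak a^B_1(S)=\mathfrak a^{B_{n_0}}_1(S_{n_0})$, for every $k\ge1$: (a) $\mathfrak a^B_k(S)\prec \widehat{\mathfrak a^{B_{n_0}}_{k+1}(S_{n_0})}\setminus\widehat{\mathfrak a^B_k(S)}$, and (b) for each $1\le i\le k$, $\mathfrak a^{B_{n_{i-1}}}_{k-i}(S_{n_{i-1}})\prec \widehat{\mathfrak a^{B_{n_i}}_{k+1-i}(S_{n_i})}\setminus\widehat{\mathfrak a^{B_{n_i}}_{k-i}(S_{n_i})}$; where $\mathfrak a^B_{k+1}(S)=\mathfrak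 a^B_k(S)\cup\mathfrak a^{B_{n_0}}_{k+1}(S_{n_0})\cup\mathfrak a^{B_{n_1}}_{k}(S_{n_1})\cup\dots\cup\mathfrak a^{B_{n_k}}_1(S_{n_k})$. The space. $\mathcal{E}_B=\{\psi_B[S]:S\in D_B\}$, quasi-ordered by inclusion. For $X=\psi_B[S]\in\mathcal E_B$, $r_k(X)=\psi_B[\{\text{the }k\ \prec\text{-least members of }S\}]$ (equivalently, the $k$ members of $X$ with smallest maxima); $\mathcal{AE}^B=\{r_k(X):X\in\mathcal E_B,k<\omega\}$. Ramsey notions. A set $\mathcal X\subseteq\mathcal E_B$ is Ramsey if for every nonempty $[u,X]$ there is $Y\in[u,X]$ with $[u,Y]\subseteq\mathcal X$ or $[u,Y]\cap\mathcal X=\emptyset$; Ramsey null if for every nonempty $[u,X]$ there is $Y\in[u,X]$ with $[u,Y]\cap\mathcal X=\emptyset$. Meager and property of Baire refer to the topology generated by the sets $[u,X]$.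
   Formalization: In clause (2)(b) of the definition of D_B, the left side a_{k-i}(S_{n_{i-1}}) is replaced by a^B_k(S) ∪ a_{k+2-i}(S_{n_{i-1}}); as printed, the order of new elements in successive rows is left free and the theorem fails already for B=[ω]^2. *)

theory Defs
  imports "HOL-Analysis.Analysis"
begin

section \<open>Topological Ramsey spaces\<close>

text \<open>
  A space is given by its carrier \<open>E\<close>, a relation \<open>le\<close> on it and the restriction maps
  \<open>r k\<close>; the topology is generated by the sets \<open>[u, X]\<close>.
\<close>

definition approximations :: "'x set \<Rightarrow> (nat \<Rightarrow> 'x \<Rightarrow> 'u) \<Rightarrow> 'u set" where
  "approximations E r = {r k X | k X. X \<in> E}"

definition basic_set ::
  "'x set \<Rightarrow> ('x \<Rightarrow> 'x \<Rightarrow> bool) \<Rightarrow> (nat \<Rightarrow> 'x \<Rightarrow> 'u) \<Rightarrow> 'u \<Rightarrow> 'x \<Rightarrow> 'x set" where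
  "basic_set E le r u X = {Y \<in> E. le Y X \<and> (\<exists>n. r n Y = u)}"

definition ramsey_topology ::
  "'x set \<Rightarrow> ('x \<Rightarrow> 'x \<Rightarrow> bool) \<Rightarrow> (nat \<Rightarrow> 'x \<Rightarrow> 'u) \<Rightarrow> 'x topology" where
  "ramsey_topology E le r =
     topology_generated_by {basic_set E le r u X | u X. u \<in> approximations E r \<and> X \<in> E}"

definition nowhere_dense_in :: "'x topology \<Rightarrow> 'x set \<Rightarrow> bool" where
  "nowhere_dense_in T A \<longleftrightarrow> A \<subseteq> topspace T \<and> T interior_of (T closure_of A) = {}"

definition meager_in :: "'x topology \<Rightarrow> 'x set \<Rightarrow> bool" where
  "meager_in T A \<longleftrightarrow> (\<exists>\<N>. countable \<N> \<and> (\<forall>N\<in>\<N>. nowhere_dense_in T N) \<and> A = \<Union>\<N>)"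

definition baire_property_in :: "'x topology \<Rightarrow> 'x set \<Rightarrow> bool" where
  "baire_property_in T A \<longleftrightarrow>
     A \<subseteq> topspace T \<and> (\<exists>U. openin T U \<and> meager_in T ((A - U) \<union> (U - A)))"

definition ramsey_set ::
  "'x set \<Rightarrow> ('x \<Rightarrow> 'x \<Rightarrow> bool) \<Rightarrow> (nat \<Rightarrow> 'x \<Rightarrow> 'u) \<Rightarrow> 'x set \<Rightarrow> bool" where
  "ramsey_set E le r \<X> \<longleftrightarrow>
     (\<forall>u \<in> approximations E r. \<forall>X \<in> E. basic_set E le r u X \<noteq> {} \<longrightarrow>
        (\<exists>Y \<in> basic_set E le r u X.
           basic_set E le r u Y \<subseteq> \<X> \<or> basic_set E le r u Y \<inter> \<X> = {}))"

definition ramsey_null ::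
  "'x set \<Rightarrow> ('x \<Rightarrow> 'x \<Rightarrow> bool) \<Rightarrow> (nat \<Rightarrow> 'x \<Rightarrow> 'u) \<Rightarrow> 'x set \<Rightarrow> bool" where
  "ramsey_null E le r \<X> \<longleftrightarrow>
     (\<forall>u \<in> approximations E r. \<forall>X \<in> E. basic_set E le r u X \<noteq> {} \<longrightarrow>
        (\<exists>Y \<in> basic_set E le r u X. basic_set E le r u Y \<inter> \<X> = {}))"

definition topological_ramsey_space ::
  "'x set \<Rightarrow> ('x \<Rightarrow> 'x \<Rightarrow> bool) \<Rightarrow> (nat \<Rightarrow> 'x \<Rightarrow> 'u) \<Rightarrow> bool" where
  "topological_ramsey_space E le r \<longleftrightarrow>
     (\<forall>\<X>. \<X> \<subseteq> E \<longrightarrow> baire_property_in (ramsey_topology E le r) \<X> \<longrightarrow> ramsey_set E le r \<X>) \<and>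
     (\<forall>\<X>. \<X> \<subseteq> E \<longrightarrow> meager_in (ramsey_topology E le r) \<X> \<longrightarrow> ramsey_null E le r \<X>)"

section \<open>Uniform barriers\<close>

definition initial_segment :: "nat set \<Rightarrow> nat set \<Rightarrow> bool" where
  "initial_segment a b \<longleftrightarrow> a = b \<or> a = {x \<in> b. x < (LEAST y. y \<in> b - a)}"

definition initial_segments :: "nat set set \<Rightarrow> nat set set" where
  "initial_segments B = {a. \<exists>b\<in>B. initial_segment a b}"

definition barrier :: "nat set set \<Rightarrow> bool" where
  "barrier B \<longleftrightarrow>
     (\<forall>b\<in>B. finite b) \<and>
     (\<forall>a\<in>B. \<forall>b\<in>B. a \<noteq> b \<longrightarrow> \<not> a \<subseteq> b) \<and>
     (\<forall>M. infinite M \<longrightarrow> (\<exists>b\<in>B. initial_segment b M))"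

definition section_at :: "nat set set \<Rightarrow> nat \<Rightarrow> nat set set" where
  "section_at B n = {a. finite a \<and> (\<forall>x\<in>a. n < x) \<and> insert n a \<in> B}"

text \<open>
  Countable ordinals are represented by well-orders \<open>\<alpha>\<close> with field contained in the
  natural numbers, compared by order type through \<open>ordLess\<close> and \<open>ordLeq\<close>; zero is
  the empty order. The successor of \<open>\<beta>\<close> is the least ordinal above it.
\<close>

definition succ_of :: "nat rel \<Rightarrow> nat rel \<Rightarrow> bool" where
  "succ_of \<beta> \<alpha> \<longleftrightarrow> (\<beta>, \<alpha>) \<in> ordLess \<and> (\<forall>\<gamma>::nat rel. (\<beta>, \<gamma>) \<in> ordLess \<longrightarrow> (\<alpha>, \<gamma>) \<in> ordLeq)"

definition limit_ordinal :: "nat rel \<Rightarrow> bool" where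
  "limit_ordinal \<alpha> \<longleftrightarrow> Well_order \<alpha> \<and> \<alpha> \<noteq> {} \<and> \<not> (\<exists>\<beta>::nat rel. succ_of \<beta> \<alpha>)"

definition increases_to :: "nat set \<Rightarrow> (nat \<Rightarrow> nat rel) \<Rightarrow> nat rel \<Rightarrow> bool" where
  "increases_to M s \<alpha> \<longleftrightarrow>
     (\<forall>m\<in>M. \<forall>n\<in>M. m < n \<longrightarrow> (s m, s n) \<in> ordLess) \<and>
     (\<forall>n\<in>M. (s n, \<alpha>) \<in> ordLess) \<and>
     (\<forall>\<gamma>::nat rel. (\<gamma>, \<alpha>) \<in> ordLess \<longrightarrow> (\<exists>n\<in>M. (\<gamma>, s n) \<in> ordLess))"

inductive uniform_on :: "nat rel \<Rightarrow> nat set \<Rightarrow> nat set set \<Rightarrow> bool" where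
  zero: "infinite M \<Longrightarrow> uniform_on {} M {{}}"
| succ: "infinite M \<Longrightarrow> succ_of \<beta> \<alpha> \<Longrightarrow> {} \<notin> B \<Longrightarrow>
         (\<And>n. n \<in> M \<Longrightarrow> uniform_on \<beta> (M - {..n}) (section_at B n)) \<Longrightarrow>
         uniform_on \<alpha> M B"
| limit: "infinite M \<Longrightarrow> limit_ordinal \<alpha> \<Longrightarrow> increases_to M s \<alpha> \<Longrightarrow>
          (\<And>n. n \<in> M \<Longrightarrow> uniform_on (s n) (M - {..n}) (section_at B n)) \<Longrightarrow>
          uniform_on \<alpha> M B"

definition uniform_barrier :: "nat set set \<Rightarrow> bool" where
  "uniform_barrier B \<longleftrightarrow> barrier B \<and> (\<exists>\<alpha>. \<alpha> \<noteq> {} \<and> uniform_on \<alpha> UNIV B)"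

section \<open>Non-decreasing sequences\<close>

definition sigma :: "nat set \<Rightarrow> nat list" where
  "sigma a = map (\<lambda>i. sorted_list_of_set a ! i - i) [0..<card a]"

definition seq_less :: "nat list \<Rightarrow> nat list \<Rightarrow> bool" (infix \<open>\<prec>\<close> 50) where
  "s \<prec> t \<longleftrightarrow> t \<noteq> [] \<and>
     (s = [] \<or> Max (set s) < Max (set t) \<or>
      Max (set s) = Max (set t) \<and> (s, t) \<in> lexord less_than)"

definition set_less :: "nat list set \<Rightarrow> nat list set \<Rightarrow> bool" (infix \<open>\<prec>\<prec>\<close> 50) where
  "F \<prec>\<prec> F' \<longleftrightarrow> (\<forall>s\<in>F. \<forall>t\<in>F'. s \<prec> t)"

definition prefixes_of :: "nat list set \<Rightarrow> nat list set" where
  "prefixes_of F = {take m s | m s. s \<in> F \<and> 1 \<le> m \<and> m \<le> length s}"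

definition first_members :: "nat \<Rightarrow> nat list set \<Rightarrow> nat list set" where
  "first_members k S = {s \<in> S. finite {t \<in> S. t \<prec> s} \<and> card {t \<in> S. t \<prec> s} < k}"

definition nu :: "nat set set \<Rightarrow> nat list \<Rightarrow> nat" where
  "nu B s = card {t \<in> sigma ` initial_segments B. t \<prec> s}"

text \<open>Counting predecessors is the order isomorphism onto the natural numbers.\<close>

lemma nu_eq_order_isomorphism:
  assumes bij: "bij_betw f (sigma ` initial_segments B) UNIV"
    and mono: "\<And>s t. s \<in> sigma ` initial_segments B \<Longrightarrow> t \<in> sigma ` initial_segments B \<Longrightarrow>
                 s \<prec> t \<longleftrightarrow> f s < f t"
    and s: "s \<in> sigma ` initial_segments B"
  shows "nu B s = (f s :: nat)"
proof -
  let ?S = "sigma ` initial_segments B"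
  have "f ` {t \<in> ?S. t \<prec> s} = {..<f s}"
  proof
    show "f ` {t \<in> ?S. t \<prec> s} \<subseteq> {..<f s}"
      using mono s by blast
    show "{..<f s} \<subseteq> f ` {t \<in> ?S. t \<prec> s}"
    proof
      fix n assume n: "n \<in> {..<f s}"
      have "n \<in> f ` ?S"
        using bij by (simp add: bij_betw_def)
      then obtain t where "t \<in> ?S" "n = f t"
        by blast
      then show "n \<in> f ` {t \<in> ?S. t \<prec> s}"
        using n mono s by blast
    qed
  qed
  moreover have "inj_on f {t \<in> ?S. t \<prec> s}"
    using bij by (auto simp: bij_betw_def intro: inj_on_subset)
  ultimately show ?thesis
    unfolding nu_def by (metis card_image card_lessThan)
qed

definition psi :: "nat set set \<Rightarrow> nat list \<Rightarrow> nat set" where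
  "psi B s = {nu B (take m s) | m. 1 \<le> m \<and> m \<le> length s}"

section \<open>Domain spaces\<close>

definition shifted_section :: "nat set set \<Rightarrow> nat \<Rightarrow> nat set set" where
  "shifted_section B n = (\<lambda>a. (\<lambda>c. c - (n + 1)) ` a) ` section_at B n"

definition upsilon :: "nat \<Rightarrow> nat list \<Rightarrow> nat list" where
  "upsilon n s = n # map (\<lambda>x. x + n) s"

lemma upsilon_sigma:
  assumes "finite c"
  shows "upsilon n (sigma c) = sigma (insert n ((\<lambda>x. x + n + 1) ` c))"
proof -
  let ?g = "\<lambda>x. x + n + 1" and ?xs = "sorted_list_of_set c"
  have fin: "finite (?g ` c)"
    using assms by simp
  have card_g: "card (?g ` c) = card c"
    by (rule card_image) (simp add: inj_on_def)
  have "n \<notin> ?g ` c"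
    by auto
  then have card_ins: "card (insert n (?g ` c)) = Suc (card c)"
    using fin card_g by simp
  have "sorted (n # map ?g ?xs)"
    using assms by (auto simp: sorted_map intro: sorted_wrt_mono_rel[OF _ sorted_sorted_list_of_set])
  moreover have "distinct (n # map ?g ?xs)"
    using assms by (auto simp: distinct_map inj_on_def)
  moreover have "set (n # map ?g ?xs) = insert n (?g ` c)"
    using assms by simp
  ultimately have slist: "sorted_list_of_set (insert n (?g ` c)) = n # map ?g ?xs"
    by (metis sorted_list_of_set.idem_if_sorted_distinct)
  have "sigma (insert n (?g ` c)) =
      map (\<lambda>i. (n # map ?g ?xs) ! i - i) (0 # map Suc [0..<card c])"
    unfolding sigma_def card_ins slist by (simp add: upt_conv_Cons map_Suc_upt del: upt_Suc)
  also have "\<dots> = n # map (\<lambda>i. ?xs ! i + n - i) [0..<card c]"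
    using assms by simp
  also have "map (\<lambda>i. ?xs ! i + n - i) [0..<card c] = map (\<lambda>i. ?xs ! i - i + n) [0..<card c]"
  proof (rule map_cong[OF refl])
    fix i assume "i \<in> set [0..<card c]"
    then have "i < length ?xs"
      using assms by simp
    moreover have "sorted_wrt (<) ?xs"
      by simp
    ultimately have "i \<le> ?xs ! i"
      by (rule sorted_wrt_less_idx[rotated])
    then show "?xs ! i + n - i = ?xs ! i - i + n"
      by simp
  qed
  finally show ?thesis
    by (simp add: upsilon_def sigma_def)
qed

definition row :: "nat list set \<Rightarrow> nat \<Rightarrow> nat list set" where
  "row S n = {s \<in> S. s \<noteq> [] \<and> s ! 0 = n}"

definition row_index :: "nat list set \<Rightarrow> nat \<Rightarrow> nat" where
  "row_index S i = enumerate {n. row S n \<noteq> {}} i"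

text \<open>
  \<open>combine A k S\<close> is the \<open>k\<close>-th full approximation of \<open>S\<close>, where \<open>A n j T\<close> is the
  \<open>j\<close>-th one of the row \<open>T\<close> with first entry \<open>n\<close>.
\<close>

primrec combine ::
  "(nat \<Rightarrow> nat \<Rightarrow> nat list set \<Rightarrow> nat list set) \<Rightarrow> nat \<Rightarrow> nat list set \<Rightarrow> nat list set" where
  "combine A 0 S = {}"
| "combine A (Suc k) S =
     combine A k S \<union>
     (\<Union>i\<le>k. A (row_index S i) (k + 1 - i) (row S (row_index S i)))"

text \<open>
  The barriers of rank 0 and 1 are exactly \<open>{{}}\<close> and the set of all singletons. The
  recursion terminates on uniform barriers (lemmas \<open>full_approx_dom_uniform\<close> and
  \<open>domain_space_dom_uniform\<close> below).
\<close>

function (domintros) full_approx :: "nat set set \<Rightarrow> nat \<Rightarrow> nat list set \<Rightarrow> nat list set" where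
  "full_approx B =
     (if B = {{}} then (\<lambda>k S. if k = 0 then {} else {[]})
      else if B = range (\<lambda>n. {n}) then first_members
      else combine (\<lambda>n k T. upsilon n ` full_approx (shifted_section B n) k (upsilon n -` T)))"
  by pat_completeness auto

definition row_approx :: "nat set set \<Rightarrow> nat \<Rightarrow> nat \<Rightarrow> nat list set \<Rightarrow> nat list set" where
  "row_approx B n k T = upsilon n ` full_approx (shifted_section B n) k (upsilon n -` T)"

text \<open>
  \<open>well_interleaved\<close> says that at stage \<open>k + 1\<close> the nodes new in the rows
  \<open>n\<^sub>0, \<dots>, n\<^sub>k\<close> come after the \<open>k\<close>-th full approximation, row after row in this order.
  In the second clause row \<open>n\<^sub>i\<^sub>-\<^sub>1\<close> occurs with its approximation at the same stage, of
  index \<open>k + 1 - (i - 1)\<close>. With only the approximation of index \<open>k - i\<close> there (which is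
  contained in \<open>full_approx B k S\<close>), the relative order of the new nodes would be left open,
  and already for the barrier of all two-element sets the space would not be Ramsey: the set
  of members whose first element lies in their first row would be a closed set meeting
  \<open>[{}, Y]\<close> and its complement for every \<open>Y\<close>. The term \<open>full_approx B k S\<close> in the second
  clause follows from the rest unless row \<open>n\<^sub>0\<close> has rank 0; then that row has no new nodes and
  the first clause is vacuous.
\<close>

definition well_interleaved :: "nat set set \<Rightarrow> nat list set \<Rightarrow> bool" where
  "well_interleaved B S \<longleftrightarrow>
     (let n = row_index S; a = (\<lambda>i j. row_approx B (n i) j (row S (n i))) in
      \<forall>k\<ge>1.
        full_approx B k S \<prec>\<prec> prefixes_of (a 0 (k + 1)) - prefixes_of (full_approx B k S) \<and>
        (\<forall>i. 1 \<le> i \<and> i \<le> k \<longrightarrow>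
           full_approx B k S \<union> a (i - 1) (k + 2 - i)
             \<prec>\<prec> prefixes_of (a i (k + 1 - i)) - prefixes_of (a i (k - i))))"

function (domintros) domain_space :: "nat set set \<Rightarrow> nat list set set" where
  "domain_space B =
     (if B = {{}} then {{[]}}
      else if B = range (\<lambda>n. {n}) then {S. S \<subseteq> sigma ` B \<and> infinite S}
      else {S. S \<subseteq> sigma ` B \<and> infinite {n. row S n \<noteq> {}} \<and>
               (\<forall>n. row S n \<noteq> {} \<longrightarrow>
                  row S n \<in> (\<lambda>T. upsilon n ` T) ` domain_space (shifted_section B n)) \<and>
               well_interleaved B S})"
  by pat_completeness auto

text \<open>Both recursions terminate on uniform barriers.\<close>

inductive ranked :: "nat set set \<Rightarrow> bool" where
  "B = {{}} \<or> (\<forall>n. ranked (shifted_section B n)) \<Longrightarrow> ranked B"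
monos disj_mono

lemma ranked_full_approx_dom: "ranked B \<Longrightarrow> full_approx_dom B"
proof (induction rule: ranked.induct)
  case (1 B)
  then show ?case
    by (intro full_approx.domintros) auto
qed

lemma ranked_domain_space_dom: "ranked B \<Longrightarrow> domain_space_dom B"
proof (induction rule: ranked.induct)
  case (1 B)
  then show ?case
    by (intro domain_space.domintros) auto
qed

lemma shifted_section_translate:
  fixes m :: nat
  shows "shifted_section ((\<lambda>a. (\<lambda>x. x - m) ` a) ` {a \<in> B. finite a \<and> a \<subseteq> {m..}}) n =
    (\<lambda>a. (\<lambda>x. x - (n + m + 1)) ` a) ` {a \<in> section_at B (n + m). finite a \<and> a \<subseteq> {n + m + 1..}}"
    (is "?L = ?R")
proof
  show "?L \<subseteq> ?R"
  proof
    fix y assume "y \<in> ?L"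
    then obtain a b where a: "y = (\<lambda>c. c - (n + 1)) ` a" "\<forall>x\<in>a. n < x"
      and b: "insert n a = (\<lambda>x. x - m) ` b" "b \<in> B" "finite b" "b \<subseteq> {m..}"
      by (auto simp: shifted_section_def section_at_def)
    have "b = (\<lambda>x. x + m) ` (\<lambda>x. x - m) ` b"
      using b(4) by (force simp: image_iff)
    then have b': "b = insert (n + m) ((\<lambda>x. x + m) ` a)"
      unfolding b(1)[symmetric] by simp
    let ?c = "(\<lambda>x. x + m) ` a"
    have "?c \<in> section_at B (n + m)" "finite ?c" "?c \<subseteq> {n + m + 1..}"
      using a(2) b(2,3) b' by (auto simp: section_at_def)
    moreover have "y = (\<lambda>x. x - (n + m + 1)) ` ?c"
      unfolding a(1) image_image by (rule image_cong) auto
    ultimately show "y \<in> ?R"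
      by blast
  qed
next
  show "?R \<subseteq> ?L"
  proof
    fix y assume "y \<in> ?R"
    then obtain c where c: "y = (\<lambda>x. x - (n + m + 1)) ` c" "c \<in> section_at B (n + m)"
      "finite c" "c \<subseteq> {n + m + 1..}"
      by auto
    let ?a = "(\<lambda>x. x - m) ` c"
    have "insert (n + m) c \<in> {a \<in> B. finite a \<and> a \<subseteq> {m..}}"
      using c by (auto simp: section_at_def)
    moreover have "insert n ?a = (\<lambda>x. x - m) ` insert (n + m) c"
      by simp
    ultimately have "insert n ?a \<in> (\<lambda>a. (\<lambda>x. x - m) ` a) ` {a \<in> B. finite a \<and> a \<subseteq> {m..}}"
      by blast
    moreover have "\<forall>x\<in>?a. n < x"
      using c(4) by force
    ultimately have "?a \<in> section_at ((\<lambda>a. (\<lambda>x. x - m) ` a) ` {a \<in> B. finite a \<and> a \<subseteq> {m..}}) n"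
      using c(3) by (simp add: section_at_def)
    moreover have "y = (\<lambda>x. x - (n + 1)) ` ?a"
      unfolding c(1) image_image by (rule image_cong) auto
    ultimately show "y \<in> ?L"
      unfolding shifted_section_def by blast
  qed
qed

lemma uniform_on_ranked:
  assumes "uniform_on \<alpha> M B" "M = {m..}"
  shows "ranked ((\<lambda>a. (\<lambda>x. x - m) ` a) ` {a \<in> B. finite a \<and> a \<subseteq> {m..}})"
  using assms
proof (induction arbitrary: m rule: uniform_on.induct)
  case (zero M)
  have "(\<lambda>a. (\<lambda>x. x - m) ` a) ` {a \<in> {{}}. finite a \<and> a \<subseteq> {m..}} = {{}}"
    by auto
  then show ?case
    using ranked.intros by metis
next
  case (succ M \<beta> \<alpha> B)
  have "{m..} - {..n + m} = {n + m + 1..}" for n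
    by auto
  then have "ranked (shifted_section ((\<lambda>a. (\<lambda>x. x - m) ` a) ` {a \<in> B. finite a \<and> a \<subseteq> {m..}}) n)" for n
    unfolding shifted_section_translate using succ.IH[of "n + m" "n + m + 1"] succ.prems by simp
  then show ?case
    using ranked.intros by blast
next
  case (limit M \<alpha> s B)
  have "{m..} - {..n + m} = {n + m + 1..}" for n
    by auto
  then have "ranked (shifted_section ((\<lambda>a. (\<lambda>x. x - m) ` a) ` {a \<in> B. finite a \<and> a \<subseteq> {m..}}) n)" for n
    unfolding shifted_section_translate using limit.IH[of "n + m" "n + m + 1"] limit.prems by simp
  then show ?case
    using ranked.intros by blast
qed

lemma uniform_barrier_ranked:
  assumes "uniform_barrier B"
  shows "ranked B"
proof -
  obtain \<alpha> where "uniform_on \<alpha> UNIV B" and fin: "\<forall>b\<in>B. finite b"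
    using assms by (auto simp: uniform_barrier_def barrier_def)
  then have "ranked ((\<lambda>a. (\<lambda>x. x - 0) ` a) ` {a \<in> B. finite a \<and> a \<subseteq> {0..}})"
    by (intro uniform_on_ranked) auto
  moreover have "{a \<in> B. finite a \<and> a \<subseteq> {0..}} = B"
    using fin by auto
  ultimately show ?thesis
    by simp
qed

lemmas full_approx_dom_uniform = ranked_full_approx_dom[OF uniform_barrier_ranked]
lemmas domain_space_dom_uniform = ranked_domain_space_dom[OF uniform_barrier_ranked]

section \<open>The spaces\<close>

definition ellentuck_space :: "nat set set \<Rightarrow> nat set set set" where
  "ellentuck_space B = (\<lambda>S. psi B ` S) ` domain_space B"

text \<open>
  Since \<open>psi B\<close> is injective on \<open>sigma ` B\<close> for a barrier \<open>B\<close>, the set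
  \<open>{s \<in> sigma ` B. psi B s \<in> X}\<close> is the \<open>S\<close> with \<open>X = psi B ` S\<close>.
\<close>

definition restriction :: "nat set set \<Rightarrow> nat \<Rightarrow> nat set set \<Rightarrow> nat set set" where
  "restriction B k X = psi B ` first_members k {s \<in> sigma ` B. psi B s \<in> X}"

end

theory Submission
  imports Defs
begin

text \<open>
  Assign to each node of the tree of a set of sequences its address, the sequence of its positions
  among its siblings, coded again as a non-decreasing sequence. The full approximations of \<open>S\<close>
  consist of the members with bounded address, and by induction on \<open>B\<close> the interleaving conditions
  say precisely that \<open>S\<close> is an infinitely branching subtree on which the passage to addresses
  preserves \<open>\<prec>\<close>. In this description members of the space are built one sequence at a time: the
  next one is attached to the node whose next child has the least address, through any child
  beyond the nodes used so far. Hence every infinitely branching set contains a member of the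
  space extending a given finite approximation, which gives amalgamation. The pigeonhole
  principle needs only that at each node one of two colours occurs above infinitely many children.
  The rest is the usual combinatorial forcing for Ellentuck-type theorems.
\<close>

text \<open>Why addresses fit: the address of a node in row number \<open>i\<close> is its address
  inside the row with \<open>i\<close> added to every entry and put in front, while the recursion
  lets row \<open>i\<close> enter stage \<open>k\<close> with index \<open>k - i\<close>. Hence at
  every depth the \<open>k\<close>-th full approximation is cut out by one condition, that the
  largest entry of the address is below \<open>k\<close>. The obstacle is that approximations
  consist of members, whereas addresses live on all nodes of the tree. The bridge is the leftmost
  leaf above a node: its address only repeats the largest entry, so it appears at the same stage,
  and whatever lies between the node and this leaf is above the node. Therefore initial segments of
  members are initial segments of nodes, and old addresses never change. The interleaving clauses
  relate only different stages or consecutive rows. Distant rows are linked by chains through the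
  rows between, which have members with any prescribed largest address entry; a row of rank 0 lacks
  them, but beyond rank 1 it can only be the first row and is never in between.\<close>

no_notation lesspoll (infixl \<open>\<prec>\<close> 50)

section \<open>Abstract Ellentuck theorem\<close>

lemma finite_subset_incseq:
  fixes A :: "nat \<Rightarrow> 'b set"
  assumes "\<And>m n. m \<le> n \<Longrightarrow> A m \<subseteq> A n"
  shows "finite U \<Longrightarrow> U \<subseteq> (\<Union>n. A n) \<Longrightarrow> \<exists>n. U \<subseteq> A n"
proof (induction U rule: finite_induct)
  case (insert x U)
  then obtain n n' where "U \<subseteq> A n" "x \<in> A n'"
    by auto
  then have "insert x U \<subseteq> A (max n n')"
    using assms[of n "max n n'"] assms[of n' "max n n'"] by auto
  then show ?case ..
qed auto

text \<open>Todorcevic's axioms in a form for sets ordered by inclusion: an approximation is a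
  finite subset of its set, and its index is its cardinality. The depth of \<open>r m Y\<close> in
  \<open>X\<close> is the least \<open>d\<close> with \<open>r m Y \<subseteq> r d X\<close>;
  \<open>amalgamate\<close> then says that \<open>[r m Y, X'] \<subseteq> [r m Y, Y]\<close> for
  some \<open>X'\<close> in \<open>[r d X, X]\<close>.\<close>

locale approximation_space =
  fixes E :: "'a set set" and r :: "nat \<Rightarrow> 'a set \<Rightarrow> 'a set"
  assumes finite_r: "X \<in> E \<Longrightarrow> finite (r n X)"
    and card_r: "X \<in> E \<Longrightarrow> card (r n X) = n"
    and r_mono: "X \<in> E \<Longrightarrow> m \<le> n \<Longrightarrow> r m X \<subseteq> r n X"
    and Union_r: "X \<in> E \<Longrightarrow> (\<Union>n. r n X) = X"
    and r_coherent: "X \<in> E \<Longrightarrow> Y \<in> E \<Longrightarrow> r n X = r n Y \<Longrightarrow> m \<le> n \<Longrightarrow> r m X = r m Y"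
    and limit: "(\<And>n. Xs n \<in> E) \<Longrightarrow> (\<And>n. r n (Xs (Suc n)) = r n (Xs n)) \<Longrightarrow>
      \<exists>Y\<in>E. \<forall>n. r n Y = r n (Xs n)"
    and extend: "Z \<in> E \<Longrightarrow> X \<in> E \<Longrightarrow> r m Z \<subseteq> X \<Longrightarrow> \<exists>Y\<in>E. Y \<subseteq> X \<and> r m Y = r m Z"
    and amalgamate: "X \<in> E \<Longrightarrow> Y \<in> E \<Longrightarrow> Y \<subseteq> X \<Longrightarrow> r m Y \<subseteq> r d X \<Longrightarrow>
      (\<And>k. k < d \<Longrightarrow> \<not> r m Y \<subseteq> r k X) \<Longrightarrow>
      \<exists>X'\<in>E. X' \<subseteq> X \<and> r d X' = r d X \<and> (\<forall>Z\<in>E. Z \<subseteq> X' \<longrightarrow> r m Z = r m Y \<longrightarrow> Z \<subseteq> Y)"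
    and pigeonhole: "X \<in> E \<Longrightarrow>
      \<exists>Y\<in>E. Y \<subseteq> X \<and> r m Y = r m X \<and>
        ((\<forall>Z\<in>E. Z \<subseteq> Y \<longrightarrow> r m Z = r m X \<longrightarrow> P (r (Suc m) Z)) \<or>
         (\<forall>Z\<in>E. Z \<subseteq> Y \<longrightarrow> r m Z = r m X \<longrightarrow> \<not> P (r (Suc m) Z)))"
begin

section \<open>Basic neighbourhoods and fusion\<close>

abbreviation nb :: "'a set \<Rightarrow> 'a set \<Rightarrow> 'a set set" where
  "nb u X \<equiv> basic_set E (\<subseteq>) r u X"

lemma r_subset: "X \<in> E \<Longrightarrow> r n X \<subseteq> X"
  using Union_r by blast

lemma r_eq_imp_index_eq: "X \<in> E \<Longrightarrow> Y \<in> E \<Longrightarrow> r n X = r m Y \<Longrightarrow> n = m"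
  using card_r[of X n] card_r[of Y m] by simp

lemma in_nb_r: "Z \<in> E \<Longrightarrow> Y \<in> nb (r m Z) X \<longleftrightarrow> Y \<in> E \<and> Y \<subseteq> X \<and> r m Y = r m Z"
proof -
  assume Z: "Z \<in> E"
  have "n = m" if "Y \<in> E" "r n Y = r m Z" for n
    using r_eq_imp_index_eq[OF that(1) Z that(2)] .
  then show ?thesis
    unfolding basic_set_def by auto
qed

lemma nb_mono: "X \<subseteq> Y \<Longrightarrow> nb u X \<subseteq> nb u Y"
  unfolding basic_set_def by fast

lemma nb_refl: "X \<in> E \<Longrightarrow> X \<in> nb (r m X) X"
  by (simp add: in_nb_r)

lemma nb_longer: "X \<in> E \<Longrightarrow> m \<le> n \<Longrightarrow> nb (r n X) Y \<subseteq> nb (r m X) Y"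
proof
  fix Z assume X: "X \<in> E" and mn: "m \<le> n" and "Z \<in> nb (r n X) Y"
  then have Z: "Z \<in> E" "Z \<subseteq> Y" "r n Z = r n X"
    by (simp_all add: in_nb_r)
  have "r m Z = r m X"
    by (rule r_coherent[OF Z(1) X Z(3) mn])
  then show "Z \<in> nb (r m X) Y"
    using X Z by (simp add: in_nb_r)
qed

text \<open>Only finitely many approximations have depth \<open>n\<close> in \<open>X\<close>, being
  subsets of the finite set \<open>r n X\<close>. They are treated one after another:
  \<open>extend\<close> reaches the approximation, \<open>dense\<close> shrinks to a good set,
  \<open>amalgamate\<close> carries this back without touching \<open>r n X\<close>, and
  \<open>anti\<close> keeps what was achieved before.\<close>

lemma fusion_step:
  assumes X: "X \<in> E" "X \<subseteq> X0"
    and anti: "\<And>v S S'. G v S \<Longrightarrow> S' \<subseteq> S \<Longrightarrow> G v S'"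
    and dense: "\<And>X m. X \<in> E \<Longrightarrow> X \<subseteq> X0 \<Longrightarrow> \<exists>Y\<in>nb (r m X) X. G (r m X) (nb (r m X) Y)"
  shows "\<exists>X'\<in>E. X' \<subseteq> X \<and> r n X' = r n X \<and>
    (\<forall>Z\<in>E. \<forall>m. r m Z \<subseteq> r n X \<longrightarrow> (\<forall>k<n. \<not> r m Z \<subseteq> r k X) \<longrightarrow> G (r m Z) (nb (r m Z) X'))"
proof -
  define V where "V = {v. v \<subseteq> r n X \<and> (\<forall>k<n. \<not> v \<subseteq> r k X) \<and> (\<exists>Z\<in>E. \<exists>m. v = r m Z)}"
  have "finite V"
    by (rule finite_subset[of _ "Pow (r n X)"]) (auto simp: V_def finite_r X)
  have "\<exists>X'\<in>E. X' \<subseteq> X \<and> r n X' = r n X \<and> (\<forall>v\<in>U. G v (nb v X'))" 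
    if "finite U" "U \<subseteq> V" for U
    using that
  proof (induction U)
    case empty
    show ?case
      using X(1) by auto
  next
    case (insert v U)
    then obtain X' where X': "X' \<in> E" "X' \<subseteq> X" "r n X' = r n X" "\<And>v. v \<in> U \<Longrightarrow> G v (nb v X')"
      by auto
    have "v \<in> V"
      using insert.prems by simp
    then obtain Z m where v: "v \<subseteq> r n X" "\<And>k. k < n \<Longrightarrow> \<not> v \<subseteq> r k X" "Z \<in> E" "v = r m Z"
      unfolding V_def by blast
    have nb_v: "W \<in> nb v Y \<longleftrightarrow> W \<in> E \<and> W \<subseteq> Y \<and> r m W = v" for W Y
      unfolding v(4) by (rule in_nb_r[OF v(3)])
    have "r m Z \<subseteq> X'"
      using v(1,4) X'(3) r_subset[OF X'(1), of n] by simp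
    from extend[OF v(3) X'(1) this]
    obtain Y1 where Y1: "Y1 \<in> E" "Y1 \<subseteq> X'" "r m Y1 = v"
      unfolding v(4) by blast
    have "Y1 \<subseteq> X0"
      using X(2) X'(2) Y1(2) by order
    from dense[OF Y1(1) this, of m]
    obtain Y2 where "Y2 \<in> nb v Y1" and GY2: "G v (nb v Y2)"
      unfolding Y1(3) by (rule bexE)
    then have Y2: "Y2 \<in> E" "Y2 \<subseteq> Y1" "r m Y2 = v"
      by (simp_all add: nb_v)
    \<comment> \<open>\<open>amalgamate\<close> asks for \<open>n\<close> to be the depth of
      \<open>v\<close> in the current \<open>X'\<close>; it is, because \<open>X'\<close> and
      \<open>X\<close> agree up to \<open>n\<close>.\<close>
    have "\<not> r m Y2 \<subseteq> r k X'" if "k < n" for k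
    proof -
      have "r k X' = r k X"
        by (rule r_coherent[OF \<open>X' \<in> E\<close> \<open>X \<in> E\<close> X'(3)]) (use that in simp)
      then show ?thesis
        using v(2)[OF that] Y2(3) by simp
    qed
    moreover have "r m Y2 \<subseteq> r n X'"
      unfolding X'(3) Y2(3) by (fact v(1))
    moreover have "Y2 \<subseteq> X'"
      using Y2(2) Y1(2) by (rule subset_trans)
    ultimately have "\<exists>X''\<in>E. X'' \<subseteq> X' \<and> r n X'' = r n X' \<and>
        (\<forall>Z\<in>E. Z \<subseteq> X'' \<longrightarrow> r m Z = r m Y2 \<longrightarrow> Z \<subseteq> Y2)"
      by (intro amalgamate X' Y2)
    then obtain X'' where X'': "X'' \<in> E" "X'' \<subseteq> X'" "r n X'' = r n X'"
      "\<And>Z. Z \<in> E \<Longrightarrow> Z \<subseteq> X'' \<Longrightarrow> r m Z = v \<Longrightarrow> Z \<subseteq> Y2"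
      unfolding Y2(3) by blast
    have "nb v X'' \<subseteq> nb v Y2"
      by (rule subsetI) (simp add: nb_v X''(4))
    then have "G v (nb v X'')"
      by (rule anti[OF GY2])
    moreover have "G w (nb w X'')" if "w \<in> U" for w
      using X'(4)[OF that] nb_mono[OF X''(2)] by (rule anti)
    moreover have "X'' \<subseteq> X" "r n X'' = r n X"
      using X'' X' by auto
    ultimately show ?case
      by (intro bexI[OF _ X''(1)] conjI ballI) auto
  qed
  from this[OF \<open>finite V\<close>] obtain X' where X': "X' \<in> E" "X' \<subseteq> X" "r n X' = r n X" "\<forall>v\<in>V. G v (nb v X')"
    by blast
  moreover have "G (r m Z) (nb (r m Z) X')"
    if "Z \<in> E" "r m Z \<subseteq> r n X" "\<forall>k<n. \<not> r m Z \<subseteq> r k X" for Z m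
    using X'(4) that unfolding V_def by blast
  ultimately show ?thesis
    by (intro bexI[OF _ X'(1)]) auto
qed

text \<open>An approximation of depth \<open>n\<close> in the limit \<open>Y\<close> was handled in
  stage \<open>n\<close>, because \<open>Y\<close> agrees with that stage up to \<open>n\<close> and
  lies inside the next one.\<close>

lemma fusion:
  assumes X0: "X0 \<in> E"
    and anti: "\<And>v S S'. G v S \<Longrightarrow> S' \<subseteq> S \<Longrightarrow> G v S'"
    and dense: "\<And>X m. X \<in> E \<Longrightarrow> X \<subseteq> X0 \<Longrightarrow> \<exists>Y\<in>nb (r m X) X. G (r m X) (nb (r m X) Y)"
  shows "\<exists>Y\<in>E. Y \<subseteq> X0 \<and> r k Y = r k X0 \<and>
    (\<forall>Z\<in>E. Z \<subseteq> Y \<longrightarrow> (\<forall>m\<ge>k. G (r m Z) (nb (r m Z) Y)))"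
proof -
  \<comment> \<open>Stages below \<open>k\<close> are idle, so that \<open>r k X0\<close> survives
    into the limit.\<close>
  define step where "step n X X' \<longleftrightarrow> X' \<subseteq> X \<and> r n X' = r n X \<and> (n < k \<longrightarrow> X' = X) \<and>
    (n \<ge> k \<longrightarrow> (\<forall>Z\<in>E. \<forall>m. r m Z \<subseteq> r n X \<longrightarrow> (\<forall>j<n. \<not> r m Z \<subseteq> r j X) \<longrightarrow>
      G (r m Z) (nb (r m Z) X')))" for n X X'
  have "\<exists>X'. (X' \<in> E \<and> X' \<subseteq> X0) \<and> step n X X'" if X: "X \<in> E" "X \<subseteq> X0" for X n
  proof (cases "n < k")
    case True
    then show ?thesis
      using X by (intro exI[of _ X]) (simp add: step_def)
  next
    case False
    have "\<exists>X'\<in>E. X' \<subseteq> X \<and> r n X' = r n X \<and> (\<forall>Z\<in>E. \<forall>m. r m Z \<subseteq> r n X \<longrightarrow>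
      (\<forall>k<n. \<not> r m Z \<subseteq> r k X) \<longrightarrow> G (r m Z) (nb (r m Z) X'))"
      by (rule fusion_step[OF X], rule anti, assumption+, rule dense, assumption+)
    then obtain X' where "X' \<in> E" "X' \<subseteq> X" "r n X' = r n X"
      "\<forall>Z\<in>E. \<forall>m. r m Z \<subseteq> r n X \<longrightarrow> (\<forall>k<n. \<not> r m Z \<subseteq> r k X) \<longrightarrow> G (r m Z) (nb (r m Z) X')"
      by (elim bexE conjE)
    moreover from this have "X' \<subseteq> X0"
      using X(2) by blast
    ultimately have "(X' \<in> E \<and> X' \<subseteq> X0) \<and> step n X X'"
      unfolding step_def using False by simp
    then show ?thesis ..
  qed
  then have "\<exists>Xs. \<forall>n. ((Xs n \<in> E \<and> Xs n \<subseteq> X0) \<and> (n = 0 \<longrightarrow> Xs n = X0)) \<and> step n (Xs n) (Xs (Suc n))"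
    by (intro dependent_nat_choice) (use X0 in auto)
  then obtain Xs where Xs: "Xs 0 = X0" "\<And>n. Xs n \<in> E \<and> Xs n \<subseteq> X0" "\<And>n. step n (Xs n) (Xs (Suc n))"
    by blast
  then obtain Y where Y: "Y \<in> E" "\<And>n. r n Y = r n (Xs n)"
    using limit[of Xs] by (auto simp: step_def)
  have decr: "Xs (n + i) \<subseteq> Xs n" for n i
  proof (induction i)
    case (Suc i)
    moreover have "Xs (n + Suc i) \<subseteq> Xs (n + i)"
      using Xs(3)[of "n + i"] by (simp add: step_def)
    ultimately show ?case
      by (rule subset_trans[rotated])
  qed simp
  have Y_sub: "Y \<subseteq> Xs n" for n
  proof -
    have "r j Y \<subseteq> Xs n" for j
    proof (cases "j \<le> n")
      case True
      then show ?thesis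
        using r_mono[OF Y(1) True] r_subset[of "Xs n" n] Xs(2)[of n] unfolding Y(2)[of n] by blast
    next
      case False
      then show ?thesis
        using decr[of n "j - n"] r_subset[of "Xs j" j] Xs(2)[of j] unfolding Y(2)[of j] by simp
    qed
    then have "(\<Union>j. r j Y) \<subseteq> Xs n"
      by (rule UN_least)
    then show ?thesis
      unfolding Union_r[OF Y(1)] .
  qed
  have "n \<le> k \<longrightarrow> Xs n = X0" for n
  proof (induction n)
    case (Suc n)
    then show ?case
      using Xs(3)[of n] by (simp add: step_def)
  qed (simp add: Xs(1))
  then have "r k Y = r k X0"
    by (simp add: Y(2))
  moreover have "Y \<subseteq> X0"
    using Y_sub[of 0] Xs(1) by simp
  moreover have "G (r m Z) (nb (r m Z) Y)" if Z: "Z \<in> E" "Z \<subseteq> Y" and m: "m \<ge> k" for Z m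
  proof -
    let ?v = "r m Z"
    have sub: "?v \<subseteq> (\<Union>n. r n Y)"
      using r_subset[OF Z(1), of m] Z(2) unfolding Union_r[OF Y(1)] by (rule subset_trans)
    have "\<exists>n. ?v \<subseteq> r n Y"
      by (rule finite_subset_incseq[OF r_mono[OF Y(1)] finite_r[OF Z(1)] sub])
    then obtain n where n: "?v \<subseteq> r n Y" "\<And>j. j < n \<Longrightarrow> \<not> ?v \<subseteq> r j Y"
      using exists_least_iff[of "\<lambda>n. ?v \<subseteq> r n Y"] by blast
    \<comment> \<open>By cardinality the depth is at least \<open>m\<close>, hence at least
      \<open>k\<close>, so stage \<open>n\<close> was not idle.\<close>
    then have "m \<le> n"
      using card_mono[OF finite_r[OF Y(1)] n(1)] by (simp add: card_r Y(1) Z(1))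
    have coh: "r j (Xs n) = r j Y" if "j \<le> n" for j
      by (rule r_coherent[OF _ Y(1) Y(2)[symmetric] that]) (simp add: Xs(2))
    then have "G ?v (nb ?v (Xs (Suc n)))"
      using Xs(3)[of n] n m \<open>m \<le> n\<close> Z unfolding step_def by (simp add: coh)
    then show ?thesis
      by (rule anti) (rule nb_mono[OF Y_sub])
  qed
  ultimately show ?thesis
    by (intro bexI[OF _ Y(1)]) auto
qed

section \<open>The topology, Ramsey sets and Ramsey null sets\<close>

abbreviation "ram_top \<equiv> ramsey_topology E (\<subseteq>) r"

lemma openin_nb: "Z \<in> E \<Longrightarrow> X \<in> E \<Longrightarrow> openin ram_top (nb (r m Z) X)"
  unfolding ramsey_topology_def approximations_def
  by (rule topology_generated_by_Basis) blast

text \<open>The sets \<open>nb (r n W) W\<close> decrease with \<open>n\<close>, which settles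
  finite intersections, and a basic set \<open>nb u X\<close> containing \<open>W\<close> contains
  \<open>nb u W\<close> since \<open>W \<subseteq> X\<close>.\<close>

lemma openin_imp_nb:
  assumes "openin ram_top U" "W \<in> U"
  shows "W \<in> E \<and> (\<exists>n. nb (r n W) W \<subseteq> U)"
proof -
  have "generate_topology_on {nb u X | u X. u \<in> approximations E r \<and> X \<in> E} U"
    using assms(1) by (simp add: ramsey_topology_def openin_topology_generated_by_iff)
  then show ?thesis
    using assms(2)
  proof (induction arbitrary: W rule: generate_topology_on.induct)
    case (Int a b)
    then obtain n n' where *: "W \<in> E" "nb (r n W) W \<subseteq> a" "nb (r n' W) W \<subseteq> b"
      by blast
    then have "nb (r (max n n') W) W \<subseteq> a \<inter> b"
      using nb_longer[of W n "max n n'" W] nb_longer[of W n' "max n n'" W] by auto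
    then show ?case
      using * by blast
  next
    case (UN K)
    then show ?case
      by (metis UnionE Sup_upper subset_trans)
  next
    case (Basis s)
    then obtain u X where s: "s = nb u X"
      by blast
    then obtain n where "W \<in> E" "W \<subseteq> X" "r n W = u"
      using Basis by (auto simp: basic_set_def)
    then show ?case
      using s nb_mono by blast
  qed auto
qed

lemma topspace_top: "topspace ram_top = E"
proof
  show "topspace ram_top \<subseteq> E"
    using openin_imp_nb[OF openin_topspace] by blast
  show "E \<subseteq> topspace ram_top"
    using openin_nb nb_refl openin_subset by blast
qed

text \<open>It suffices to treat \<open>u = r m X\<close>: a nonempty \<open>nb u X\<close> has a
  member \<open>W\<close> with this approximation, and one can work below \<open>W\<close>.\<close>

lemma ramsey_setI:
  assumes "\<And>X m. X \<in> E \<Longrightarrow> \<exists>Y\<in>nb (r m X) X. nb (r m X) Y \<subseteq> \<X> \<or> nb (r m X) Y \<inter> \<X> = {}"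
  shows "ramsey_set E (\<subseteq>) r \<X>"
  unfolding ramsey_set_def
proof (intro ballI impI)
  fix u X assume "u \<in> approximations E r" "X \<in> E" and ne: "nb u X \<noteq> {}"
  then obtain W m where W: "W \<in> E" "W \<subseteq> X" "r m W = u"
    by (auto simp: basic_set_def)
  then obtain Y where "Y \<in> nb u W" "nb u Y \<subseteq> \<X> \<or> nb u Y \<inter> \<X> = {}"
    using assms[of W m] by auto
  then show "\<exists>Y\<in>nb u X. nb u Y \<subseteq> \<X> \<or> nb u Y \<inter> \<X> = {}"
    using nb_mono[OF W(2)] by blast
qed

lemma ramsey_nullI:
  assumes "\<And>X m. X \<in> E \<Longrightarrow> \<exists>Y\<in>nb (r m X) X. nb (r m X) Y \<inter> \<X> = {}"
  shows "ramsey_null E (\<subseteq>) r \<X>"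
  unfolding ramsey_null_def
proof (intro ballI impI)
  fix u X assume "u \<in> approximations E r" "X \<in> E" and ne: "nb u X \<noteq> {}"
  then obtain W m where W: "W \<in> E" "W \<subseteq> X" "r m W = u"
    by (auto simp: basic_set_def)
  then obtain Y where "Y \<in> nb u W" "nb u Y \<inter> \<X> = {}"
    using assms[of W m] by auto
  then show "\<exists>Y\<in>nb u X. nb u Y \<inter> \<X> = {}"
    using nb_mono[OF W(2)] by blast
qed

lemma ramsey_set_nb:
  assumes "ramsey_set E (\<subseteq>) r \<X>" "X \<in> E"
  shows "\<exists>Y\<in>nb (r m X) X. nb (r m X) Y \<subseteq> \<X> \<or> nb (r m X) Y \<inter> \<X> = {}"
  using assms nb_refl[OF assms(2), of m] unfolding ramsey_set_def approximations_def by blast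

lemma ramsey_null_nb:
  assumes "ramsey_null E (\<subseteq>) r \<X>" "X \<in> E"
  shows "\<exists>Y\<in>nb (r m X) X. nb (r m X) Y \<inter> \<X> = {}"
  using assms nb_refl[OF assms(2), of m] unfolding ramsey_null_def approximations_def by blast

text \<open>
  Combinatorial forcing: \<open>Y\<close> decides every \<open>v\<close>, and if it rejects \<open>v\<close>, then the pigeonhole
  principle makes a smaller set reject all one-step extensions of \<open>v\<close>.
\<close>

lemma open_ramsey:
  assumes U: "openin ram_top U"
  shows "ramsey_set E (\<subseteq>) r U"
proof (rule ramsey_setI)
  fix X k assume X: "X \<in> E"
  \<comment> \<open>For \<open>S = nb v Y\<close> this reads: \<open>Y\<close> accepts
    \<open>v\<close>, or nothing in \<open>S\<close> accepts it. Stated for \<open>S\<close>, it is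
    inherited by subsets, as fusion demands.\<close>
  define G where "G v S \<longleftrightarrow> S \<subseteq> U \<or> (\<forall>Y\<in>S. \<not> nb v Y \<subseteq> U)" for v S
  obtain Y where Y: "Y \<in> E" "Y \<subseteq> X" "r k Y = r k X"
    and dec: "\<And>Z m. Z \<in> E \<Longrightarrow> Z \<subseteq> Y \<Longrightarrow> m \<ge> k \<Longrightarrow> G (r m Z) (nb (r m Z) Y)"
  proof -
    have "\<exists>Y\<in>E. Y \<subseteq> X \<and> r k Y = r k X \<and>
        (\<forall>Z\<in>E. Z \<subseteq> Y \<longrightarrow> (\<forall>m\<ge>k. G (r m Z) (nb (r m Z) Y)))"
    proof (rule fusion[OF X])
      fix W m assume W: "W \<in> E"
      show "\<exists>Y\<in>nb (r m W) W. G (r m W) (nb (r m W) Y)"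
      proof (cases "\<exists>Y\<in>nb (r m W) W. nb (r m W) Y \<subseteq> U")
        case True
        then show ?thesis
          unfolding G_def by auto
      next
        case False
        then show ?thesis
          by (intro bexI[OF _ nb_refl[OF W]]) (simp add: G_def)
      qed
    qed (auto simp: G_def)
    then obtain Y where "Y \<in> E" "Y \<subseteq> X" "r k Y = r k X"
      "\<forall>Z\<in>E. Z \<subseteq> Y \<longrightarrow> (\<forall>m\<ge>k. G (r m Z) (nb (r m Z) Y))"
      by (elim bexE conjE)
    then show ?thesis
      by (intro that[of Y]) auto
  qed
  define rej where "rej v \<longleftrightarrow> (\<forall>Z\<in>nb v Y. \<not> nb v Z \<subseteq> U)" for v
  show "\<exists>Y\<in>nb (r k X) X. nb (r k X) Y \<subseteq> U \<or> nb (r k X) Y \<inter> U = {}"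
  proof (cases "rej (r k X)")
    case False
    then have "nb (r k X) Y \<subseteq> U"
      using dec[of Y k] Y unfolding rej_def G_def by auto
    then show ?thesis
      using Y X by (auto simp: in_nb_r)
  next
    case True
    \<comment> \<open>The index is read off as \<open>card v\<close>, since
      \<open>card (r m W) = m\<close>.\<close>
    define H where "H v S \<longleftrightarrow> (card v \<ge> k \<longrightarrow> rej v \<longrightarrow> (\<forall>Z\<in>S. rej (r (Suc (card v)) Z)))" for v S
    have "\<exists>Z\<in>nb (r m W) W. H (r m W) (nb (r m W) Z)" if W: "W \<in> E" "W \<subseteq> Y" for W m
    proof (cases "m \<ge> k \<and> rej (r m W)")
      case True
      obtain Z where Z: "Z \<in> E" "Z \<subseteq> W" "r m Z = r m W"
        and Z': "(\<forall>Z'\<in>E. Z' \<subseteq> Z \<longrightarrow> r m Z' = r m W \<longrightarrow> rej (r (Suc m) Z')) \<or>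
         (\<forall>Z'\<in>E. Z' \<subseteq> Z \<longrightarrow> r m Z' = r m W \<longrightarrow> \<not> rej (r (Suc m) Z'))"
        using pigeonhole[OF W(1), of m rej] by blast
      have "\<not> (\<forall>Z'\<in>E. Z' \<subseteq> Z \<longrightarrow> r m Z' = r m W \<longrightarrow> \<not> rej (r (Suc m) Z'))"
      proof
        assume *: "\<forall>Z'\<in>E. Z' \<subseteq> Z \<longrightarrow> r m Z' = r m W \<longrightarrow> \<not> rej (r (Suc m) Z')"
        \<comment> \<open>If no one-step extension were rejected, \<open>Y\<close> would accept each
          of them; their neighbourhoods cover \<open>nb (r m W) Z\<close>, so \<open>Z\<close> would
          accept \<open>r m W\<close>.\<close>
        have "nb (r m W) Z \<subseteq> U"
        proof
          fix Z' assume "Z' \<in> nb (r m W) Z"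
          then have "Z' \<in> E" "Z' \<subseteq> Z" "r m Z' = r m W"
            using in_nb_r[OF W(1)] by auto
          moreover from this have "nb (r (Suc m) Z') Y \<subseteq> U"
            using * dec[of Z' "Suc m"] True Z W unfolding rej_def G_def by (meson le_Suc_eq subset_trans)
          moreover have "Z' \<in> nb (r (Suc m) Z') Y"
            using calculation W Z by (auto simp: in_nb_r)
          ultimately show "Z' \<in> U"
            by blast
        qed
        moreover have "Z \<in> nb (r m W) Y"
          using Z W by (auto simp: in_nb_r)
        ultimately show False
          using True unfolding rej_def by blast
      qed
      then have "\<forall>Z'\<in>nb (r m W) Z. rej (r (Suc m) Z')"
        using Z' W by (auto simp: in_nb_r)
      then have "H (r m W) (nb (r m W) Z)"
        using W by (simp add: H_def card_r)
      then show ?thesis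
        using Z W by (auto simp: in_nb_r)
    next
      case False
      then show ?thesis
        using nb_refl W by (auto simp: H_def card_r)
    qed
    then have "\<exists>Z\<in>E. Z \<subseteq> Y \<and> r k Z = r k Y \<and>
        (\<forall>W\<in>E. W \<subseteq> Z \<longrightarrow> (\<forall>m\<ge>k. H (r m W) (nb (r m W) Z)))"
      by (intro fusion[OF Y(1)]) (auto simp: H_def)
    then obtain Z where Z: "Z \<in> E" "Z \<subseteq> Y" "r k Z = r k Y"
      and ZH: "\<And>W m. W \<in> E \<Longrightarrow> W \<subseteq> Z \<Longrightarrow> m \<ge> k \<Longrightarrow> H (r m W) (nb (r m W) Z)"
      by auto
    have "W \<notin> U" if "W \<in> nb (r k X) Z" for W
    proof
      assume "W \<in> U"
      have W: "W \<in> E" "W \<subseteq> Z" "r k W = r k X"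
        using that X by (auto simp: in_nb_r)
      \<comment> \<open>Rejection passes from \<open>r k X\<close> to all longer approximations of
        \<open>W\<close>, while openness of \<open>U\<close> makes \<open>W\<close> itself accept a
        long one.\<close>
      have rej: "rej (r (k + i) W)" for i
      proof (induction i)
        case 0
        then show ?case
          using True W by simp
      next
        case (Suc i)
        then show ?case
          using ZH[OF W(1,2), of "k + i"] W by (auto simp: H_def card_r in_nb_r)
      qed
      obtain n where "nb (r n W) W \<subseteq> U"
        using openin_imp_nb[OF U \<open>W \<in> U\<close>] by blast
      then have "nb (r (k + n) W) W \<subseteq> U"
        using nb_longer[OF W(1), of n "k + n" W] by auto
      moreover have "W \<in> nb (r (k + n) W) Y"
        using W Z by (auto simp: in_nb_r)
      ultimately show False
        using rej[of n] unfolding rej_def by blast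
    qed
    then show ?thesis
      using Z Y X by (intro bexI[of _ Z]) (auto simp: in_nb_r)
  qed
qed

text \<open>The complement of the closure is open, hence Ramsey; a neighbourhood inside the closure
  would be a nonempty open set there, against the empty interior.\<close>

lemma nowhere_dense_ramsey_null:
  assumes "nowhere_dense_in ram_top N"
  shows "ramsey_null E (\<subseteq>) r N"
proof (rule ramsey_nullI)
  fix X m assume X: "X \<in> E"
  let ?C = "ram_top closure_of N"
  have "N \<subseteq> ?C"
    using assms by (simp add: nowhere_dense_in_def closure_of_subset)
  have int: "ram_top interior_of ?C = {}"
    using assms by (simp add: nowhere_dense_in_def)
  have "openin ram_top (E - ?C)"
    using closedin_closure_of[of ram_top N] by (simp add: closedin_def topspace_top)
  then obtain Y where Y: "Y \<in> nb (r m X) X" "nb (r m X) Y \<subseteq> E - ?C \<or> nb (r m X) Y \<inter> (E - ?C) = {}"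
    using ramsey_set_nb[OF open_ramsey X] by blast
  have "Y \<in> E" "r m Y = r m X"
    using Y(1) X by (auto simp: in_nb_r)
  have False if "nb (r m X) Y \<inter> (E - ?C) = {}"
  proof -
    have "nb (r m X) Y \<subseteq> ?C"
      using that by (auto simp: basic_set_def)
    then have "nb (r m X) Y \<subseteq> ram_top interior_of ?C"
      using openin_nb[OF X \<open>Y \<in> E\<close>] by (simp add: interior_of_maximal)
    then show False
      using int nb_refl[OF \<open>Y \<in> E\<close>, of m] \<open>r m Y = r m X\<close> by auto
  qed
  then show "\<exists>Y\<in>nb (r m X) X. nb (r m X) Y \<inter> N = {}"
    using Y \<open>N \<subseteq> ?C\<close> by blast
qed

text \<open>At an approximation \<open>v\<close> fusion can take care of finitely many nowhere dense
  sets, here those with index at most \<open>card v\<close>. Every \<open>W\<close> in the final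
  neighbourhood has approximations of all cardinalities from \<open>k\<close> on, so it avoids all
  of them.\<close>

lemma meager_ramsey_null:
  assumes "meager_in ram_top M"
  shows "ramsey_null E (\<subseteq>) r M"
proof -
  obtain \<N> where \<N>: "countable \<N>" "\<And>N. N \<in> \<N> \<Longrightarrow> nowhere_dense_in ram_top N" "M = \<Union>\<N>"
    using assms by (auto simp: meager_in_def)
  obtain N :: "nat \<Rightarrow> 'a set set" where N: "M = (\<Union>i. N i)" "\<And>i. ramsey_null E (\<subseteq>) r (N i)"
  proof (cases "\<N> = {}")
    case True
    then have "M = (\<Union>i::nat. {})" "ramsey_null E (\<subseteq>) r {}"
      using \<N>(3) nb_refl by (auto intro!: ramsey_nullI)
    then show ?thesis
      by (rule that)
  next
    case False
    then have "M = (\<Union>i. from_nat_into \<N> i)"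
      using \<N> by simp
    moreover have "ramsey_null E (\<subseteq>) r (from_nat_into \<N> i)" for i
      using \<N>(2) nowhere_dense_ramsey_null from_nat_into[OF False] by blast
    ultimately show ?thesis
      by (rule that)
  qed
  show ?thesis
  proof (rule ramsey_nullI)
    fix X k assume X: "X \<in> E"
    define G where "G v S \<longleftrightarrow> (\<forall>i\<le>card v. S \<inter> N i = {})" for v :: "'a set" and S
    have anti: "G v S'" if "G v S" "S' \<subseteq> S" for v S S'
      using that unfolding G_def by blast
    have dense: "\<exists>Y\<in>nb (r m X) X. G (r m X) (nb (r m X) Y)" if X: "X \<in> E" for X m
    proof -
      have "\<exists>Y\<in>nb (r m X) X. \<forall>i<j. nb (r m X) Y \<inter> N i = {}" for j
      proof (induction j)
        case 0
        then show ?case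
          using nb_refl X by auto
      next
        case (Suc j)
        then obtain Y where Y: "Y \<in> nb (r m X) X" "\<And>i. i < j \<Longrightarrow> nb (r m X) Y \<inter> N i = {}"
          by auto
        then have "Y \<in> E" "r m Y = r m X"
          using X by (auto simp: in_nb_r)
        then obtain Z where Z: "Z \<in> nb (r m X) Y" "nb (r m X) Z \<inter> N j = {}"
          using ramsey_null_nb[OF N(2)[of j] \<open>Y \<in> E\<close>, of m] by auto
        have "nb (r m X) Z \<subseteq> nb (r m X) Y"
          by (rule nb_mono) (use Z(1) X in \<open>simp add: in_nb_r\<close>)
        then have "\<forall>i<Suc j. nb (r m X) Z \<inter> N i = {}"
          using Z Y by (auto simp: less_Suc_eq)
        moreover have "Z \<in> nb (r m X) X"
          using Z Y X by (auto simp: in_nb_r)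
        ultimately show ?case
          by blast
      qed
      from this[of "Suc m"] show ?thesis
        using X by (simp add: G_def card_r less_Suc_eq_le)
    qed
    have "\<exists>Y\<in>E. Y \<subseteq> X \<and> r k Y = r k X \<and>
        (\<forall>Z\<in>E. Z \<subseteq> Y \<longrightarrow> (\<forall>m\<ge>k. G (r m Z) (nb (r m Z) Y)))"
      by (rule fusion[OF X]) (erule (1) anti, erule dense)
    then obtain Y where Y: "Y \<in> E" "Y \<subseteq> X" "r k Y = r k X"
      and YG: "\<And>Z m. Z \<in> E \<Longrightarrow> Z \<subseteq> Y \<Longrightarrow> m \<ge> k \<Longrightarrow> G (r m Z) (nb (r m Z) Y)"
      by auto
    have "W \<notin> N i" if "W \<in> nb (r k X) Y" for W i
    proof -
      have W: "W \<in> E" "W \<subseteq> Y"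
        using that by (auto simp: basic_set_def)
      then have "W \<in> nb (r (k + i) W) Y"
        by (simp add: in_nb_r)
      moreover have "nb (r (k + i) W) Y \<inter> N i = {}"
        using YG[OF W, of "k + i"] W(1) by (simp add: G_def card_r)
      ultimately show ?thesis
        by blast
    qed
    then show "\<exists>Y\<in>nb (r k X) X. nb (r k X) Y \<inter> M = {}"
      using Y X N(1) by (intro bexI[of _ Y]) (auto simp: in_nb_r)
  qed
qed

text \<open>In a neighbourhood that avoids the meager difference the set coincides with an open set,
  and open sets are Ramsey.\<close>

theorem ellentuck: "topological_ramsey_space E (\<subseteq>) r"
  unfolding topological_ramsey_space_def
proof (intro conjI allI impI)
  fix \<X> assume "\<X> \<subseteq> E" "baire_property_in ram_top \<X>"
  then obtain U where U: "openin ram_top U" "meager_in ram_top ((\<X> - U) \<union> (U - \<X>))"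
    by (auto simp: baire_property_in_def)
  show "ramsey_set E (\<subseteq>) r \<X>"
  proof (rule ramsey_setI)
    fix X m assume X: "X \<in> E"
    obtain Y where Y: "Y \<in> nb (r m X) X" "nb (r m X) Y \<inter> ((\<X> - U) \<union> (U - \<X>)) = {}"
      using ramsey_null_nb[OF meager_ramsey_null[OF U(2)] X] by blast
    then have "Y \<in> E" "r m Y = r m X"
      using X by (auto simp: in_nb_r)
    then obtain Z where Z: "Z \<in> nb (r m X) Y" "nb (r m X) Z \<subseteq> U \<or> nb (r m X) Z \<inter> U = {}"
      using ramsey_set_nb[OF open_ramsey[OF U(1)], of Y m] by auto
    have "nb (r m X) Z \<subseteq> nb (r m X) Y"
      by (rule nb_mono) (use Z(1) X in \<open>simp add: in_nb_r\<close>)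
    moreover have "Z \<in> nb (r m X) X"
      using Z(1) Y(1) X by (auto simp: in_nb_r)
    moreover have "nb (r m X) Z \<subseteq> \<X> \<or> nb (r m X) Z \<inter> \<X> = {}"
      using calculation Y(2) Z(2) by blast
    ultimately show "\<exists>Y\<in>nb (r m X) X. nb (r m X) Y \<subseteq> \<X> \<or> nb (r m X) Y \<inter> \<X> = {}"
      by blast
  qed
qed (rule meager_ramsey_null)

end

section \<open>Non-decreasing sequences and their addresses\<close>

text \<open>With the value 0 at the empty sequence the special cases of \<open>\<prec>\<close> for
  \<open>[]\<close> disappear; see \<open>seq_less_iff\<close>.\<close>

definition mx :: "nat list \<Rightarrow> nat" where
  "mx s = Max (insert 0 (set s))"

lemma mx_simps [simp]:
  "mx [] = 0"
  "mx (x # s) = max x (mx s)"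
  "mx (s @ t) = max (mx s) (mx t)"
  by (simp_all add: mx_def insert_commute[of 0] Max_insert2 Un_insert_left[symmetric] flip: Max_Un del: Un_insert_left)

lemma mx_map_add: "s \<noteq> [] \<Longrightarrow> mx (map (\<lambda>x. x + n) s) = mx s + n"
  by (induction s rule: list_nonempty_induct) auto

lemma mx_upsilon [simp]: "mx (upsilon n s) = n + mx s"
  by (cases "s = []") (auto simp: upsilon_def mx_map_add)

lemma mx_replicate [simp]: "mx (replicate k n) = (if k = 0 then 0 else n)"
  by (induction k) auto

lemma seq_less_iff:
  "s \<prec> t \<longleftrightarrow> mx s < mx t \<or> mx s = mx t \<and> (s, t) \<in> lexord less_than"
proof (cases "s = [] \<or> t = []")
  case True
  then show ?thesis
    by (cases t) (auto simp: seq_less_def)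
next
  case False
  then have "mx s = Max (set s)" "mx t = Max (set t)"
    by (simp_all add: mx_def)
  then show ?thesis
    using False by (simp add: seq_less_def)
qed

lemma seq_less_irrefl [simp]: "\<not> s \<prec> s"
  by (simp add: seq_less_iff lexord_irreflexive)

lemma seq_less_trans: "s \<prec> t \<Longrightarrow> t \<prec> u \<Longrightarrow> s \<prec> u"
  unfolding seq_less_iff by (auto intro: lexord_trans)

lemma seq_less_linear: "s \<prec> t \<or> s = t \<or> t \<prec> s"
proof -
  have "(s, t) \<in> lexord less_than \<or> s = t \<or> (t, s) \<in> lexord less_than"
    by (rule lexord_linear) auto
  then show ?thesis
    unfolding seq_less_iff by (auto simp: nat_neq_iff)
qed

lemma seq_less_append: "t \<noteq> [] \<Longrightarrow> s \<prec> s @ t"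
  by (cases t) (auto simp: seq_less_iff less_max_iff_disj lexord_append_rightI)

lemma seq_less_snoc: "m < n \<Longrightarrow> s @ [m] \<prec> s @ [n]"
  by (auto simp: seq_less_iff max_def lexord_append_leftI)

lemma seq_less_upsilon [simp]: "upsilon n s \<prec> upsilon n t \<longleftrightarrow> s \<prec> t"
proof -
  have "(map (\<lambda>x. x + n) s, map (\<lambda>x. x + n) t) \<in> lexord less_than \<longleftrightarrow> (s, t) \<in> lexord less_than"
  proof (induction s arbitrary: t)
    case Nil
    then show ?case
      by (cases t) auto
  next
    case (Cons a s)
    then show ?case
      by (cases t) auto
  qed
  then show ?thesis
    by (simp add: seq_less_iff) (simp add: upsilon_def)
qed

lemma finite_seq_min:
  "finite A \<Longrightarrow> A \<noteq> {} \<Longrightarrow> \<exists>a\<in>A. \<forall>b\<in>A. b \<noteq> a \<longrightarrow> a \<prec> b"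
proof (induction A rule: finite_ne_induct)
  case (insert x A)
  then obtain a where a: "a \<in> A" "\<forall>b\<in>A. b \<noteq> a \<longrightarrow> a \<prec> b"
    by blast
  show ?case
  proof (cases "x \<prec> a")
    case True
    then show ?thesis
      using a seq_less_trans[of x a] by (intro bexI[of _ x]) auto
  next
    case False
    then have "a \<prec> x"
      using seq_less_linear insert.hyps a(1) by blast
    then show ?thesis
      using a by (intro bexI[of _ a]) auto
  qed
qed auto

text \<open>The root is a node even of the empty set, so that the construction of members can start
  from nothing.\<close>

definition nodes :: "nat list set \<Rightarrow> nat list set" where
  "nodes S = insert [] {x. \<exists>y. x @ y \<in> S}"

lemma Nil_in_nodes [simp]: "[] \<in> nodes S"
  by (simp add: nodes_def)

lemma nodesE: "x \<in> nodes S \<Longrightarrow> x \<noteq> [] \<Longrightarrow> (\<And>y. x @ y \<in> S \<Longrightarrow> P) \<Longrightarrow> P"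
  by (auto simp: nodes_def)

lemma append_in_nodes: "x @ y \<in> S \<Longrightarrow> x \<in> nodes S"
  by (auto simp: nodes_def)

lemma subset_nodes: "S \<subseteq> nodes S"
  using append_in_nodes[of _ "[]"] by auto

lemma nodes_mono: "S \<subseteq> S' \<Longrightarrow> nodes S \<subseteq> nodes S'"
  by (auto simp: nodes_def)

lemma nodes_prefix: "x @ y \<in> nodes S \<Longrightarrow> x \<in> nodes S"
  by (auto simp: nodes_def)

lemma nodes_Union: "nodes (\<Union>i. f i) = (\<Union>i. nodes (f i))"
  by (auto simp: nodes_def)

lemma finite_nodes: "finite S \<Longrightarrow> finite (nodes S)"
proof -
  assume "finite S"
  moreover have "{x. \<exists>y. x @ y \<in> S} \<subseteq> (\<Union>s\<in>S. (\<lambda>k. take k s) ` {..length s})"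
  proof
    fix x assume "x \<in> {x. \<exists>y. x @ y \<in> S}"
    then obtain y where "x @ y \<in> S"
      by blast
    moreover have "x = take (length x) (x @ y)" "length x \<le> length (x @ y)"
      by simp_all
    ultimately show "x \<in> (\<Union>s\<in>S. (\<lambda>k. take k s) ` {..length s})"
      by blast
  qed
  ultimately show ?thesis
    unfolding nodes_def by (simp add: finite_subset)
qed

text \<open>The entries are the partial sums of the positions among siblings
  (\<open>adr_snoc\<close>), so the largest entry is the last. With \<open>upsilon\<close>,
  addresses follow the same row recursion as the domain spaces: row number \<open>i\<close> shifts
  everything by \<open>i\<close>.\<close>

primrec adr :: "nat list set \<Rightarrow> nat list \<Rightarrow> nat list" where
  "adr T [] = []"
| "adr T (n # s) = upsilon (card {m. m < n \<and> [m] \<in> T}) (adr {t. n # t \<in> T} s)"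

lemma adr_snoc:
  "adr T (x @ [n]) = adr T x @ [mx (adr T x) + card {m. m < n \<and> x @ [m] \<in> T}]"
proof (induction x arbitrary: T)
  case Nil
  then show ?case
    by (simp add: upsilon_def)
next
  case (Cons a x)
  let ?i = "card {m. m < a \<and> [m] \<in> T}" and ?T = "{t. a # t \<in> T}"
  have "adr T ((a # x) @ [n]) = upsilon ?i (adr ?T x @ [mx (adr ?T x) + card {m. m < n \<and> x @ [m] \<in> ?T}])"
    by (simp add: Cons.IH)
  also have "\<dots> = upsilon ?i (adr ?T x) @ [?i + mx (adr ?T x) + card {m. m < n \<and> (a # x) @ [m] \<in> T}]"
    by (simp add: upsilon_def)
  finally show ?case
    by simp
qed

lemma length_adr [simp]: "length (adr T x) = length x"
  by (induction x rule: rev_induct) (simp_all add: adr_snoc)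

lemma mx_adr_snoc: "mx (adr T (x @ [n])) = mx (adr T x) + card {m. m < n \<and> x @ [m] \<in> T}"
  by (simp add: adr_snoc)

lemma take_adr_append: "take (length x) (adr T (x @ y)) = adr T x"
proof (induction y rule: rev_induct)
  case (snoc n y)
  then show ?case
    using adr_snoc[of T "x @ y" n] by simp
qed simp

lemma adr_take: "adr T (take k x) = take k (adr T x)"
  using take_adr_append[of "take k x" T "drop k x"] by (cases "k \<le> length x") auto

lemma adr_append: "adr T (x @ y) = adr T x @ drop (length x) (adr T (x @ y))"
  by (metis append_take_drop_id take_adr_append)

lemma card_less_inj:
  fixes n n' :: nat
  assumes "P n" "P n'" "card {m. m < n \<and> P m} = card {m. m < n' \<and> P m}"
  shows "n = n'"
proof -
  have "card {m. m < a \<and> P m} < card {m. m < b \<and> P m}" if "a < b" "P a" for a b :: nat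
    using that by (intro psubset_card_mono) auto
  then show ?thesis
    using assms by (metis less_irrefl_nat nat_neq_iff)
qed

lemma adr_inj:
  "x \<in> nodes S \<Longrightarrow> y \<in> nodes S \<Longrightarrow> adr (nodes S) x = adr (nodes S) y \<Longrightarrow> x = y"
proof (induction x arbitrary: y rule: rev_induct)
  case Nil
  then show ?case
    by (metis length_0_conv length_adr)
next
  case (snoc n x)
  have "length y = Suc (length x)"
    using arg_cong[OF snoc.prems(3), of length] by simp
  then obtain y' n' where y: "y = y' @ [n']"
    by (cases y rule: rev_cases) auto
  have "x = y'"
    using snoc.prems by (intro snoc.IH) (auto simp: y adr_snoc dest: nodes_prefix)
  moreover have "n = n'"
    by (rule card_less_inj[of "\<lambda>m. x @ [m] \<in> nodes S"])
      (use snoc.prems in \<open>auto simp: y adr_snoc \<open>x = y'\<close>\<close>)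
  ultimately show ?case
    by (simp add: y)
qed

text \<open>Addresses commute with \<open>take\<close>, so a truncation of \<open>y\<close> has the
  address of \<open>x\<close>; injectivity does the rest.\<close>

lemma adr_prefix_imp:
  assumes "x \<in> nodes S" "y \<in> nodes S" "adr (nodes S) y = adr (nodes S) x @ z"
  shows "\<exists>w. y = x @ w"
proof -
  have "adr (nodes S) (take (length x) y) = adr (nodes S) x"
    using assms(3) by (simp add: adr_take)
  moreover have "take (length x) y \<in> nodes S"
    using assms(2) nodes_prefix[of "take (length x) y" "drop (length x) y"] by simp
  ultimately have "take (length x) y = x"
    using adr_inj assms(1) by blast
  then show ?thesis
    by (metis append_take_drop_id)
qed

text \<open>An address depends only on the smaller siblings along the path, and \<open>u\<close>
  misses none of those.\<close>

lemma adr_cong: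
  assumes "nodes u \<subseteq> nodes S"
    and "\<And>x m n. x @ [n] \<in> nodes u \<Longrightarrow> m < n \<Longrightarrow> x @ [m] \<in> nodes S \<Longrightarrow> x @ [m] \<in> nodes u"
  shows "x \<in> nodes u \<Longrightarrow> adr (nodes S) x = adr (nodes u) x"
proof (induction x rule: rev_induct)
  case (snoc n x)
  have "{m. m < n \<and> x @ [m] \<in> nodes S} = {m. m < n \<and> x @ [m] \<in> nodes u}"
    using assms snoc.prems by blast
  then show ?case
    using snoc nodes_prefix[of x "[n]"] by (simp add: adr_snoc)
qed simp

section \<open>The space of address preserving subtrees\<close>

abbreviation ab :: "nat list set \<Rightarrow> nat list \<Rightarrow> nat list" where
  "ab S \<equiv> adr (nodes S)"

definition ordered :: "nat list set \<Rightarrow> bool" where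
  "ordered S \<longleftrightarrow> (\<forall>x\<in>nodes S. \<forall>y\<in>nodes S. ab S x \<prec> ab S y \<longrightarrow> x \<prec> y)"

text \<open>\<open>L\<close> is the set of possible leaves: only nodes that are not yet full
  sequences have to branch.\<close>

definition fat :: "nat list set \<Rightarrow> nat list set \<Rightarrow> bool" where
  "fat L S \<longleftrightarrow> (\<forall>x\<in>nodes S - L. infinite {m. x @ [m] \<in> nodes S})"

definition tree_space :: "nat list set \<Rightarrow> nat list set set" where
  "tree_space L = {S. S \<subseteq> L \<and> S \<noteq> {} \<and> fat L S \<and> ordered S}"

text \<open>Nodes are compared, not only members: a new smaller sibling of an old node would change
  old addresses, and this is what excludes it.\<close>

definition end_ext :: "nat list set \<Rightarrow> nat list set \<Rightarrow> bool" where
  "end_ext u S \<longleftrightarrow> u \<subseteq> S \<and> (\<forall>x\<in>nodes S - nodes u. \<forall>y\<in>nodes u. y \<prec> x)"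

lemma seq_less_asym: "s \<prec> t \<Longrightarrow> \<not> t \<prec> s"
  using seq_less_trans seq_less_irrefl by blast

lemma seq_less_prefix_trans: "s \<prec> t \<Longrightarrow> s \<prec> t @ u"
  using seq_less_append[of u t] seq_less_trans[of s t "t @ u"] by (cases "u = []") auto

lemma seq_prefix_less_trans: "s @ u \<prec> t \<Longrightarrow> s \<prec> t"
  using seq_less_append[of u s] seq_less_trans[of s "s @ u" t] by (cases "u = []") auto

lemma mx_adr_append: "mx (adr T x) \<le> mx (adr T (x @ y))"
  using arg_cong[OF adr_append[of T x y], of mx] by simp

lemma finite_small_index: "finite {n::nat. P n \<and> card {m. m < n \<and> P m} \<le> k}"
proof (rule inj_on_finite[where B = "{..k}"])
  show "inj_on (\<lambda>n. card {m. m < n \<and> P m}) {n. P n \<and> card {m. m < n \<and> P m} \<le> k}"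
    by (auto simp: inj_on_def intro: card_less_inj[of P])
qed auto

lemma lexord_between:
  "(p, q) \<in> lexord less_than \<Longrightarrow> (q, p @ r) \<in> lexord less_than \<Longrightarrow> \<exists>z. q = p @ z"
proof (induction p arbitrary: q)
  case (Cons a p)
  then show ?case
    by (cases q) auto
qed simp

text \<open>Appending copies of \<open>mx p\<close> does not raise the maximum, so the whole
  interval has one maximum and \<open>\<prec>\<close> is lexicographic on it; lexicographically only
  extensions of \<open>p\<close> lie between \<open>p\<close> and an extension of
  \<open>p\<close>.\<close>

lemma seq_less_between:
  assumes "p \<prec> q" "q \<prec> p @ replicate k (mx p)"
  shows "\<exists>z. q = p @ z"
proof -
  have "mx p = mx q"
    using assms by (auto simp: seq_less_iff split: if_splits)
  then show ?thesis
    using assms lexord_between by (auto simp: seq_less_iff split: if_splits)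
qed

lemma end_ext_adr: "end_ext u S \<Longrightarrow> x \<in> nodes u \<Longrightarrow> ab S x = ab u x"
proof (rule adr_cong)
  assume ee: "end_ext u S"
  then show "nodes u \<subseteq> nodes S"
    by (simp add: end_ext_def nodes_mono)
  fix x m n assume "x @ [n] \<in> nodes u" "m < n" "x @ [m] \<in> nodes S"
  then show "x @ [m] \<in> nodes u"
    using ee seq_less_snoc[of m n x] seq_less_asym unfolding end_ext_def by blast
qed

lemma end_ext_trans:
  assumes "end_ext u v" "end_ext v w"
  shows "end_ext u w"
  using assms nodes_mono[of u v] unfolding end_ext_def by blast

lemma end_ext_mono: "end_ext u S \<Longrightarrow> u \<subseteq> S' \<Longrightarrow> S' \<subseteq> S \<Longrightarrow> end_ext u S'"
  using nodes_mono[of S' S] unfolding end_ext_def by blast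

text \<open>The address of the next child of \<open>x\<close> to be added to a finite tree.\<close>

definition cand :: "nat list set \<Rightarrow> nat list \<Rightarrow> nat list" where
  "cand u x = ab u x @ [mx (ab u x) + card {m. x @ [m] \<in> nodes u}]"

text \<open>Old siblings precede the new child because new nodes come after old ones, and by
  minimality no other new sibling does; so its position is the number of old siblings.\<close>

lemma new_child_adr:
  assumes ee: "end_ext u S" and x: "x \<in> nodes u" "x @ [m] \<in> nodes S - nodes u"
    and min: "\<And>m'. m' < m \<Longrightarrow> x @ [m'] \<in> nodes S \<Longrightarrow> x @ [m'] \<in> nodes u"
  shows "ab S (x @ [m]) = cand u x"
proof -
  have "{m'. m' < m \<and> x @ [m'] \<in> nodes S} = {m'. x @ [m'] \<in> nodes u}"
  proof (intro equalityI subsetI CollectI)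
    fix m' assume "m' \<in> {m'. m' < m \<and> x @ [m'] \<in> nodes S}"
    then show "x @ [m'] \<in> nodes u"
      using min by simp
  next
    fix m' assume "m' \<in> {m'. x @ [m'] \<in> nodes u}"
    then have m': "x @ [m'] \<in> nodes u"
      by simp
    have "x @ [m'] \<prec> x @ [m]"
      using ee m' x unfolding end_ext_def by blast
    then have "\<not> m < m'"
      using seq_less_snoc[of m m' x] seq_less_asym by blast
    moreover have "m \<noteq> m'"
      using x m' by auto
    moreover have "x @ [m'] \<in> nodes S"
      using ee m' nodes_mono[of u S] unfolding end_ext_def by blast
    ultimately show "m' < m \<and> x @ [m'] \<in> nodes S"
      by simp
  qed
  then show ?thesis
    using end_ext_adr[OF ee x(1)] by (simp add: adr_snoc cand_def)
qed

text \<open>A node with this address would be a child of \<open>x\<close> whose position equals the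
  number of children of \<open>x\<close>, but positions are strictly smaller.\<close>

lemma cand_not_adr:
  assumes "finite u" "x \<in> nodes u" "y \<in> nodes u"
  shows "ab u y \<noteq> cand u x"
proof
  assume eq: "ab u y = cand u x"
  then obtain v where v: "y = x @ v"
    using adr_prefix_imp[OF assms(2,3)] unfolding cand_def by blast
  have "length v = 1"
    using arg_cong[OF eq, of length] by (simp add: v cand_def)
  then obtain n where n: "y = x @ [n]"
    unfolding v by (cases v) auto
  have "{m. x @ [m] \<in> nodes u} \<subseteq> last ` nodes u"
    by force
  then have "finite {m. x @ [m] \<in> nodes u}"
    using finite_nodes[OF assms(1)] finite_subset by blast
  then have "card {m. m < n \<and> x @ [m] \<in> nodes u} < card {m. x @ [m] \<in> nodes u}"
    using assms(3) n by (intro psubset_card_mono) auto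
  then show False
    using eq by (simp add: n adr_snoc cand_def)
qed

lemma cand_inj: "x \<in> nodes u \<Longrightarrow> y \<in> nodes u \<Longrightarrow> cand u x = cand u y \<Longrightarrow> x = y"
  unfolding cand_def append1_eq_conv by (elim conjE) (rule adr_inj)

text \<open>The properties of the set of sequences of a barrier that the combinatorics needs.
  Well-foundedness stands in for the rank and permits induction from the members down to the root.
  \<open>Nil_notin\<close> excludes rank 0, whose space has the finite set \<open>{[]}\<close> as
  its only element.\<close>

locale front =
  fixes L :: "nat list set"
  assumes antichain: "s \<in> L \<Longrightarrow> s @ t \<in> L \<Longrightarrow> t = []"
    and Nil_notin: "[] \<notin> L"
    and wf_nodes: "wf {(x @ [m], x) | x m. x @ [m] \<in> nodes L}"
begin

section \<open>Finiteness and order type in a front\<close>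

lemma node_induct [consumes 1, case_names step]:
  assumes "x \<in> nodes L"
    and "\<And>x. x \<in> nodes L \<Longrightarrow> (\<And>m. x @ [m] \<in> nodes L \<Longrightarrow> P (x @ [m])) \<Longrightarrow> P x"
  shows "P x"
  using wf_nodes assms(1)
proof (induction x rule: wf_induct_rule)
  case (less x)
  show ?case
    by (rule assms(2)) (use less in auto)
qed

lemma leaf_in: "S \<subseteq> L \<Longrightarrow> x \<in> nodes S \<Longrightarrow> x \<in> L \<Longrightarrow> x \<in> S"
proof -
  assume S: "S \<subseteq> L" and x: "x \<in> nodes S" "x \<in> L"
  then obtain y where "x @ y \<in> S"
    using Nil_notin by (auto elim: nodesE)
  then show "x \<in> S"
    using antichain[OF x(2), of y] S by auto
qed

lemma leaf_children: "S \<subseteq> L \<Longrightarrow> x \<in> L \<Longrightarrow> x @ y \<in> nodes S \<Longrightarrow> y = []"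
  using antichain[of x] Nil_notin by (auto simp: nodes_def)

lemma leaf_above:
  assumes "S \<noteq> {}" "x \<in> nodes S"
  obtains y where "x @ y \<in> S"
  using assms by (auto simp: nodes_def)

text \<open>The position of a child is at most the largest entry in the address of any member above
  it, so at each node only finitely many children qualify; finiteness then follows by
  \<open>node_induct\<close>.\<close>

lemma finite_bounded_adr:
  assumes S: "S \<subseteq> L"
  shows "finite {s \<in> S. mx (ab S s) \<le> k}"
proof -
  have "finite {y. x @ y \<in> S \<and> mx (ab S (x @ y)) \<le> k}" if "x \<in> nodes L" for x
    using that
  proof (induction rule: node_induct)
    case (step x)
    show ?case
    proof (cases "x \<in> L")
      case True
      then have "{y. x @ y \<in> S \<and> mx (ab S (x @ y)) \<le> k} \<subseteq> {[]}"
        using antichain S by blast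
      then show ?thesis
        by (rule finite_subset) simp
    next
      case False
      let ?M = "{m. x @ [m] \<in> nodes S \<and> card {m'. m' < m \<and> x @ [m'] \<in> nodes S} \<le> k}"
      have "{y. x @ y \<in> S \<and> mx (ab S (x @ y)) \<le> k} \<subseteq>
        (\<Union>m\<in>?M. (#) m ` {y. (x @ [m]) @ y \<in> S \<and> mx (ab S ((x @ [m]) @ y)) \<le> k})"
      proof
        fix y assume "y \<in> {y. x @ y \<in> S \<and> mx (ab S (x @ y)) \<le> k}"
        then have y: "x @ y \<in> S" "mx (ab S (x @ y)) \<le> k"
          by auto
        then obtain m z where z: "y = m # z"
          using False S by (cases y) auto
        have "mx (ab S (x @ [m])) \<le> k"
          using y(2) mx_adr_append[of "nodes S" "x @ [m]" z] by (simp add: z)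
        moreover have "x @ [m] \<in> nodes S"
          using y(1) append_in_nodes[of "x @ [m]" z] by (simp add: z)
        ultimately have "m \<in> ?M"
          by (simp add: mx_adr_snoc)
        then show "y \<in> (\<Union>m\<in>?M. (#) m ` {y. (x @ [m]) @ y \<in> S \<and> mx (ab S ((x @ [m]) @ y)) \<le> k})"
          using y z by auto
      qed
      moreover have "finite {y. (x @ [m]) @ y \<in> S \<and> mx (ab S ((x @ [m]) @ y)) \<le> k}" if "m \<in> ?M" for m
        using that nodes_mono[OF S] by (intro step.IH) auto
      ultimately show ?thesis
        using finite_small_index[of "\<lambda>m. x @ [m] \<in> nodes S" k] by (auto intro: finite_subset)
    qed
  qed
  from this[of "[]"] show ?thesis
    by simp
qed

text \<open>Since \<open>\<prec>\<close> compares maxima first, this makes every set of predecessors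
  finite, so infinite subsets of a front have order type omega and \<open>first_members\<close>
  really picks initial segments.\<close>

lemma finite_bounded_nodes: "finite {s \<in> nodes L. mx s \<le> k}"
proof -
  have "finite {y. x @ y \<in> nodes L \<and> mx (x @ y) \<le> k}" if "x \<in> nodes L" for x
    using that
  proof (induction rule: node_induct)
    case (step x)
    have sub: "{y. x @ y \<in> nodes L \<and> mx (x @ y) \<le> k} \<subseteq>
      insert [] (\<Union>m\<in>{m. m \<le> k \<and> x @ [m] \<in> nodes L}. (#) m ` {y. (x @ [m]) @ y \<in> nodes L \<and> mx ((x @ [m]) @ y) \<le> k})"
    proof
      fix y assume y: "y \<in> {y. x @ y \<in> nodes L \<and> mx (x @ y) \<le> k}"
      show "y \<in> insert [] (\<Union>m\<in>{m. m \<le> k \<and> x @ [m] \<in> nodes L}. (#) m ` {y. (x @ [m]) @ y \<in> nodes L \<and> mx ((x @ [m]) @ y) \<le> k})"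
      proof (cases y)
        case (Cons m z)
        then show ?thesis
          using y nodes_prefix[of "x @ [m]" z L] by auto
      qed simp
    qed
    show ?case
      by (rule finite_subset[OF sub])
        (auto intro!: finite_imageI step.IH simp del: mx_simps append_assoc)
  qed
  from this[of "[]"] show ?thesis
    by simp
qed

lemma finite_predecessors: "S \<subseteq> nodes L \<Longrightarrow> finite {t \<in> S. t \<prec> s}"
  by (rule finite_subset[OF _ finite_bounded_nodes[of "mx s"]]) (auto simp: seq_less_iff)

lemma first_members_iff:
  "S \<subseteq> L \<Longrightarrow> s \<in> first_members n S \<longleftrightarrow> s \<in> S \<and> card {t \<in> S. t \<prec> s} < n"
  using finite_predecessors[of S s] subset_nodes[of L] by (auto simp: first_members_def)

lemma card_node_predecessors_less:
  assumes "S \<subseteq> nodes L" "s \<in> S" "s \<prec> t"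
  shows "card {x \<in> S. x \<prec> s} < card {x \<in> S. x \<prec> t}"
proof (rule psubset_card_mono)
  show "finite {x \<in> S. x \<prec> t}"
    using finite_predecessors assms by blast
  show "{x \<in> S. x \<prec> s} \<subset> {x \<in> S. x \<prec> t}"
  proof
    show "{x \<in> S. x \<prec> s} \<subseteq> {x \<in> S. x \<prec> t}"
      using assms(3) seq_less_trans by blast
    have "s \<in> {x \<in> S. x \<prec> t}" "s \<notin> {x \<in> S. x \<prec> s}"
      using assms by auto
    then show "{x \<in> S. x \<prec> s} \<noteq> {x \<in> S. x \<prec> t}"
      by blast
  qed
qed

lemma card_predecessors_less:
  "S \<subseteq> L \<Longrightarrow> s \<in> S \<Longrightarrow> s \<prec> t \<Longrightarrow> card {x \<in> S. x \<prec> s} < card {x \<in> S. x \<prec> t}"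
  using card_node_predecessors_less[of S s t] subset_nodes[of L] by (meson subset_trans)

lemma predecessors_bij:
  assumes S: "S \<subseteq> L" "infinite S"
  shows "bij_betw (\<lambda>s. card {t \<in> S. t \<prec> s}) S UNIV"
proof -
  let ?f = "\<lambda>s. card {t \<in> S. t \<prec> s}"
  have inj: "inj_on ?f S"
  proof (rule inj_onI)
    fix s t assume "s \<in> S" "t \<in> S" "?f s = ?f t"
    then show "s = t"
      using card_predecessors_less[OF S(1), of s t] card_predecessors_less[OF S(1), of t s]
        seq_less_linear[of s t] by auto
  qed
  have down: "{..<?f s} \<subseteq> ?f ` S" if "s \<in> S" for s
  proof -
    have "?f ` {t \<in> S. t \<prec> s} = {..<?f s}"
    proof (rule card_subset_eq)
      show "?f ` {t \<in> S. t \<prec> s} \<subseteq> {..<?f s}"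
        using card_predecessors_less[OF S(1)] by auto
      show "card (?f ` {t \<in> S. t \<prec> s}) = card {..<?f s}"
        using inj by (subst card_image) (auto intro: inj_on_subset)
    qed simp
    then show ?thesis
      by blast
  qed
  have "n \<in> ?f ` S" for n
  proof -
    have "infinite (?f ` S)"
      using S(2) inj finite_imageD by blast
    then obtain s where "s \<in> S" "n < ?f s"
      unfolding infinite_nat_iff_unbounded by blast
    then show ?thesis
      using down[of s] by auto
  qed
  then show ?thesis
    using inj by (auto simp: bij_betw_def)
qed

lemma first_members_finite_card:
  assumes S: "S \<subseteq> L" "infinite S"
  shows "finite (first_members n S) \<and> card (first_members n S) = n"
proof -
  let ?f = "\<lambda>s. card {t \<in> S. t \<prec> s}"
  have eq: "first_members n S = {s \<in> S. ?f s < n}"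
    using first_members_iff[OF S(1)] by auto
  have bij: "bij_betw ?f S UNIV"
    by (rule predecessors_bij[OF S])
  have "?f ` {s \<in> S. ?f s < n} = {..<n}"
  proof
    show "{..<n} \<subseteq> ?f ` {s \<in> S. ?f s < n}"
    proof
      fix k assume k: "k \<in> {..<n}"
      have "k \<in> ?f ` S"
        unfolding bij_betw_imp_surj_on[OF bij] by simp
      then obtain s where "k = ?f s" "s \<in> S"
        by (rule imageE)
      then show "k \<in> ?f ` {s \<in> S. ?f s < n}"
        using k by blast
    qed
  qed auto
  moreover have "inj_on ?f {s \<in> S. ?f s < n}"
    using bij_betw_imp_inj_on[OF bij] by (rule inj_on_subset) auto
  ultimately have "bij_betw ?f {s \<in> S. ?f s < n} {..<n}"
    unfolding bij_betw_def by blast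
  then show ?thesis
    unfolding eq using bij_betw_finite bij_betw_same_card by fastforce
qed

lemma first_members_initial:
  "S \<subseteq> L \<Longrightarrow> s \<in> first_members n S \<Longrightarrow> t \<in> S \<Longrightarrow> t \<prec> s \<Longrightarrow> t \<in> first_members n S"
  using card_predecessors_less[of S t s] by (simp add: first_members_iff)

lemma initial_eq_first_members:
  assumes S: "S \<subseteq> L" and u: "finite u" "u \<subseteq> S" "\<And>s t. s \<in> u \<Longrightarrow> t \<in> S \<Longrightarrow> t \<prec> s \<Longrightarrow> t \<in> u"
  shows "first_members (card u) S = u"
proof -
  have "card {t \<in> S. t \<prec> s} < card u" if "s \<in> u" for s
    using that u by (intro psubset_card_mono) auto
  moreover have "card u \<le> card {t \<in> S. t \<prec> s}" if "s \<in> S" "s \<notin> u" for s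
  proof (rule card_mono)
    show "finite {t \<in> S. t \<prec> s}"
      using finite_predecessors S subset_nodes by blast
    show "u \<subseteq> {t \<in> S. t \<prec> s}"
    proof
      fix t assume "t \<in> u"
      then show "t \<in> {t \<in> S. t \<prec> s}"
        using u(2) u(3)[of t s] that seq_less_linear[of s t] by auto
    qed
  qed
  ultimately have "s \<in> first_members (card u) S \<longleftrightarrow> s \<in> u" for s
    using u(2) by (cases "s \<in> u") (auto simp: first_members_iff[OF S] not_less)
  then show ?thesis
    by blast
qed

lemma end_ext_first_members:
  assumes S: "S \<subseteq> L" and u: "finite u" "end_ext u S"
  shows "first_members (card u) S = u"
proof (rule initial_eq_first_members[OF S u(1)])
  show "u \<subseteq> S"
    using u by (simp add: end_ext_def)
  fix s t assume "s \<in> u" "t \<in> S" "t \<prec> s"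
  then have "t \<in> nodes S" "s \<in> nodes u"
    using subset_nodes by blast+
  then have "t \<in> nodes u"
    using u(2) \<open>t \<prec> s\<close> seq_less_asym unfolding end_ext_def by blast
  then show "t \<in> u"
    using leaf_in[of u t] \<open>u \<subseteq> S\<close> S \<open>t \<in> S\<close> by blast
qed

text \<open>Descending to the least child adds position 0, so the largest entry of the address is
  repeated; well-foundedness ends the descent at a member. Thus every node lies below a member with
  the same largest address entry.\<close>

lemma leftmost_leaf:
  assumes S: "S \<subseteq> L" "S \<noteq> {}" "fat L S" and x: "x \<in> nodes S"
  shows "\<exists>y. x @ y \<in> S \<and> ab S (x @ y) = ab S x @ replicate (length y) (mx (ab S x))"
proof -
  have "x \<in> nodes L"
    using x nodes_mono[OF S(1)] by blast
  then show ?thesis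
    using x
  proof (induction rule: node_induct)
    case (step x)
    show ?case
    proof (cases "x \<in> L")
      case True
      then have "x \<in> S"
        using leaf_in S step.prems by blast
      then show ?thesis
        by (intro exI[of _ "[]"]) simp
    next
      case False
      then have "infinite {m. x @ [m] \<in> nodes S}"
        using S step.prems by (simp add: fat_def)
      then have ex: "\<exists>m. x @ [m] \<in> nodes S"
        using not_finite_existsD by blast
      define m where "m = (LEAST m. x @ [m] \<in> nodes S)"
      have m: "x @ [m] \<in> nodes S"
        unfolding m_def by (rule LeastI_ex[OF ex])
      have "{m'. m' < m \<and> x @ [m'] \<in> nodes S} = {}"
        using not_less_Least unfolding m_def by blast
      then have *: "ab S (x @ [m]) = ab S x @ [mx (ab S x)]"
        by (simp only: adr_snoc card.empty add_0_right)
      obtain y where "(x @ [m]) @ y \<in> S"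
        "ab S ((x @ [m]) @ y) = ab S (x @ [m]) @ replicate (length y) (mx (ab S (x @ [m])))"
        using step.IH[of m] m nodes_mono[OF S(1)] by blast
      then show ?thesis
        by (intro exI[of _ "m # y"]) (simp add: *)
    qed
  qed
qed

lemma tree_space_less_iff:
  assumes "S \<in> tree_space L" "x \<in> nodes S" "y \<in> nodes S"
  shows "ab S x \<prec> ab S y \<longleftrightarrow> x \<prec> y"
  using assms adr_inj[of x S y] seq_less_linear[of "ab S x" "ab S y"] seq_less_asym
  unfolding tree_space_def ordered_def by blast

text \<open>The passage from members to nodes. If a new node \<open>x\<close> preceded an old node
  \<open>y\<close>, the leftmost leaf above \<open>x\<close> would be new, hence come after a member
  of \<open>u\<close> above \<open>y\<close>. The address of \<open>y\<close> would then lie between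
  those of \<open>x\<close> and of the leftmost leaf, so \<open>y\<close> would be above
  \<open>x\<close> and \<open>x\<close> an old node.\<close>

lemma initial_end_ext:
  assumes S: "S \<in> tree_space L" and u: "u \<subseteq> S" "\<And>s t. s \<in> u \<Longrightarrow> t \<in> S \<Longrightarrow> t \<prec> s \<Longrightarrow> t \<in> u"
  shows "end_ext u S"
  unfolding end_ext_def
proof (intro conjI ballI)
  fix x y assume x: "x \<in> nodes S - nodes u" and y: "y \<in> nodes u"
  have SL: "S \<subseteq> L" "S \<noteq> {}" "fat L S"
    using S by (auto simp: tree_space_def)
  have yS: "y \<in> nodes S"
    using y nodes_mono[OF u(1)] by blast
  show "y \<prec> x"
  proof (rule ccontr)
    assume "\<not> y \<prec> x"
    then have xy: "x \<prec> y"
      using x y seq_less_linear by blast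
    have "y \<noteq> []"
      using xy by (auto simp: seq_less_def)
    then obtain w where w: "y @ w \<in> u"
      using y by (auto elim: nodesE)
    obtain v where v: "x @ v \<in> S" "ab S (x @ v) = ab S x @ replicate (length v) (mx (ab S x))"
      using leftmost_leaf[OF SL] x by blast
    have "x @ v \<notin> u"
      using x append_in_nodes by blast
    then have "\<not> x @ v \<prec> y @ w" "x @ v \<noteq> y @ w"
      using u(2)[OF w v(1)] w by auto
    then have "y @ w \<prec> x @ v"
      using seq_less_linear by blast
    then have "ab S (y @ w) \<prec> ab S (x @ v)"
      using tree_space_less_iff[OF S] v w u(1) subset_nodes by blast
    moreover have "ab S (y @ w) = ab S y @ drop (length y) (ab S (y @ w))"
      by (rule adr_append)
    ultimately have "ab S y \<prec> ab S x @ replicate (length v) (mx (ab S x))"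
      using v(2) seq_prefix_less_trans by metis
    moreover have "ab S x \<prec> ab S y"
      using tree_space_less_iff[OF S] x yS xy by blast
    ultimately obtain z where "ab S y = ab S x @ z"
      using seq_less_between by blast
    then obtain w' where "y = x @ w'"
      using adr_prefix_imp x yS by blast
    then show False
      using x y nodes_prefix by blast
  qed
qed (use u in simp)

lemma first_members_end_ext:
  assumes "S \<in> tree_space L"
  shows "end_ext (first_members n S) S"
proof (rule initial_end_ext[OF assms])
  have "S \<subseteq> L"
    using assms by (simp add: tree_space_def)
  then show "t \<in> first_members n S" if "s \<in> first_members n S" "t \<in> S" "t \<prec> s" for s t
    using first_members_initial that by blast
qed (simp add: first_members_def)

lemma tree_space_infinite: "S \<in> tree_space L \<Longrightarrow> infinite S"
proof
  assume S: "S \<in> tree_space L" and fin: "finite S"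
  have "{m. [] @ [m] \<in> nodes S} \<subseteq> last ` nodes S"
    by force
  then have "finite {m. [] @ [m] \<in> nodes S}"
    using finite_nodes[OF fin] finite_subset by blast
  then show False
    using S Nil_notin Nil_in_nodes[of S] unfolding tree_space_def fat_def by blast
qed

text \<open>
  The last condition says that no free position precedes a member, so that the addresses fill an
  initial segment of the possible ones.
\<close>

definition proper :: "nat list set \<Rightarrow> bool" where
  "proper u \<longleftrightarrow> finite u \<and> u \<subseteq> L \<and> ordered u \<and>
     (\<forall>x\<in>nodes u - L. \<forall>s\<in>u. \<not> cand u x \<prec> ab u s)"

definition growing :: "nat list set \<Rightarrow> nat list \<Rightarrow> bool" where
  "growing u x \<longleftrightarrow> x \<in> nodes u - L \<and> (\<forall>y\<in>nodes u - L. y \<noteq> x \<longrightarrow> cand u x \<prec> cand u y)"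

section \<open>Adding one member to a finite part\<close>

lemma exit_node:
  "z \<notin> nodes S \<Longrightarrow> \<exists>p n r. z = p @ n # r \<and> p \<in> nodes S \<and> p @ [n] \<notin> nodes S"
proof (induction z rule: rev_induct)
  case (snoc n z)
  show ?case
  proof (cases "z \<in> nodes S")
    case True
    then show ?thesis
      using snoc.prems by (intro exI[of _ z] exI[of _ n] exI[of _ "[]"]) simp
  next
    case False
    then obtain p n' r where "z = p @ n' # r" "p \<in> nodes S" "p @ [n'] \<notin> nodes S"
      using snoc.IH by blast
    then show ?thesis
      by (intro exI[of _ p] exI[of _ n'] exI[of _ "r @ [n]"]) simp
  qed
qed simp

lemma finite_children: "finite u \<Longrightarrow> finite {m. x @ [m] \<in> nodes u}"
proof -
  assume "finite u"
  moreover have "{m. x @ [m] \<in> nodes u} \<subseteq> last ` nodes u"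
    by force
  ultimately show ?thesis
    using finite_nodes finite_subset by blast
qed

lemma growing_exists:
  assumes "finite u"
  obtains x where "growing u x"
proof -
  have "[] \<in> nodes u - L"
    using Nil_notin by simp
  then have "finite (cand u ` (nodes u - L))" "cand u ` (nodes u - L) \<noteq> {}"
    using finite_nodes[OF assms] by blast+
  from finite_seq_min[OF this] obtain x where x: "x \<in> nodes u - L"
    "\<And>y. y \<in> nodes u - L \<Longrightarrow> cand u y \<noteq> cand u x \<Longrightarrow> cand u x \<prec> cand u y"
    by auto
  have "growing u x"
    unfolding growing_def
  proof (intro conjI ballI impI)
    fix y assume "y \<in> nodes u - L" "y \<noteq> x"
    then show "cand u x \<prec> cand u y"
      using cand_inj[of y u x] x by auto
  qed (fact x(1))
  then show ?thesis
    by (rule that)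
qed

lemma first_new_child:
  assumes S: "S \<in> tree_space L" and ee: "end_ext u S" "finite u" and x: "x \<in> nodes u - L"
  obtains m where "x @ [m] \<in> nodes S - nodes u" "ab S (x @ [m]) = cand u x"
proof -
  have "x \<in> nodes S - L"
    using x ee(1) nodes_mono[of u S] unfolding end_ext_def by blast
  then have "infinite {m. x @ [m] \<in> nodes S}"
    using S by (simp add: tree_space_def fat_def)
  then have "\<not> {m. x @ [m] \<in> nodes S} \<subseteq> {m. x @ [m] \<in> nodes u}"
    using finite_children[OF ee(2)] finite_subset by blast
  then have ex: "\<exists>m. x @ [m] \<in> nodes S - nodes u"
    by blast
  define m where "m = (LEAST m. x @ [m] \<in> nodes S - nodes u)"
  have m: "x @ [m] \<in> nodes S - nodes u"
    unfolding m_def by (rule LeastI_ex[OF ex])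
  moreover have "ab S (x @ [m]) = cand u x"
  proof (rule new_child_adr[OF ee(1)])
    fix m' assume "m' < m" "x @ [m'] \<in> nodes S"
    then show "x @ [m'] \<in> nodes u"
      using not_less_Least[of m' "\<lambda>m. x @ [m] \<in> nodes S - nodes u"] unfolding m_def by blast
  qed (use x m in auto)
  ultimately show ?thesis
    by (rule that)
qed

text \<open>In \<open>S\<close> the free position \<open>cand u x\<close> is filled by a node
  outside \<open>u\<close>. It comes after all members of \<open>u\<close>, and addresses in
  \<open>S\<close> are ordered in the same way.\<close>

lemma end_ext_proper:
  assumes S: "S \<in> tree_space L" and ee: "end_ext u S" "finite u"
  shows "proper u"
  unfolding proper_def
proof (intro conjI ballI)
  have sub: "u \<subseteq> S" "nodes u \<subseteq> nodes S"
    using ee(1) nodes_mono[of u S] unfolding end_ext_def by blast+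
  show "u \<subseteq> L"
    using sub S by (auto simp: tree_space_def)
  show "ordered u"
    unfolding ordered_def
  proof (intro ballI impI)
    fix x y assume "x \<in> nodes u" "y \<in> nodes u" "ab u x \<prec> ab u y"
    then show "x \<prec> y"
      using tree_space_less_iff[OF S, of x y] sub end_ext_adr[OF ee(1)] by auto
  qed
  fix x s assume x: "x \<in> nodes u - L" and s: "s \<in> u"
  obtain m where m: "x @ [m] \<in> nodes S - nodes u" "ab S (x @ [m]) = cand u x"
    using first_new_child[OF S ee x] .
  have s': "s \<in> nodes u" "s \<in> nodes S"
    using s sub subset_nodes[of u] by blast+
  have "s \<prec> x @ [m]"
    using ee(1) m s' unfolding end_ext_def by blast
  then have "ab S s \<prec> ab S (x @ [m])"
    using tree_space_less_iff[OF S] m s' by blast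
  then show "\<not> cand u x \<prec> ab u s"
    using seq_less_asym end_ext_adr[OF ee(1) s'(1)] m(2) by simp
qed (fact ee)

lemma nodes_insert:
  assumes "x \<in> nodes u"
  shows "nodes (insert (x @ m # r) u) = nodes u \<union> {x @ m # w | w v. r = w @ v}"
proof (intro equalityI subsetI)
  fix z assume z: "z \<in> nodes (insert (x @ m # r) u)"
  show "z \<in> nodes u \<union> {x @ m # w | w v. r = w @ v}"
  proof (cases "z \<in> nodes u")
    case False
    then obtain v where v: "z @ v = x @ m # r"
      using z by (auto simp: nodes_def)
    then consider w where "z @ w = x" | w where "z = x @ w"
      by (auto simp: append_eq_append_conv2)
    then show ?thesis
    proof cases
      case 1
      then show ?thesis
        using assms nodes_prefix by blast
    next
      case 2
      then show ?thesis
        using v assms by (cases w) auto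
    qed
  qed simp
next
  fix z assume "z \<in> nodes u \<union> {x @ m # w | w v. r = w @ v}"
  then show "z \<in> nodes (insert (x @ m # r) u)"
    using nodes_mono[of u "insert (x @ m # r) u"] by (auto simp: nodes_def)
qed

text \<open>With \<open>c = cand u x\<close>, the new nodes get the addresses \<open>c\<close>
  followed by copies of \<open>mx c\<close>. All old addresses are below \<open>c\<close>, and the
  choice of \<open>x\<close> as growing node ensures that no free position precedes the address of
  the new member.\<close>

lemma proper_insert:
  assumes u: "proper u" and x: "growing u x" and s: "x @ m # r \<in> L"
    and new: "\<And>y. y \<in> nodes u \<Longrightarrow> y \<prec> x @ [m]"
  shows "proper (insert (x @ m # r) u)" "end_ext u (insert (x @ m # r) u)"
proof -
  let ?s = "x @ m # r"
  define u' where "u' = insert ?s u"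
  define c where "c = cand u x"
  have xu: "x \<in> nodes u" "x \<notin> L"
    using x by (auto simp: growing_def)
  have fin: "finite u" "finite u'" "u \<subseteq> L"
    using u by (auto simp: proper_def u'_def)
  have nodes_u': "nodes u' = nodes u \<union> {x @ m # w | w v. r = w @ v}"
    unfolding u'_def by (rule nodes_insert[OF xu(1)])
  have new_notin: "x @ m # w \<notin> nodes u" for w
    using new[of "x @ [m]"] nodes_prefix[of "x @ [m]" w u] by auto
  show ee: "end_ext u (insert (x @ m # r) u)"
    unfolding u'_def[symmetric] end_ext_def
  proof (intro conjI ballI)
    fix z y assume "z \<in> nodes u' - nodes u" "y \<in> nodes u"
    then show "y \<prec> z"
      using nodes_u' new[of y] seq_less_prefix_trans[of y "x @ [m]"] by auto
  qed (auto simp: u'_def)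
  have ee': "end_ext u u'"
    using ee by (simp add: u'_def)
  note old = end_ext_adr[OF ee']
  have "ab u' (x @ [m]) = c"
    unfolding c_def by (rule new_child_adr[OF ee']) (use xu new_notin nodes_u' in auto)
  \<comment> \<open>Each node of the new branch beyond \<open>x @ [m]\<close> is an only child, so
    it has position 0.\<close>
  then have ab_new: "ab u' (x @ m # w) = c @ replicate (length w) (mx c)" if "r = w @ v" for w v
    using that
  proof (induction w arbitrary: v rule: rev_induct)
    case (snoc n w)
    have "{n'. n' < n \<and> (x @ m # w) @ [n'] \<in> nodes u'} = {}"
      using new_notin snoc.prems by (auto simp: nodes_u')
    then have "ab u' ((x @ m # w) @ [n]) = ab u' (x @ m # w) @ [mx (ab u' (x @ m # w))]"
      by (simp only: adr_snoc card.empty add_0_right)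
    moreover have "ab u' (x @ m # w) = c @ replicate (length w) (mx c)"
      using snoc by auto
    ultimately show ?case
      by (simp add: replicate_append_same)
  qed simp
  \<comment> \<open>Properness speaks of members, so an old node is bounded through a member above
    it.\<close>
  have c_above: "ab u y \<prec> c" if y: "y \<in> nodes u" for y
  proof (cases "y = []")
    case True
    then show ?thesis
      using seq_less_append[of c "[]"] by (simp add: c_def cand_def)
  next
    case False
    then obtain w where w: "y @ w \<in> u"
      using y by (auto elim: nodesE)
    then have "\<not> c \<prec> ab u (y @ w)"
      using u xu unfolding c_def proper_def by blast
    moreover have "ab u (y @ w) \<noteq> c"
      unfolding c_def using cand_not_adr[OF fin(1) xu(1)] w subset_nodes by blast
    ultimately have "ab u (y @ w) \<prec> c"
      using seq_less_linear by blast
    then show ?thesis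
      using seq_prefix_less_trans adr_append by metis
  qed
  have ord: "ordered u'"
    unfolding ordered_def
  proof (intro ballI impI)
    fix y z assume yz: "y \<in> nodes u'" "z \<in> nodes u'" "ab u' y \<prec> ab u' z"
    consider "y \<in> nodes u" "z \<in> nodes u" | "y \<in> nodes u" "z \<notin> nodes u"
      | "y \<notin> nodes u" "z \<in> nodes u" | "y \<notin> nodes u" "z \<notin> nodes u"
      by blast
    then show "y \<prec> z"
    proof cases
      case 1
      then show ?thesis
        using u yz old unfolding proper_def ordered_def by simp
    next
      case 2
      then show ?thesis
        using ee' yz unfolding end_ext_def by blast
    next
      case 3
      then obtain w v where w: "y = x @ m # w" "r = w @ v"
        using yz nodes_u' by auto
      have "ab u z \<prec> c @ replicate (length w) (mx c)"
        using c_above[OF 3(2)] by (rule seq_less_prefix_trans)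
      then show ?thesis
        using yz(3) seq_less_asym by (simp add: w(1) ab_new[OF w(2)] old[OF 3(2)])
    next
      case 4
      then obtain w v w' v' where w: "y = x @ m # w" "r = w @ v" "z = x @ m # w'" "r = w' @ v'"
        using yz nodes_u' by blast
      then consider a where "w' = w @ a" | a where "w = w' @ a"
        by (auto simp: append_eq_append_conv2)
      then show ?thesis
      proof cases
        case (1 a)
        moreover from 1 have "a \<noteq> []"
          using yz(3) w by auto
        ultimately show ?thesis
          using seq_less_append[of a "x @ m # w"] w by simp
      next
        case (2 a)
        have "ab u' y = ab u' z @ replicate (length a) (mx c)"
          by (simp add: w(1,3) ab_new[OF w(2)] ab_new[OF w(4)]) (simp add: 2 replicate_add)
        then show ?thesis
          using yz(3) seq_prefix_less_trans by (metis seq_less_irrefl)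
      qed
    qed
  qed
  have ab_s: "ab u' ?s = c @ replicate (length r) (mx c)"
    using ab_new[of r "[]"] by simp
  have le_s: "t \<in> u' \<Longrightarrow> ab u' t = ab u' ?s \<or> ab u' t \<prec> ab u' ?s" for t
  proof -
    assume "t \<in> u'"
    then consider "t = ?s" | "t \<in> u"
      by (auto simp: u'_def)
    then show ?thesis
    proof cases
      case 2
      then have t: "t \<in> nodes u"
        using subset_nodes by blast
      show ?thesis
        unfolding ab_s old[OF t] using c_above[OF t] seq_less_prefix_trans by blast
    qed simp
  qed
  \<comment> \<open>An old node \<open>z\<close> other than \<open>x\<close> has its free position
    after \<open>c\<close>; if this preceded the address of the new member it would extend
    \<open>c\<close>, and some prefix of \<open>z\<close> would have the free address
    \<open>c\<close>. If \<open>z\<close> is \<open>x\<close> or a new inner node, it has just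
    gained a child, so its next free position has a larger maximum than \<open>c\<close>.\<close>
  have cand_s: "\<not> cand u' z \<prec> ab u' ?s" if z: "z \<in> nodes u' - L" for z
  proof (cases "z \<in> nodes u \<and> z \<noteq> x")
    case True
    have "{n. z @ [n] \<in> nodes u'} = {n. z @ [n] \<in> nodes u}"
    proof -
      have "z @ [n] \<noteq> x @ m # w" for n w
      proof
        assume "z @ [n] = x @ m # w"
        then show False
          using True new_notin by (cases w rule: rev_cases) auto
      qed
      then show ?thesis
        unfolding nodes_u' by blast
    qed
    then have eq: "cand u' z = cand u z"
      using True old by (simp add: cand_def)
    have "c \<prec> cand u z"
      using x z True unfolding growing_def c_def by blast
    show ?thesis
    proof
      assume "cand u' z \<prec> ab u' ?s"
      then obtain v where v: "cand u z = c @ v"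
        using seq_less_between[OF \<open>c \<prec> cand u z\<close>] unfolding eq ab_s by blast
      then have "v \<noteq> []"
        using \<open>c \<prec> cand u z\<close> by auto
      then obtain v' where "ab u z = c @ v'"
        using v unfolding cand_def by (cases v rule: rev_cases) auto
      then have "ab u (take (length c) z) = c"
        by (simp add: adr_take)
      moreover have "take (length c) z \<in> nodes u"
        using True nodes_prefix[of "take (length c) z" "drop (length c) z"] by simp
      ultimately show False
        using cand_not_adr[OF fin(1) xu(1)] unfolding c_def by blast
    qed
  next
    case False
    have "mx c < mx (cand u' z)"
    proof (cases "z = x")
      case True
      have "{n. x @ [n] \<in> nodes u'} = insert m {n. x @ [n] \<in> nodes u}"
        unfolding nodes_u' by auto
      then have "card {n. x @ [n] \<in> nodes u'} = Suc (card {n. x @ [n] \<in> nodes u})"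
        using new_notin[of "[]"] finite_children[OF fin(1)] by simp
      then show ?thesis
        using old[OF xu(1)] by (simp add: True c_def cand_def)
    next
      case False
      then obtain w v where w: "z = x @ m # w" "r = w @ v"
        using z nodes_u' \<open>\<not> (z \<in> nodes u \<and> z \<noteq> x)\<close> by auto
      have "v \<noteq> []"
        using z s w by auto
      then obtain n v' where "v = n # v'"
        by (cases v) auto
      then have "z @ [n] \<in> nodes u'"
        using w unfolding nodes_u' by auto
      then have "card {n. z @ [n] \<in> nodes u'} > 0"
        using finite_children[OF fin(2)] card_gt_0_iff by blast
      then show ?thesis
        unfolding cand_def w(1) ab_new[OF w(2)] by simp
    qed
    moreover have "mx (ab u' ?s) = mx c"
      by (simp add: ab_s)
    ultimately show ?thesis
      by (simp add: seq_less_iff)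
  qed
  have "\<not> cand u' z \<prec> ab u' t" if "z \<in> nodes u' - L" "t \<in> u'" for z t
    using cand_s[OF that(1)] le_s[OF that(2)] seq_less_trans by metis
  then show "proper (insert ?s u)"
    using fin ord s unfolding proper_def u'_def by blast
qed

text \<open>
  The position of the next member is determined by the finite part: it is the node whose
  next child has the least address.
\<close>

lemma next_member:
  assumes S: "S \<in> tree_space L" and u: "finite u" "end_ext u S" and x: "growing u x"
    and s: "s \<in> S - u" "end_ext (insert s u) S"
  obtains m r where "s = x @ m # r" "x @ [m] \<notin> nodes u"
proof -
  have SL: "S \<subseteq> L" and uS: "u \<subseteq> S" "nodes u \<subseteq> nodes S"
    using S u nodes_mono[of u S] by (auto simp: tree_space_def end_ext_def)
  have s_notin: "s \<notin> nodes u"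
    using leaf_in[of u s] s uS SL by blast
  obtain p m r where spm: "s = p @ m # r" and pu: "p \<in> nodes u" and pm: "p @ [m] \<notin> nodes u"
    using exit_node[OF s_notin] by blast
  have pmS: "p @ [m] \<in> nodes S"
    using s(1) append_in_nodes[of "p @ [m]" r S] by (simp add: spm)
  have pL: "p \<notin> L"
    using antichain[of p "m # r"] s(1) SL by (auto simp: spm)
  have nodes_s: "nodes (insert s u) = nodes u \<union> {p @ m # w | w v. r = w @ v}"
    unfolding spm by (rule nodes_insert[OF pu])
  have below: "y \<in> nodes (insert s u)" if "y \<in> nodes S" "y \<prec> p @ [m]" for y
  proof (rule ccontr)
    assume "y \<notin> nodes (insert s u)"
    moreover have "p @ [m] \<in> nodes (insert s u)"
      unfolding nodes_s by auto
    ultimately have "p @ [m] \<prec> y"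
      using s(2) that unfolding end_ext_def by blast
    then show False
      using that seq_less_asym by blast
  qed
  have ab_pm: "ab S (p @ [m]) = cand u p"
  proof (rule new_child_adr[OF u(2) pu])
    fix m' assume m': "m' < m" "p @ [m'] \<in> nodes S"
    then have "p @ [m'] \<in> nodes (insert s u)"
      using below seq_less_snoc by blast
    then show "p @ [m'] \<in> nodes u"
      using m' unfolding nodes_s by auto
  qed (use pmS pm in simp)
  \<comment> \<open>Otherwise the node of \<open>S\<close> with address \<open>cand u x\<close>
    precedes \<open>p @ [m]\<close>, so it belongs to the new branch; then \<open>x\<close> lies
    above \<open>p @ [m]\<close>, which would be an old node.\<close>
  have "p = x"
  proof (rule ccontr)
    assume "p \<noteq> x"
    have xu: "x \<in> nodes u - L"
      using x by (simp add: growing_def)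
    obtain m' where m': "x @ [m'] \<in> nodes S - nodes u" "ab S (x @ [m']) = cand u x"
      using first_new_child[OF S u(2,1) xu] .
    have "cand u x \<prec> cand u p"
      using x pu pL \<open>p \<noteq> x\<close> unfolding growing_def by blast
    then have "x @ [m'] \<prec> p @ [m]"
      using tree_space_less_iff[OF S, of "x @ [m']" "p @ [m]"] m' ab_pm pmS by auto
    then have "x @ [m'] \<in> nodes (insert s u)"
      using below m' by blast
    then obtain w where w: "x @ [m'] = p @ m # w"
      using m' unfolding nodes_s by auto
    then have "w \<noteq> []"
      using \<open>p \<noteq> x\<close> by auto
    then have "x = p @ m # butlast w"
      using w by (cases w rule: rev_cases) auto
    then show False
      using xu pm nodes_prefix[of "p @ [m]" "butlast w" u] by simp
  qed
  then show ?thesis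
    using that spm pm by blast
qed

text \<open>Fatness is the point. If a node \<open>x\<close> stopped acquiring children, its free
  position \<open>cand S x\<close> would be final and properness would bound the addresses of all
  members by it; but only finitely many members have bounded addresses.\<close>

lemma chain_limit:
  assumes proper: "\<And>n. proper (u n)" and ee: "\<And>n. end_ext (u n) (u (Suc n))"
    and strict: "\<And>n. u n \<noteq> u (Suc n)"
  shows "(\<Union>n. u n) \<in> tree_space L" "end_ext (u k) (\<Union>n. u n)"
proof -
  define S where "S = (\<Union>n. u n)"
  have ee_le: "end_ext (u m) (u n)" if "m \<le> n" for m n
    using that
  proof (induction rule: dec_induct)
    case base
    then show ?case
      by (simp add: end_ext_def)
  next
    case (step n)
    show ?case
      by (rule end_ext_trans[OF step.IH ee])
  qed
  have mono: "nodes (u m) \<subseteq> nodes (u n)" if "m \<le> n" for m n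
    using ee_le[OF that] nodes_mono unfolding end_ext_def by blast
  have nodes_S: "nodes S = (\<Union>n. nodes (u n))"
    unfolding S_def by (rule nodes_Union)
  have ee_S: "end_ext (u n) S" for n
    unfolding end_ext_def
  proof (intro conjI ballI)
    fix x y assume x: "x \<in> nodes S - nodes (u n)" and y: "y \<in> nodes (u n)"
    then obtain k where k: "x \<in> nodes (u k)"
      unfolding nodes_S by blast
    then have "n \<le> k"
      using x mono[of k n] by (cases "k \<le> n") auto
    then show "y \<prec> x"
      using ee_le x y k unfolding end_ext_def by blast
  qed (auto simp: S_def)
  have SL: "S \<subseteq> L"
    using proper unfolding S_def proper_def by blast
  have "infinite S"
  proof
    assume fin: "finite S"
    have "n \<le> card (u n)" for n
    proof (induction n)
      case (Suc n)
      have "u n \<subset> u (Suc n)"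
        using ee strict unfolding end_ext_def by blast
      then have "card (u n) < card (u (Suc n))"
        using proper[of "Suc n"] by (intro psubset_card_mono) (auto simp: proper_def)
      then show ?case
        using Suc by simp
    qed simp
    moreover have "card (u n) \<le> card S" for n
      using fin by (intro card_mono) (auto simp: S_def)
    ultimately show False
      by (metis Suc_n_not_le_n le_trans)
  qed
  have "ordered S"
    unfolding ordered_def
  proof (intro ballI impI)
    fix x y assume xy: "x \<in> nodes S" "y \<in> nodes S" "ab S x \<prec> ab S y"
    then obtain m n where "x \<in> nodes (u m)" "y \<in> nodes (u n)"
      unfolding nodes_S by blast
    then have "x \<in> nodes (u (max m n))" "y \<in> nodes (u (max m n))"
      using mono[of m "max m n"] mono[of n "max m n"] by auto
    then show "x \<prec> y"
      using proper[of "max m n"] xy(3) end_ext_adr[OF ee_S] by (simp add: proper_def ordered_def)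
  qed
  moreover have "fat L S"
    unfolding fat_def
  proof (intro ballI notI)
    fix x assume x: "x \<in> nodes S - L" and fin: "finite {m. x @ [m] \<in> nodes S}"
    have "(\<lambda>m. x @ [m]) ` {m. x @ [m] \<in> nodes S} \<subseteq> (\<Union>n. nodes (u n))"
      unfolding nodes_S[symmetric] by blast
    then obtain N where N: "(\<lambda>m. x @ [m]) ` {m. x @ [m] \<in> nodes S} \<subseteq> nodes (u N)"
      using finite_subset_incseq[of "\<lambda>n. nodes (u n)", OF mono finite_imageI[OF fin]] by blast
    obtain N' where N': "x \<in> nodes (u N')"
      using x unfolding nodes_S by blast
    let ?c = "cand S x"
    have "mx (ab S s) \<le> mx ?c" if s: "s \<in> S" for s
    proof -
      obtain k where k: "s \<in> u k"
        using s unfolding S_def by blast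
      define n where "n = max k (max N N')"
      have le: "k \<le> n" "N \<le> n" "N' \<le> n"
        by (simp_all add: n_def)
      have n: "s \<in> u n" "x \<in> nodes (u n)"
        using k ee_le[OF le(1)] N' mono[OF le(3)] unfolding end_ext_def by blast+
      have "{m. x @ [m] \<in> nodes S} \<subseteq> {m. x @ [m] \<in> nodes (u n)}"
        using N mono[OF le(2)] by blast
      moreover have "{m. x @ [m] \<in> nodes (u n)} \<subseteq> {m. x @ [m] \<in> nodes S}"
        unfolding nodes_S by blast
      ultimately have "{m. x @ [m] \<in> nodes (u n)} = {m. x @ [m] \<in> nodes S}"
        by blast
      then have "cand (u n) x = ?c"
        using end_ext_adr[OF ee_S n(2)] by (simp add: cand_def)
      moreover have "ab S s = ab (u n) s"
        using end_ext_adr[OF ee_S] n(1) subset_nodes by blast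
      moreover have "\<not> cand (u n) x \<prec> ab (u n) s"
        using proper[of n] n x unfolding proper_def by blast
      ultimately show ?thesis
        by (simp add: seq_less_iff)
    qed
    then have "S \<subseteq> {s \<in> S. mx (ab S s) \<le> mx ?c}"
      by blast
    then show False
      using finite_bounded_adr[OF SL] \<open>infinite S\<close> finite_subset by blast
  qed
  ultimately show "(\<Union>n. u n) \<in> tree_space L"
    using SL \<open>infinite S\<close> by (auto simp: tree_space_def S_def)
  show "end_ext (u k) (\<Union>n. u n)"
    using ee_S by (simp add: S_def)
qed

lemma fat_children: "fat L Q \<Longrightarrow> x \<in> nodes Q \<Longrightarrow> x \<notin> L \<Longrightarrow> infinite {m. x @ [m] \<in> nodes Q}"
  by (simp add: fat_def)

lemma extend_in_fat:
  assumes u: "proper u" "u \<subseteq> Q" and Q: "Q \<subseteq> L" "fat L Q"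
  shows "\<exists>S\<in>tree_space L. S \<subseteq> Q \<and> end_ext u S"
proof -
  have step: "\<exists>v'. (proper v' \<and> v' \<subseteq> Q) \<and> (end_ext v v' \<and> v \<noteq> v')" if v: "proper v" "v \<subseteq> Q" for v
  proof -
    have fin: "finite v"
      using v by (simp add: proper_def)
    then obtain x where x: "growing v x"
      by (rule growing_exists)
    have "x \<in> nodes Q" "x \<notin> L"
      using x nodes_mono[OF v(2)] unfolding growing_def by blast+
    then have inf: "infinite {m. x @ [m] \<in> nodes Q}"
      using fat_children Q by blast
    define K where "K = Max (mx ` nodes v)"
    obtain m where m: "x @ [m] \<in> nodes Q" "K < m"
      using inf unfolding infinite_nat_iff_unbounded by blast
    then obtain r where r: "(x @ [m]) @ r \<in> Q"
      by (auto elim: nodesE)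
    \<comment> \<open>Since \<open>\<prec>\<close> compares maxima first, a child above all entries
      used so far comes after all old nodes, wherever it is attached.\<close>
    have new: "y \<prec> x @ [m]" if "y \<in> nodes v" for y
    proof -
      have "mx y \<le> K"
        unfolding K_def using that finite_nodes[OF fin] by simp
      then have "mx y < mx (x @ [m])"
        using m(2) by simp
      then show ?thesis
        by (simp add: seq_less_iff del: mx_simps)
    qed
    have "x @ [m] \<notin> nodes v"
      using new[of "x @ [m]"] by auto
    then have "x @ m # r \<notin> v"
      using append_in_nodes[of "x @ [m]" r v] by auto
    moreover have "proper (insert (x @ m # r) v)" "end_ext v (insert (x @ m # r) v)"
      using proper_insert[OF v(1) x _ new, of r] r Q by auto
    ultimately show ?thesis
      using v r by (intro exI[of _ "insert (x @ m # r) v"]) auto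
  qed
  have "\<exists>f. \<forall>n. ((proper (f n) \<and> f n \<subseteq> Q) \<and> (n = 0 \<longrightarrow> f n = u)) \<and>
      (end_ext (f n) (f (Suc n)) \<and> f n \<noteq> f (Suc n))"
    by (rule dependent_nat_choice) (use u step in auto)
  then obtain f where f: "f 0 = u" "\<And>n. proper (f n)" "\<And>n. f n \<subseteq> Q"
    "\<And>n. end_ext (f n) (f (Suc n))" "\<And>n. f n \<noteq> f (Suc n)"
    by blast
  show ?thesis
    using chain_limit(1)[of f, OF f(2,4,5)] chain_limit(2)[of f 0, OF f(2,4,5)] f(1,3)
    by (intro bexI[of _ "\<Union>n. f n"]) auto
qed

text \<open>
  The subtree can stay infinitely branching since at each node one colour wins above infinitely
  many children.
\<close>

lemma homogeneous_subtree:
  fixes c :: "nat list \<Rightarrow> bool"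
  assumes Q: "Q \<subseteq> L" "fat L Q" "Q \<noteq> {}" and x: "x \<in> nodes Q"
  shows "\<exists>Q'\<subseteq>Q. Q' \<noteq> {} \<and> (\<forall>z\<in>Q'. \<exists>y. z = x @ y) \<and>
    (\<forall>w. x @ w \<in> nodes Q' - L \<longrightarrow> infinite {m. x @ w @ [m] \<in> nodes Q'}) \<and>
    (\<exists>b. \<forall>z\<in>Q'. c z = b)"
proof -
  have "x \<in> nodes L"
    using x nodes_mono[OF Q(1)] by blast
  then show ?thesis
    using x
  proof (induction rule: node_induct)
    case (step x)
    show ?case
    proof (cases "x \<in> L")
      case True
      then have "x \<in> Q"
        using leaf_in Q step.prems by blast
      moreover have "x @ w \<notin> nodes {x} - L" for w
        using leaf_children[of "{x}" x w] True by auto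
      ultimately show ?thesis
        using True by (intro exI[of _ "{x}"]) auto
    next
      case False
      define M where "M = {m. x @ [m] \<in> nodes Q}"
      have inf: "infinite M"
        unfolding M_def using fat_children Q step.prems False by blast
      \<comment> \<open>The claim for the child \<open>x @ [m]\<close>. Branching is asked only from
        \<open>x @ [m]\<close> upwards: the nodes below it have a single child in
        \<open>F\<close>.\<close>
      define G where "G m F b \<longleftrightarrow> F \<subseteq> Q \<and> F \<noteq> {} \<and> (\<forall>z\<in>F. \<exists>y. z = (x @ [m]) @ y) \<and>
          (\<forall>w. (x @ [m]) @ w \<in> nodes F - L \<longrightarrow> infinite {k. (x @ [m]) @ w @ [k] \<in> nodes F}) \<and>
          (\<forall>z\<in>F. c z = b)" for m F b
      have "\<exists>F b. G m F b" if "m \<in> M" for m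
        using step.IH[of m] that nodes_mono[OF Q(1)] unfolding M_def G_def by blast
      then obtain F b where "\<And>m. m \<in> M \<Longrightarrow> G m (F m) (b m)"
        by metis
      then have F: "\<And>m. m \<in> M \<Longrightarrow> F m \<subseteq> Q" "\<And>m. m \<in> M \<Longrightarrow> F m \<noteq> {}"
        "\<And>m z. m \<in> M \<Longrightarrow> z \<in> F m \<Longrightarrow> \<exists>y. z = (x @ [m]) @ y"
        "\<And>m w. m \<in> M \<Longrightarrow> (x @ [m]) @ w \<in> nodes (F m) - L \<Longrightarrow>
          infinite {k. (x @ [m]) @ w @ [k] \<in> nodes (F m)}"
        "\<And>m z. m \<in> M \<Longrightarrow> z \<in> F m \<Longrightarrow> c z = b m"
        unfolding G_def by blast+
      have "M = {m \<in> M. b m} \<union> {m \<in> M. \<not> b m}"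
        by blast
      then have "infinite {m \<in> M. b m} \<or> infinite {m \<in> M. \<not> b m}"
        using inf by (metis finite_UnI)
      then obtain b0 where b0: "infinite {m \<in> M. b m = b0}"
        by (elim disjE) (auto intro: that[of True] that[of False])
      define Q' where "Q' = (\<Union>m\<in>{m \<in> M. b m = b0}. F m)"
      have child: "x @ [m] \<in> nodes Q'" if m: "m \<in> {m \<in> M. b m = b0}" for m
      proof -
        obtain z where "z \<in> F m"
          using F(2) m by blast
        moreover from this obtain y where "z = (x @ [m]) @ y"
          using F(3) m by blast
        ultimately show ?thesis
          using m append_in_nodes[of "x @ [m]" y Q'] unfolding Q'_def by blast
      qed
      have "infinite {k. x @ w @ [k] \<in> nodes Q'}" if w: "x @ w \<in> nodes Q' - L" for w
      proof (cases w)
        case Nil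
        have "{m \<in> M. b m = b0} \<subseteq> {k. x @ w @ [k] \<in> nodes Q'}"
          using child Nil by auto
        then show ?thesis
          using b0 finite_subset by blast
      next
        case (Cons m w')
        then obtain v where "(x @ w) @ v \<in> Q'"
          using w by (auto elim: nodesE)
        then obtain m' where m': "m' \<in> M" "b m' = b0" "(x @ w) @ v \<in> F m'"
          unfolding Q'_def by blast
        then have "m' = m"
          using F(3)[of m' "(x @ w) @ v"] Cons by auto
        then have "(x @ [m]) @ w' \<in> nodes (F m) - L"
          using m' w Cons append_in_nodes[of "x @ w" v] by auto
        then have "infinite {k. (x @ [m]) @ w' @ [k] \<in> nodes (F m)}"
          using F(4) m' \<open>m' = m\<close> by blast
        moreover have "nodes (F m) \<subseteq> nodes Q'"
          using m' \<open>m' = m\<close> by (intro nodes_mono) (auto simp: Q'_def)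
        then have "{k. (x @ [m]) @ w' @ [k] \<in> nodes (F m)} \<subseteq> {k. x @ w @ [k] \<in> nodes Q'}"
          using Cons by auto
        ultimately show ?thesis
          using finite_subset by blast
      qed
      moreover have "Q' \<subseteq> Q" "\<forall>z\<in>Q'. c z = b0"
        using F(1,5) unfolding Q'_def by blast+
      moreover have "\<forall>z\<in>Q'. \<exists>y. z = x @ y"
        using F(3) unfolding Q'_def by fastforce
      moreover have "{m \<in> M. b m = b0} \<noteq> {}"
        using b0 by (metis finite.emptyI)
      then have "Q' \<noteq> {}"
        using F(2) unfolding Q'_def by blast
      ultimately show ?thesis
        by (intro exI[of _ Q'] conjI) auto
    qed
  qed
qed

section \<open>Amalgamation, pigeonhole and the other axioms\<close>

lemma first_members_mono: "m \<le> n \<Longrightarrow> first_members m S \<subseteq> first_members n S"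
  by (auto simp: first_members_def)

lemma tree_space_first_members:
  assumes "X \<in> tree_space L"
  shows "finite (first_members n X)" "card (first_members n X) = n"
    "end_ext (first_members n X) X" "proper (first_members n X)" "first_members n X \<subseteq> X"
proof -
  have X: "X \<subseteq> L" "infinite X"
    using assms tree_space_infinite by (auto simp: tree_space_def)
  show "finite (first_members n X)" "card (first_members n X) = n"
    using first_members_finite_card[OF X] by auto
  show "end_ext (first_members n X) X"
    by (rule first_members_end_ext[OF assms])
  then show "proper (first_members n X)"
    by (rule end_ext_proper[OF assms]) fact
  show "first_members n X \<subseteq> X"
    by (auto simp: first_members_def)
qed

lemma space_extend:
  assumes Z: "Z \<in> tree_space L" and Q: "Q \<subseteq> L" "fat L Q" "first_members m Z \<subseteq> Q"
  shows "\<exists>Y\<in>tree_space L. Y \<subseteq> Q \<and> first_members m Y = first_members m Z"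
proof -
  obtain S where S: "S \<in> tree_space L" "S \<subseteq> Q" "end_ext (first_members m Z) S"
    using extend_in_fat[OF tree_space_first_members(4)[OF Z] Q(3,1,2)] by blast
  then have "first_members (card (first_members m Z)) S = first_members m Z"
    by (intro end_ext_first_members tree_space_first_members(1)[OF Z]) (auto simp: tree_space_def)
  then show ?thesis
    using S unfolding tree_space_first_members(2)[OF Z] by blast
qed

text \<open>Let \<open>v\<close> and \<open>w\<close> be the given approximations of
  \<open>Y\<close> and \<open>X\<close>. The set \<open>X'\<close> is found inside the set
  \<open>Q\<close> of those members of \<open>X\<close> that lie in \<open>Y\<close> as soon as they
  branch off from a node of \<open>v\<close> through a child that is not a node of \<open>w\<close>.
  \<open>Q\<close> contains \<open>w\<close> and \<open>Y\<close>. The further members of a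
  \<open>Z\<close> starting with \<open>v\<close> do branch off in this way, because
  \<open>d\<close> is minimal: no node of \<open>w\<close> comes after all of
  \<open>v\<close>.\<close>

lemma space_amalgamate:
  assumes X: "X \<in> tree_space L" and Y: "Y \<in> tree_space L" "Y \<subseteq> X"
    and sub: "first_members m Y \<subseteq> first_members d X"
    and min: "\<And>k. k < d \<Longrightarrow> \<not> first_members m Y \<subseteq> first_members k X"
  shows "\<exists>X'\<in>tree_space L. X' \<subseteq> X \<and> first_members d X' = first_members d X \<and>
    (\<forall>Z\<in>tree_space L. Z \<subseteq> X' \<longrightarrow> first_members m Z = first_members m Y \<longrightarrow> Z \<subseteq> Y)"
proof -
  define v w where "v = first_members m Y" and "w = first_members d X"
  note X' = tree_space_first_members[OF X, of d, folded w_def]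
  note Y' = tree_space_first_members[OF Y(1), of m, folded v_def]
  have XL: "X \<subseteq> L" "fat L X" and YL: "Y \<subseteq> L" "fat L Y" "Y \<noteq> {}"
    using X Y by (auto simp: tree_space_def)
  define Q where "Q = {z \<in> X. \<forall>p n r. z = p @ n # r \<longrightarrow> p \<in> nodes v \<longrightarrow> p @ [n] \<notin> nodes w \<longrightarrow> z \<in> Y}"
  have YQ: "Y \<subseteq> Q"
    using Y by (auto simp: Q_def)
  have wQ: "w \<subseteq> Q"
  proof
    fix z assume z: "z \<in> w"
    then have "p @ [n] \<in> nodes w" if "z = p @ n # r" for p n r
      using that append_in_nodes[of "p @ [n]" r w] by simp
    then show "z \<in> Q"
      using z X'(5) unfolding Q_def by blast
  qed
  have "fat L Q"
    unfolding fat_def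
  proof
    fix y assume y: "y \<in> nodes Q - L"
    show "infinite {n. y @ [n] \<in> nodes Q}"
    proof (cases "y \<in> nodes Y")
      case True
      then have "infinite {n. y @ [n] \<in> nodes Y}"
        using fat_children YL y by blast
      moreover have "{n. y @ [n] \<in> nodes Y} \<subseteq> {n. y @ [n] \<in> nodes Q}"
        using nodes_mono[OF YQ] by blast
      ultimately show ?thesis
        using finite_subset by blast
    next
      case False
      have "y \<in> nodes X"
        using y nodes_mono[of Q X] by (auto simp: Q_def)
      then have "infinite {n. y @ [n] \<in> nodes X}"
        using fat_children XL y by blast
      moreover have "y @ [n] \<in> nodes Q" if n: "y @ [n] \<in> nodes X" for n
      proof -
        obtain r where r: "(y @ [n]) @ r \<in> X"
          using n by (auto elim: nodesE)
        \<comment> \<open>The condition of \<open>Q\<close> is not triggered here: \<open>p\<close>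
          is a node of \<open>Y\<close>, so it would be a proper prefix of \<open>y\<close> and
          would already bind the member of \<open>Q\<close> above \<open>y\<close>, which puts
          \<open>y\<close> into the tree of \<open>Y\<close>.\<close>
        have False if z: "(y @ [n]) @ r = p @ n' # r'" "p \<in> nodes v" "p @ [n'] \<notin> nodes w" for p n' r'
        proof -
          have pY: "p \<in> nodes Y"
            using z(2) nodes_mono[OF Y'(5)] by blast
          have "y @ n # r = p @ n' # r'"
            using z(1) by simp
          then consider us where "y = p @ us" | us where "p = y @ us"
            by (auto simp: append_eq_append_conv2)
          then show False
          proof cases
            case (1 us)
            then have "us \<noteq> []"
              using pY False by auto
            then obtain us' where us': "y = p @ n' # us'"
              using z(1) 1 by (cases us) auto
            obtain t where t: "y @ t \<in> Q"
              using y wQ YQ YL leaf_above[of Q y] by blast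
            then have "y @ t \<in> Y"
              using us' z unfolding Q_def by auto
            then show False
              using False append_in_nodes by blast
          next
            case (2 us)
            then show False
              using pY False nodes_prefix by blast
          qed
        qed
        then have "(y @ [n]) @ r \<in> Q"
          using r unfolding Q_def by blast
        then show ?thesis
          by (rule append_in_nodes)
      qed
      then have "{n. y @ [n] \<in> nodes X} \<subseteq> {n. y @ [n] \<in> nodes Q}"
        by blast
      ultimately show ?thesis
        using finite_subset by blast
    qed
  qed
  moreover have "Q \<subseteq> L"
    using XL(1) by (auto simp: Q_def)
  ultimately obtain S where S: "S \<in> tree_space L" "S \<subseteq> Q" "first_members d S = w"
    using space_extend[OF X, of Q d] wQ unfolding w_def by blast
  \<comment> \<open>By minimality of \<open>d\<close> some member of \<open>v\<close> is not among
    the first \<open>d - 1\<close> of \<open>X\<close>, so no member of \<open>w\<close> comes after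
    it.\<close>
  have w_le: "y \<in> nodes w \<Longrightarrow> y \<noteq> [] \<Longrightarrow> \<exists>t\<in>v. y = t \<or> y \<prec> t" for y
  proof -
    assume y: "y \<in> nodes w" "y \<noteq> []"
    then obtain q where q: "y @ q \<in> w"
      by (auto elim: nodesE)
    then have "d \<noteq> 0"
      by (auto simp: w_def first_members_def)
    then obtain t where t: "t \<in> v" "t \<notin> first_members (d - 1) X"
      using min[of "d - 1"] unfolding v_def by auto
    have "t \<in> X" "y @ q \<in> X"
      using t Y' Y q X' by blast+
    have "\<not> t \<prec> y @ q"
    proof
      assume "t \<prec> y @ q"
      then have "card {x \<in> X. x \<prec> t} < card {x \<in> X. x \<prec> y @ q}"
        using card_predecessors_less[OF XL(1) \<open>t \<in> X\<close>] by blast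
      moreover have "card {x \<in> X. x \<prec> y @ q} < d"
        using q unfolding w_def first_members_iff[OF XL(1)] by blast
      moreover have "\<not> card {x \<in> X. x \<prec> t} < d - 1"
        using t(2) \<open>t \<in> X\<close> unfolding first_members_iff[OF XL(1)] by blast
      ultimately show False
        by simp
    qed
    then have "y @ q = t \<or> y @ q \<prec> t"
      using seq_less_linear by blast
    moreover have "y = y @ q \<or> y \<prec> y @ q"
      using seq_less_append[of q y] by (cases "q = []") auto
    ultimately have "y = t \<or> y \<prec> t"
      using seq_less_trans[of y "y @ q" t] by auto
    then show ?thesis
      using t(1) by blast
  qed
  have "Z \<subseteq> Y" if Z: "Z \<in> tree_space L" "Z \<subseteq> S" "first_members m Z = v" for Z
  proof
    fix z assume z: "z \<in> Z"
    show "z \<in> Y"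
    proof (cases "z \<in> v")
      case True
      then show ?thesis
        using Y' by blast
    next
      case False
      have eeZ: "end_ext v Z"
        using tree_space_first_members(3)[OF Z(1), of m] Z(3) by simp
      have "z \<in> L"
        using z Z(1) by (auto simp: tree_space_def)
      then have "z \<notin> nodes v"
        using leaf_in[of v z] False Y'(5) YL by blast
      then obtain p n r where pnr: "z = p @ n # r" "p \<in> nodes v" "p @ [n] \<notin> nodes v"
        using exit_node by blast
      have "p @ [n] \<in> nodes Z"
        using z pnr(1) append_in_nodes[of "p @ [n]" r Z] by simp
      then have above: "y \<prec> p @ [n]" if "y \<in> nodes v" for y
        using eeZ pnr(3) that unfolding end_ext_def by blast
      have "p @ [n] \<notin> nodes w"
      proof
        assume "p @ [n] \<in> nodes w"
        then obtain t where "t \<in> v" "p @ [n] = t \<or> p @ [n] \<prec> t"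
          using w_le by blast
        then show False
          using above[of t] subset_nodes[of v] seq_less_asym by auto
      qed
      then show ?thesis
        using z Z(2) S(2) pnr unfolding Q_def by blast
    qed
  qed
  then show ?thesis
    using S unfolding v_def w_def Q_def by (intro bexI[of _ S]) auto
qed

text \<open>By \<open>next_member\<close> the next member is attached at the growing node
  \<open>x\<close> of the common initial part \<open>v\<close>, whatever \<open>Z\<close> is. So it
  suffices to make the colour of \<open>insert z v\<close> constant for the \<open>z\<close> that
  leave \<open>v\<close> at \<open>x\<close>.\<close>

lemma space_pigeonhole:
  fixes P :: "nat list set \<Rightarrow> bool"
  assumes X: "X \<in> tree_space L"
  shows "\<exists>Y\<in>tree_space L. Y \<subseteq> X \<and> first_members m Y = first_members m X \<and>
    ((\<forall>Z\<in>tree_space L. Z \<subseteq> Y \<longrightarrow> first_members m Z = first_members m X \<longrightarrow>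
        P (first_members (Suc m) Z)) \<or>
     (\<forall>Z\<in>tree_space L. Z \<subseteq> Y \<longrightarrow> first_members m Z = first_members m X \<longrightarrow>
        \<not> P (first_members (Suc m) Z)))"
proof -
  define v where "v = first_members m X"
  note v = tree_space_first_members[OF X, of m, folded v_def]
  have XL: "X \<subseteq> L" "fat L X" "X \<noteq> {}"
    using X by (auto simp: tree_space_def)
  obtain x where x: "growing v x"
    using growing_exists[OF v(1)] .
  then have xv: "x \<in> nodes v" "x \<notin> L"
    by (auto simp: growing_def)
  have "x \<in> nodes X"
    using xv(1) nodes_mono[OF v(5)] by blast
  from homogeneous_subtree[OF XL this, of "\<lambda>z. P (insert z v)"]
  obtain Q' b where *: "Q' \<subseteq> X" "Q' \<noteq> {}" "\<forall>z\<in>Q'. \<exists>y. z = x @ y"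
    "\<forall>w. x @ w \<in> nodes Q' - L \<longrightarrow> infinite {m. x @ w @ [m] \<in> nodes Q'}"
    "\<forall>z\<in>Q'. P (insert z v) = b"
    by (elim exE conjE)
  then have Q': "Q' \<subseteq> X" "Q' \<noteq> {}" "\<And>z. z \<in> Q' \<Longrightarrow> \<exists>y. z = x @ y"
    "\<And>w. x @ w \<in> nodes Q' - L \<Longrightarrow> infinite {m. x @ w @ [m] \<in> nodes Q'}"
    "\<And>z. z \<in> Q' \<Longrightarrow> P (insert z v) = b"
    by simp_all
  \<comment> \<open>Members that do not leave \<open>v\<close> at \<open>x\<close> are kept, so that
    \<open>v\<close> stays inside and the other nodes keep infinitely many children.\<close>
  define Q where "Q = {z \<in> X. \<forall>n r. z = x @ n # r \<longrightarrow> x @ [n] \<notin> nodes v \<longrightarrow> z \<in> Q'}"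
  have Q'Q: "Q' \<subseteq> Q"
    using Q'(1) by (auto simp: Q_def)
  have QX: "Q \<subseteq> X"
    by (auto simp: Q_def)
  have vQ: "v \<subseteq> Q"
  proof
    fix z assume z: "z \<in> v"
    then have "x @ [n] \<in> nodes v" if "z = x @ n # r" for n r
      using that append_in_nodes[of "x @ [n]" r v] by simp
    then show "z \<in> Q"
      using z v(5) unfolding Q_def by blast
  qed
  have inf_Q': "infinite {k. x @ w @ [k] \<in> nodes Q}" if "x @ w \<in> nodes Q'" "x @ w \<notin> L" for w
  proof -
    have "infinite {k. x @ w @ [k] \<in> nodes Q'}"
      using Q'(4) that by blast
    moreover have "{k. x @ w @ [k] \<in> nodes Q'} \<subseteq> {k. x @ w @ [k] \<in> nodes Q}"
      using nodes_mono[OF Q'Q] by blast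
    ultimately show ?thesis
      using finite_subset by blast
  qed
  have "fat L Q"
    unfolding fat_def
  proof
    fix y assume y: "y \<in> nodes Q - L"
    consider "y = x" | n r where "y = x @ n # r" "x @ [n] \<notin> nodes v"
      | "y \<noteq> x" "\<And>n r. y = x @ n # r \<Longrightarrow> x @ [n] \<in> nodes v"
      by blast
    then show "infinite {n. y @ [n] \<in> nodes Q}"
    proof cases
      case 1
      obtain z where "z \<in> Q'"
        using Q'(2) by blast
      then have "x \<in> nodes Q'"
        using Q'(3) append_in_nodes by blast
      then show ?thesis
        using inf_Q'[of "[]"] xv 1 by simp
    next
      case 2
      obtain w where w: "y @ w \<in> Q"
        using y Q'Q Q'(2) leaf_above[of Q y] by blast
      then have "y @ w \<in> Q'"
        using 2 unfolding Q_def by auto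
      then have "x @ n # r \<in> nodes Q'"
        using 2 append_in_nodes by blast
      then show ?thesis
        using inf_Q'[of "n # r"] y 2 by simp
    next
      case 3
      have "y \<in> nodes X"
        using y nodes_mono[OF QX] by blast
      \<comment> \<open>If \<open>y\<close> is a proper prefix of \<open>x\<close>, the child
        towards \<open>x\<close> is given up, since members through it may be lost; every other
        child avoids \<open>x\<close>. For other \<open>y\<close> the value
        \<open>x ! length y\<close> has no meaning, and dropping one child does no harm.\<close>
      then have "infinite ({n. y @ [n] \<in> nodes X} - {x ! length y})"
        using fat_children XL y by (simp add: infinite_remove)
      moreover have "y @ [n] \<in> nodes Q" if n: "y @ [n] \<in> nodes X" "n \<noteq> x ! length y" for n
      proof -
        obtain r where r: "(y @ [n]) @ r \<in> X"
          using n by (auto elim: nodesE)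
        have "x @ [n'] \<in> nodes v" if z: "(y @ [n]) @ r = x @ n' # r'" for n' r'
        proof -
          have "y @ n # r = x @ n' # r'"
            using z by simp
          then consider us where "y = x @ us" | us where "x = y @ us"
            by (auto simp: append_eq_append_conv2)
          then show ?thesis
          proof cases
            case (1 us)
            then have "us \<noteq> []"
              using 3(1) by auto
            then obtain us' where "y = x @ n' # us'"
              using z 1 by (cases us) auto
            then show ?thesis
              using 3(2) by blast
          next
            case (2 us)
            then have "us \<noteq> []"
              using 3(1) by auto
            then have "x ! length y = n"
              using z 2 by (cases us) auto
            then show ?thesis
              using n(2) by simp
          qed
        qed
        then have "(y @ [n]) @ r \<in> Q"
          using r unfolding Q_def by blast
        then show ?thesis
          by (rule append_in_nodes)
      qed
      then have "{n. y @ [n] \<in> nodes X} - {x ! length y} \<subseteq> {n. y @ [n] \<in> nodes Q}"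
        by blast
      ultimately show ?thesis
        using finite_subset by blast
    qed
  qed
  then obtain S where S: "S \<in> tree_space L" "S \<subseteq> Q" "first_members m S = v"
    using space_extend[OF X, of Q m] vQ subset_trans[OF QX XL(1)] unfolding v_def by blast
  have col: "P (first_members (Suc m) Z) = b" if Z: "Z \<in> tree_space L" "Z \<subseteq> S" "first_members m Z = v" for Z
  proof -
    let ?v' = "first_members (Suc m) Z"
    note v' = tree_space_first_members[OF Z(1), of "Suc m"]
    have sub: "v \<subseteq> ?v'"
      using first_members_mono[of m "Suc m" Z] Z(3) by simp
    then have "card (?v' - v) = 1"
      using v v' by (simp add: card_Diff_subset)
    then obtain s where "?v' - v = {s}"
      by (rule card_1_singletonE)
    then have s: "?v' = insert s v" "s \<notin> v"
      using sub by blast+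
    have eeZ: "end_ext v Z"
      using tree_space_first_members(3)[OF Z(1), of m] Z(3) by simp
    have sZ: "s \<in> Z"
      using v'(5) s by blast
    have "end_ext (insert s v) Z"
      using v'(3) s by simp
    then obtain n r where nr: "s = x @ n # r" "x @ [n] \<notin> nodes v"
      using next_member[OF Z(1) v(1) eeZ x, of s] sZ s(2) by blast
    then have "s \<in> Q'"
      using sZ Z(2) S(2) unfolding Q_def by blast
    then show ?thesis
      using Q'(5) s(1) by simp
  qed
  show ?thesis
    unfolding v_def[symmetric]
  proof (intro bexI[of _ S] conjI)
    show "(\<forall>Z\<in>tree_space L. Z \<subseteq> S \<longrightarrow> first_members m Z = v \<longrightarrow> P (first_members (Suc m) Z)) \<or>
      (\<forall>Z\<in>tree_space L. Z \<subseteq> S \<longrightarrow> first_members m Z = v \<longrightarrow> \<not> P (first_members (Suc m) Z))"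
      using col by (cases b) simp_all
  qed (use S QX in auto)
qed

lemma tree_space_approximation_space: "approximation_space (tree_space L) first_members"
proof
  fix X Y :: "nat list set" and m n d :: nat
  assume X: "X \<in> tree_space L"
  then have XL: "X \<subseteq> L" "fat L X"
    by (auto simp: tree_space_def)
  show "finite (first_members n X)" "card (first_members n X) = n"
    using tree_space_first_members[OF X] by auto
  show "first_members m X \<subseteq> first_members n X" if "m \<le> n"
    using first_members_mono[OF that] .
  show "(\<Union>n. first_members n X) = X"
  proof
    show "X \<subseteq> (\<Union>n. first_members n X)"
    proof
      fix s assume "s \<in> X"
      then have "s \<in> first_members (Suc (card {t \<in> X. t \<prec> s})) X"
        using first_members_iff[OF XL(1)] by simp
      then show "s \<in> (\<Union>n. first_members n X)"
        by blast
    qed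
  qed (auto simp: first_members_def)
next
  fix X Y :: "nat list set" and m n :: nat
  assume X: "X \<in> tree_space L" and Y: "Y \<in> tree_space L"
    and eq: "first_members n X = first_members n Y" and "m \<le> n"
  have sub: "first_members m X \<subseteq> first_members m Y"
    if X: "X \<in> tree_space L" and Y: "Y \<in> tree_space L"
      and eq: "first_members n X = first_members n Y" for X Y
  proof
    fix s assume s: "s \<in> first_members m X"
    have XL: "X \<subseteq> L" and YL: "Y \<subseteq> L"
      using X Y by (auto simp: tree_space_def)
    have s': "s \<in> first_members n X" "s \<in> first_members n Y"
      using s first_members_mono[OF \<open>m \<le> n\<close>] eq by auto
    have "{t \<in> X. t \<prec> s} = {t \<in> first_members n X. t \<prec> s}"
      using first_members_initial[OF XL s'(1)] tree_space_first_members(5)[OF X] by blast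
    moreover have "{t \<in> Y. t \<prec> s} = {t \<in> first_members n Y. t \<prec> s}"
      using first_members_initial[OF YL s'(2)] tree_space_first_members(5)[OF Y] by blast
    ultimately show "s \<in> first_members m Y"
      using s s'(2) eq by (simp add: first_members_iff[OF XL] first_members_iff[OF YL])
  qed
  show "first_members m X = first_members m Y"
    using sub[OF X Y eq] sub[OF Y X eq[symmetric]] by (rule equalityI)
next
  fix Xs :: "nat \<Rightarrow> nat list set"
  assume Xs: "\<And>n. Xs n \<in> tree_space L"
    and coh: "\<And>n. first_members n (Xs (Suc n)) = first_members n (Xs n)"
  define u where "u n = first_members n (Xs n)" for n
  note u = tree_space_first_members[OF Xs, of n n for n, folded u_def]
  have u_Suc: "u n \<subseteq> u (Suc n)" for n
    using first_members_mono[of n "Suc n" "Xs (Suc n)"] coh[of n] by (simp add: u_def)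
  have "end_ext (u n) (Xs (Suc n))" for n
    using tree_space_first_members(3)[OF Xs, of n "Suc n"] coh[of n] by (simp add: u_def)
  \<comment> \<open>\<open>u (Suc n)\<close> lies between \<open>u n\<close> and
    \<open>Xs (Suc n)\<close>, and end-extension is inherited by such a set.\<close>
  then have ee: "end_ext (u n) (u (Suc n))" for n
    using end_ext_mono u_Suc u(5) by blast
  have neq: "u n \<noteq> u (Suc n)" for n
    using u(2)[of n] u(2)[of "Suc n"] by auto
  have S: "(\<Union>n. u n) \<in> tree_space L" "end_ext (u k) (\<Union>n. u n)" for k
    using chain_limit[of u, OF u(4) ee neq] by blast+
  have "first_members k (\<Union>n. u n) = u k" for k
    using end_ext_first_members[OF _ u(1) S(2), of k] S(1) u(2)[of k] by (auto simp: tree_space_def)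
  then show "\<exists>Y\<in>tree_space L. \<forall>n. first_members n Y = first_members n (Xs n)"
    using S(1) unfolding u_def by blast
next
  fix Z X :: "nat list set" and m :: nat
  assume "Z \<in> tree_space L" "X \<in> tree_space L" "first_members m Z \<subseteq> X"
  then show "\<exists>Y\<in>tree_space L. Y \<subseteq> X \<and> first_members m Y = first_members m Z"
    by (intro space_extend) (auto simp: tree_space_def)
next
  fix X Y :: "nat list set" and m d :: nat
  assume "X \<in> tree_space L" "Y \<in> tree_space L" "Y \<subseteq> X" "first_members m Y \<subseteq> first_members d X"
    "\<And>k. k < d \<Longrightarrow> \<not> first_members m Y \<subseteq> first_members k X"
  then show "\<exists>X'\<in>tree_space L. X' \<subseteq> X \<and> first_members d X' = first_members d X \<and>
      (\<forall>Z\<in>tree_space L. Z \<subseteq> X' \<longrightarrow> first_members m Z = first_members m Y \<longrightarrow> Z \<subseteq> Y)"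
    by (rule space_amalgamate)
next
  fix X :: "nat list set" and m :: nat and P :: "nat list set \<Rightarrow> bool"
  assume "X \<in> tree_space L"
  then show "\<exists>Y\<in>tree_space L. Y \<subseteq> X \<and> first_members m Y = first_members m X \<and>
      ((\<forall>Z\<in>tree_space L. Z \<subseteq> Y \<longrightarrow> first_members m Z = first_members m X \<longrightarrow>
          P (first_members (Suc m) Z)) \<or>
       (\<forall>Z\<in>tree_space L. Z \<subseteq> Y \<longrightarrow> first_members m Z = first_members m X \<longrightarrow>
          \<not> P (first_members (Suc m) Z)))"
    by (rule space_pigeonhole)
qed

end

text \<open>The axioms speak of inclusion, equality and cardinality of subsets of the union of
  \<open>E\<close>, all of which an injection preserves.\<close>

lemma approximation_space_image:
  assumes "approximation_space E r" and inj: "inj_on f (\<Union>E)"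
    and r': "\<And>k X. X \<in> E \<Longrightarrow> r' k (f ` X) = f ` r k X"
  shows "approximation_space ((`) f ` E) r'"
proof -
  interpret approximation_space E r
    by fact
  have sub: "f ` A \<subseteq> f ` B \<longleftrightarrow> A \<subseteq> B" and eq: "f ` A = f ` B \<longleftrightarrow> A = B"
    if "A \<subseteq> \<Union>E" "B \<subseteq> \<Union>E" for A B
    using inj_on_image_subset_iff[OF inj that] inj_on_image_eq_iff[OF inj that] by blast+
  have rE: "r k X \<subseteq> \<Union>E" "X \<subseteq> \<Union>E" if "X \<in> E" for k X
    using r_subset[OF that] that by blast+
  note trans = sub eq rE r'
  show ?thesis
  proof
    fix X Y :: "'b set" and m n d
    assume "X \<in> (`) f ` E"
    then obtain X0 where X: "X0 \<in> E" "X = f ` X0"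
      by blast
    show "finite (r' n X)" "(\<Union>n. r' n X) = X"
      using X finite_r Union_r by (simp_all add: r' flip: image_UN)
    show "card (r' n X) = n"
      using X card_r inj_on_subset[OF inj rE(1)] by (simp add: r' card_image)
    show "r' m X \<subseteq> r' n X" if "m \<le> n"
      using X that r_mono by (simp add: r' image_mono)
  next
    fix X Y :: "'b set" and m n
    assume "X \<in> (`) f ` E" "Y \<in> (`) f ` E" and e: "r' n X = r' n Y" and mn: "m \<le> n"
    then obtain X0 Y0 where X: "X0 \<in> E" "X = f ` X0" and Y: "Y0 \<in> E" "Y = f ` Y0"
      by blast
    have "r n X0 = r n Y0"
      using e by (simp add: X Y trans)
    then have "r m X0 = r m Y0"
      using X Y mn by (intro r_coherent[of X0 Y0 n m])
    then show "r' m X = r' m Y"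
      by (simp add: X Y r')
  next
    fix Xs :: "nat \<Rightarrow> 'b set"
    assume "\<And>n. Xs n \<in> (`) f ` E" and coh: "\<And>n. r' n (Xs (Suc n)) = r' n (Xs n)"
    then have "\<forall>n. \<exists>X. X \<in> E \<and> Xs n = f ` X"
      by blast
    then have "\<exists>Xs0. \<forall>n. Xs0 n \<in> E \<and> Xs n = f ` Xs0 n"
      by (rule choice)
    then obtain Xs0 where "\<forall>n. Xs0 n \<in> E \<and> Xs n = f ` Xs0 n"
      by (rule exE)
    then have Xs0: "Xs0 n \<in> E" "Xs n = f ` Xs0 n" for n
      by blast+
    have "r n (Xs0 (Suc n)) = r n (Xs0 n)" for n
      using coh[of n] by (simp add: Xs0 trans)
    then obtain Y where "Y \<in> E" "\<forall>n. r n Y = r n (Xs0 n)"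
      using limit[of Xs0] Xs0(1) by blast
    then show "\<exists>Y\<in>(`) f ` E. \<forall>n. r' n Y = r' n (Xs n)"
      by (intro bexI[of _ "f ` Y"]) (auto simp: Xs0 r')
  next
    fix Z X :: "'b set" and m
    assume "Z \<in> (`) f ` E" "X \<in> (`) f ` E" and s: "r' m Z \<subseteq> X"
    then obtain X0 Z0 where X: "X0 \<in> E" "X = f ` X0" and Z: "Z0 \<in> E" "Z = f ` Z0"
      by blast
    have "r m Z0 \<subseteq> X0"
      using s by (simp add: X Z trans)
    then obtain Y where Y: "Y \<in> E" "Y \<subseteq> X0" "r m Y = r m Z0"
      using extend[OF Z(1) X(1)] by blast
    then show "\<exists>Y\<in>(`) f ` E. Y \<subseteq> X \<and> r' m Y = r' m Z"
      by (intro bexI[of _ "f ` Y"]) (auto simp: X Z r')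
  next
    fix X Y :: "'b set" and m d
    assume "X \<in> (`) f ` E" "Y \<in> (`) f ` E" and s: "Y \<subseteq> X" "r' m Y \<subseteq> r' d X"
      "\<And>k. k < d \<Longrightarrow> \<not> r' m Y \<subseteq> r' k X"
    then obtain X0 Y0 where X: "X0 \<in> E" "X = f ` X0" and Y: "Y0 \<in> E" "Y = f ` Y0"
      by blast
    have "Y0 \<subseteq> X0" "r m Y0 \<subseteq> r d X0" "\<And>k. k < d \<Longrightarrow> \<not> r m Y0 \<subseteq> r k X0"
      using s by (simp_all add: X Y trans)
    from amalgamate[OF X(1) Y(1) this] obtain X' where X': "X' \<in> E" "X' \<subseteq> X0" "r d X' = r d X0"
      "\<And>Z. Z \<in> E \<Longrightarrow> Z \<subseteq> X' \<Longrightarrow> r m Z = r m Y0 \<Longrightarrow> Z \<subseteq> Y0"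
      by auto
    have "Z \<subseteq> Y" if Z: "Z \<in> (`) f ` E" "Z \<subseteq> f ` X'" "r' m Z = r' m Y" for Z
    proof -
      obtain Z0 where Z0: "Z0 \<in> E" "Z = f ` Z0"
        using Z(1) by blast
      have "Z0 \<subseteq> X'" "r m Z0 = r m Y0"
        using Z(2,3) X'(1) by (simp_all add: Z0 Y trans)
      then have "Z0 \<subseteq> Y0"
        by (rule X'(4)[OF Z0(1)])
      then show ?thesis
        by (simp add: Z0 Y image_mono)
    qed
    moreover have "f ` X' \<subseteq> X" "r' d (f ` X') = r' d X"
      using X' X by (auto simp: r')
    ultimately show "\<exists>X'\<in>(`) f ` E. X' \<subseteq> X \<and> r' d X' = r' d X \<and>
        (\<forall>Z\<in>(`) f ` E. Z \<subseteq> X' \<longrightarrow> r' m Z = r' m Y \<longrightarrow> Z \<subseteq> Y)"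
      using X'(1) by (intro bexI[of _ "f ` X'"]) auto
  next
    fix X :: "'b set" and m and P :: "'b set \<Rightarrow> bool"
    assume "X \<in> (`) f ` E"
    then obtain X0 where X: "X0 \<in> E" "X = f ` X0"
      by blast
    obtain Y where Y: "Y \<in> E" "Y \<subseteq> X0" "r m Y = r m X0"
      and h: "(\<forall>Z\<in>E. Z \<subseteq> Y \<longrightarrow> r m Z = r m X0 \<longrightarrow> P (f ` r (Suc m) Z)) \<or>
       (\<forall>Z\<in>E. Z \<subseteq> Y \<longrightarrow> r m Z = r m X0 \<longrightarrow> \<not> P (f ` r (Suc m) Z))"
      using pigeonhole[OF X(1), of m "\<lambda>v. P (f ` v)"] by blast
    have "f ` Z \<subseteq> f ` Y \<longleftrightarrow> Z \<subseteq> Y" "r' m (f ` Z) = r' m X \<longleftrightarrow> r m Z = r m X0"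
      "r' (Suc m) (f ` Z) = f ` r (Suc m) Z" if "Z \<in> E" for Z
      using that Y(1) X by (simp_all add: trans)
    then have "(\<forall>Z\<in>(`) f ` E. Z \<subseteq> f ` Y \<longrightarrow> r' m Z = r' m X \<longrightarrow> P (r' (Suc m) Z)) \<or>
        (\<forall>Z\<in>(`) f ` E. Z \<subseteq> f ` Y \<longrightarrow> r' m Z = r' m X \<longrightarrow> \<not> P (r' (Suc m) Z))"
      using h by auto
    moreover have "f ` Y \<in> (`) f ` E" "f ` Y \<subseteq> X" "r' m (f ` Y) = r' m X"
      using X Y by (auto simp: r')
    ultimately show "\<exists>Y\<in>(`) f ` E. Y \<subseteq> X \<and> r' m Y = r' m X \<and>
        ((\<forall>Z\<in>(`) f ` E. Z \<subseteq> Y \<longrightarrow> r' m Z = r' m X \<longrightarrow> P (r' (Suc m) Z)) \<or>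
         (\<forall>Z\<in>(`) f ` E. Z \<subseteq> Y \<longrightarrow> r' m Z = r' m X \<longrightarrow> \<not> P (r' (Suc m) Z)))"
      by blast
  qed
qed

section \<open>The domain spaces\<close>

text \<open>
  The last premise of the second rule records what is needed of the ranks: in a limit stage they
  increase strictly with \<open>n\<close>, so only the section at \<open>0\<close> can have rank 0.
\<close>

inductive regular :: "nat set set \<Rightarrow> bool" where
  regular_empty: "regular {{}}"
| regular_step: "{} \<notin> B \<Longrightarrow> \<forall>b\<in>B. finite b \<Longrightarrow>
    (\<And>n. regular (shifted_section B n)) \<Longrightarrow>
    (\<forall>n. shifted_section B n = {{}}) \<or> (\<forall>n>0. shifted_section B n \<noteq> {{}}) \<Longrightarrow> regular B"

section \<open>Sections of barriers and sections of trees\<close>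

lemma regular_finite: "regular B \<Longrightarrow> b \<in> B \<Longrightarrow> finite b"
  by (erule regular.cases) auto

lemma regular_ranked: "regular B \<Longrightarrow> ranked B"
  by (induction rule: regular.induct) (blast intro: ranked.intros)+

lemma shifted_section_iff:
  "c \<in> shifted_section B n \<longleftrightarrow> finite c \<and> insert n ((\<lambda>x. x + n + 1) ` c) \<in> B"
proof
  assume "c \<in> shifted_section B n"
  then obtain a where a: "finite a" "\<forall>x\<in>a. n < x" "insert n a \<in> B" "c = (\<lambda>x. x - (n + 1)) ` a"
    by (auto simp: shifted_section_def section_at_def)
  have "(\<lambda>x. x + n + 1) ` c = (\<lambda>x. x) ` a"
    unfolding a(4) image_image using a(2) by (intro image_cong) auto
  then show "finite c \<and> insert n ((\<lambda>x. x + n + 1) ` c) \<in> B"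
    using a by simp
next
  assume c: "finite c \<and> insert n ((\<lambda>x. x + n + 1) ` c) \<in> B"
  let ?a = "(\<lambda>x. x + n + 1) ` c"
  have "?a \<in> section_at B n"
    using c by (auto simp: section_at_def)
  moreover have "c = (\<lambda>x. x - (n + 1)) ` ?a"
    by (simp add: image_image)
  ultimately show "c \<in> shifted_section B n"
    unfolding shifted_section_def by blast
qed

lemma regular_nonempty: "regular B \<Longrightarrow> B \<noteq> {}"
proof (induction rule: regular.induct)
  case (regular_step B)
  then obtain c where "c \<in> shifted_section B 0"
    by blast
  then show ?case
    by (auto simp: shifted_section_iff)
qed simp

lemma sigma_Nil_iff: "finite a \<Longrightarrow> sigma a = [] \<longleftrightarrow> a = {}"
  by (simp add: sigma_def)

lemma upsilon_inj: "upsilon n s = upsilon m t \<longleftrightarrow> n = m \<and> s = t"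
  by (auto simp: upsilon_def map_injective inj_on_def dest: map_inj_on)

lemma finite_set_split:
  fixes b :: "nat set"
  assumes "finite b" "b \<noteq> {}"
  obtains n c where "finite c" "b = insert n ((\<lambda>x. x + n + 1) ` c)"
proof
  let ?n = "Min b" and ?c = "(\<lambda>x. x - (Min b + 1)) ` (b - {Min b})"
  show "finite ?c"
    using assms by simp
  have "(\<lambda>x. x + ?n + 1) ` ?c = (\<lambda>x. x) ` (b - {?n})"
    unfolding image_image
  proof (intro image_cong refl)
    fix x assume x: "x \<in> b - {?n}"
    then have "?n \<le> x"
      using assms by simp
    with x have "?n < x"
      by (simp add: order_less_le)
    then show "x - (?n + 1) + ?n + 1 = x"
      by simp
  qed
  then show "b = insert ?n ((\<lambda>x. x + ?n + 1) ` ?c)"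
    using Min_in[OF assms] by auto
qed

abbreviation sec :: "nat \<Rightarrow> nat list set \<Rightarrow> nat list set" where
  "sec n S \<equiv> upsilon n -` S"

text \<open>What is used of monotonicity: members are nonempty and no entry is below the first,
  which \<open>sec\<close> then removes and subtracts.\<close>

definition headed :: "nat list set \<Rightarrow> bool" where
  "headed S \<longleftrightarrow> (\<forall>s\<in>S. \<exists>n t. s = upsilon n t)"

lemma headed_subset: "headed L \<Longrightarrow> S \<subseteq> L \<Longrightarrow> headed S"
  unfolding headed_def by blast

lemma sigma_image_split:
  assumes B: "{} \<notin> B" "\<forall>b\<in>B. finite b"
  shows "headed (sigma ` B)" "sec n (sigma ` B) = sigma ` shifted_section B n"
proof -
  have split: "\<exists>n c. s = upsilon n (sigma c) \<and> c \<in> shifted_section B n" if s: "s \<in> sigma ` B" for s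
  proof -
    obtain b where b: "b \<in> B" "s = sigma b"
      using s by blast
    then have "finite b" "b \<noteq> {}"
      using B by auto
    then obtain n c where "finite c" "b = insert n ((\<lambda>x. x + n + 1) ` c)"
      by (rule finite_set_split)
    then show ?thesis
      using b upsilon_sigma[of c n] by (intro exI[of _ n] exI[of _ c]) (simp add: shifted_section_iff)
  qed
  then show "headed (sigma ` B)"
    unfolding headed_def by blast
  show "sec n (sigma ` B) = sigma ` shifted_section B n"
  proof (intro equalityI subsetI)
    fix s assume "s \<in> sec n (sigma ` B)"
    then have "upsilon n s \<in> sigma ` B"
      by simp
    then obtain m c where "upsilon n s = upsilon m (sigma c)" "c \<in> shifted_section B m"
      using split by blast
    then show "s \<in> sigma ` shifted_section B n"
      by (simp add: upsilon_inj)
  next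
    fix s assume "s \<in> sigma ` shifted_section B n"
    then obtain c where "s = sigma c" "c \<in> shifted_section B n"
      by blast
    then show "s \<in> sec n (sigma ` B)"
      using upsilon_sigma[of c n] by (simp add: shifted_section_iff)
  qed
qed

lemma upsilon_not_Nil [simp]: "upsilon n s \<noteq> []"
  by (simp add: upsilon_def)

lemma upsilon_append: "upsilon n (x @ y) = upsilon n x @ map (\<lambda>z. z + n) y"
  by (simp add: upsilon_def)

lemma upsilon_prefix:
  assumes "upsilon n s = x @ y" "x \<noteq> []"
  obtains x' y' where "x = upsilon n x'" "s = x' @ y'"
proof -
  obtain xs where xs: "x = n # xs" "map (\<lambda>z. z + n) s = xs @ y"
    using assms by (cases x) (auto simp: upsilon_def)
  then obtain x' y' where "s = x' @ y'" "xs = map (\<lambda>z. z + n) x'"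
    by (auto simp: map_eq_append_conv)
  then show ?thesis
    using that xs(1) by (simp add: upsilon_def)
qed

text \<open>The conjunct \<open>sec n S \<noteq> {}\<close> is there because the root counts as a
  node of an empty section.\<close>

lemma upsilon_in_nodes:
  assumes "headed S"
  shows "upsilon n x \<in> nodes S \<longleftrightarrow> sec n S \<noteq> {} \<and> x \<in> nodes (sec n S)"
proof
  assume "upsilon n x \<in> nodes S"
  then obtain y where y: "upsilon n x @ y \<in> S"
    by (rule nodesE) (simp add: upsilon_def)
  then obtain m t where mt: "upsilon m t = upsilon n x @ y"
    using assms unfolding headed_def by metis
  then obtain x' y' where "upsilon n x = upsilon m x'" "t = x' @ y'"
    by (rule upsilon_prefix) (simp add: upsilon_def)
  then have "x @ y' \<in> sec n S"
    using y mt by (simp add: upsilon_inj)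
  then show "sec n S \<noteq> {} \<and> x \<in> nodes (sec n S)"
    using append_in_nodes by blast
next
  assume "sec n S \<noteq> {} \<and> x \<in> nodes (sec n S)"
  then obtain y where "x @ y \<in> sec n S"
    by (auto simp: nodes_def)
  then show "upsilon n x \<in> nodes S"
    by (simp add: upsilon_append append_in_nodes)
qed

lemma headed_nodesE:
  assumes "headed S" "x \<in> nodes S" "x \<noteq> []"
  obtains n x' where "x = upsilon n x'"
proof -
  obtain y where y: "x @ y \<in> S"
    using assms by (auto elim: nodesE)
  then obtain m t where "upsilon m t = x @ y"
    using assms(1) unfolding headed_def by metis
  then show ?thesis
    using that upsilon_prefix[of m t x y] assms(3) by blast
qed

lemma singleton_in_nodes: "headed S \<Longrightarrow> [n] \<in> nodes S \<longleftrightarrow> sec n S \<noteq> {}"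
  using upsilon_in_nodes[of S n "[]"] by (simp add: upsilon_def)

lemma adr_shift: "adr ((map (\<lambda>z. z + n)) ` T) (map (\<lambda>z. z + n) x) = adr T x"
proof (induction x arbitrary: T)
  case (Cons a x)
  let ?f = "map (\<lambda>z. z + n)"
  have inj: "inj ?f"
    by (simp add: inj_def map_injective)
  have "{m. m < a + n \<and> [m] \<in> ?f ` T} = (\<lambda>z. z + n) ` {m. m < a \<and> [m] \<in> T}"
    by (auto simp: image_iff Cons_eq_map_conv)
  then have "card {m. m < a + n \<and> [m] \<in> ?f ` T} = card {m. m < a \<and> [m] \<in> T}"
    by (simp add: card_image inj_on_def)
  moreover have "{t. (a + n) # t \<in> ?f ` T} = ?f ` {t. a # t \<in> T}"
    by (auto simp: image_iff Cons_eq_map_conv)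
  ultimately show ?case
    by (simp add: Cons.IH)
qed simp

text \<open>The shift by the row number \<open>i\<close>: the largest address entry in the section
  is below \<open>j\<close> exactly if that in \<open>S\<close> is below \<open>i + j\<close>. This
  matches the indices \<open>k + 1 - i\<close> in \<open>combine\<close>.\<close>

lemma adr_upsilon:
  assumes S: "headed S" and ne: "sec n S \<noteq> {}"
  shows "ab S (upsilon n x) = upsilon (card {m. m < n \<and> sec m S \<noteq> {}}) (ab (sec n S) x)"
proof -
  let ?f = "map (\<lambda>z. z + n)"
  have "{t. n # t \<in> nodes S} = ?f ` nodes (sec n S)"
  proof (intro equalityI subsetI)
    fix t assume "t \<in> {t. n # t \<in> nodes S}"
    then have t: "n # t \<in> nodes S"
      by simp
    then obtain m x where "n # t = upsilon m x"
      by (rule headed_nodesE[OF S]) simp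
    then have "n # t = upsilon n x"
      by (simp add: upsilon_def)
    then have "t = ?f x" "x \<in> nodes (sec n S)"
      using t upsilon_in_nodes[OF S] by (auto simp: upsilon_def)
    then show "t \<in> ?f ` nodes (sec n S)"
      by blast
  next
    fix t assume "t \<in> ?f ` nodes (sec n S)"
    then show "t \<in> {t. n # t \<in> nodes S}"
      using upsilon_in_nodes[OF S] ne by (auto simp: upsilon_def)
  qed
  then have "ab S (n # ?f x) = upsilon (card {m. m < n \<and> [m] \<in> nodes S}) (ab (sec n S) x)"
    by (simp add: adr_shift)
  then show ?thesis
    by (simp add: upsilon_def[of n x] singleton_in_nodes[OF S])
qed

lemma fat_iff:
  assumes L: "headed L" and S: "S \<subseteq> L"
  shows "fat L S \<longleftrightarrow> infinite {n. sec n S \<noteq> {}} \<and> (\<forall>n. sec n S \<noteq> {} \<longrightarrow> fat (sec n L) (sec n S))"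
proof -
  have hS: "headed S"
    using L S by (rule headed_subset)
  have Nil: "[] \<notin> L"
    using L by (auto simp: headed_def upsilon_def)
  have children: "{m. upsilon n x @ [m] \<in> nodes S} = (\<lambda>m. m + n) ` {m. x @ [m] \<in> nodes (sec n S)}"
    if ne: "sec n S \<noteq> {}" for n x
  proof (intro equalityI subsetI)
    fix m assume "m \<in> {m. upsilon n x @ [m] \<in> nodes S}"
    then have m: "upsilon n x @ [m] \<in> nodes S"
      by simp
    then obtain k z where z: "upsilon n x @ [m] = upsilon k z"
      by (rule headed_nodesE[OF hS]) simp
    then have "k = n"
      by (simp add: upsilon_def)
    obtain x' y' where x': "upsilon n x = upsilon k x'" "z = x' @ y'"
      using upsilon_prefix[OF z[symmetric]] by (auto simp: upsilon_def)
    then have "upsilon n x @ [m] = upsilon n x @ map (\<lambda>z. z + n) y'"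
      using z by (simp add: upsilon_append \<open>k = n\<close>)
    then obtain m' where "y' = [m']" "m = m' + n"
      by auto
    then have "m = m' + n" "upsilon n (x @ [m']) \<in> nodes S"
      using m by (simp_all add: upsilon_append)
    then show "m \<in> (\<lambda>m. m + n) ` {m. x @ [m] \<in> nodes (sec n S)}"
      using upsilon_in_nodes[OF hS] by blast
  next
    fix m assume "m \<in> (\<lambda>m. m + n) ` {m. x @ [m] \<in> nodes (sec n S)}"
    then obtain m' where "m = m' + n" "upsilon n (x @ [m']) \<in> nodes S"
      using upsilon_in_nodes[OF hS] ne by blast
    then show "m \<in> {m. upsilon n x @ [m] \<in> nodes S}"
      by (simp add: upsilon_append)
  qed
  have inf_iff: "infinite {m. upsilon n x @ [m] \<in> nodes S} \<longleftrightarrow> infinite {m. x @ [m] \<in> nodes (sec n S)}"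
    if ne: "sec n S \<noteq> {}" for n x
    unfolding children[OF ne] by (simp add: finite_image_iff inj_on_def)
  show ?thesis
  proof
    assume fat: "fat L S"
    have "infinite {m. [] @ [m] \<in> nodes S}"
      using fat Nil unfolding fat_def by (metis Diff_iff Nil_in_nodes)
    moreover have "fat (sec n L) (sec n S)" if "sec n S \<noteq> {}" for n
      unfolding fat_def
    proof
      fix x assume "x \<in> nodes (sec n S) - sec n L"
      then have "upsilon n x \<in> nodes S - L"
        using upsilon_in_nodes[OF hS] that by simp
      then show "infinite {m. x @ [m] \<in> nodes (sec n S)}"
        using fat inf_iff[OF that] unfolding fat_def by blast
    qed
    ultimately show "infinite {n. sec n S \<noteq> {}} \<and> (\<forall>n. sec n S \<noteq> {} \<longrightarrow> fat (sec n L) (sec n S))"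
      by (simp add: singleton_in_nodes[OF hS])
  next
    assume *: "infinite {n. sec n S \<noteq> {}} \<and> (\<forall>n. sec n S \<noteq> {} \<longrightarrow> fat (sec n L) (sec n S))"
    show "fat L S"
      unfolding fat_def
    proof
      fix x assume x: "x \<in> nodes S - L"
      show "infinite {m. x @ [m] \<in> nodes S}"
      proof (cases "x = []")
        case True
        then show ?thesis
          using * by (simp add: singleton_in_nodes[OF hS])
      next
        case False
        then obtain n x' where x': "x = upsilon n x'"
          using x headed_nodesE[OF hS] by blast
        then have "sec n S \<noteq> {}" "x' \<in> nodes (sec n S) - sec n L"
          using x upsilon_in_nodes[OF hS] by auto
        then have "infinite {m. x' @ [m] \<in> nodes (sec n S)}"
          using * unfolding fat_def by blast
        then show ?thesis
          using inf_iff[OF \<open>sec n S \<noteq> {}\<close>] x' by simp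
      qed
    qed
  qed
qed

text \<open>Both parts rest on induction over \<open>regular\<close>. Accessibility of the root of a
  section is carried by \<open>upsilon n\<close> to the node \<open>[n]\<close>; so the root of the
  whole tree is accessible, and with it all nodes.\<close>

lemma regular_front:
  assumes "regular B"
  shows "s \<in> sigma ` B \<Longrightarrow> s @ t \<in> sigma ` B \<Longrightarrow> t = []"
    and "x \<in> Wellfounded.acc {(x @ [m], x) | x m. x @ [m] \<in> nodes (sigma ` B)} \<or> x \<notin> nodes (sigma ` B)"
proof -
  let ?R = "\<lambda>B. {(x @ [m], x) | x m. x @ [m] \<in> nodes (sigma ` B)}"
  show "s \<in> sigma ` B \<Longrightarrow> s @ t \<in> sigma ` B \<Longrightarrow> t = []"
    using assms
  proof (induction arbitrary: s t rule: regular.induct)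
    case regular_empty
    then show ?case
      by (simp add: sigma_Nil_iff)
  next
    case (regular_step B)
    note split = sigma_image_split[OF regular_step.hyps(1,2)]
    obtain n s' where s': "s = upsilon n s'"
      using regular_step.prems split unfolding headed_def by blast
    obtain m u where u: "s @ t = upsilon m u"
      using regular_step.prems split unfolding headed_def by blast
    then have "m = n"
      by (simp add: s' upsilon_def)
    obtain x' y' where x': "s = upsilon m x'" "u = x' @ y'"
      by (rule upsilon_prefix[OF u[symmetric]]) (auto simp: s' upsilon_def)
    then have "x' = s'"
      by (simp add: s' upsilon_inj)
    have "s' \<in> sec n (sigma ` B)" "s' @ y' \<in> sec n (sigma ` B)"
      using regular_step.prems s' u x' \<open>x' = s'\<close> \<open>m = n\<close> by simp_all
    then have "s' \<in> sigma ` shifted_section B n" "s' @ y' \<in> sigma ` shifted_section B n"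
      by (simp_all only: split(2))
    then have "y' = []"
      using regular_step.IH by blast
    then show ?case
      using u x' by simp
  qed
  have "[] \<in> Wellfounded.acc (?R B)"
    using assms
  proof (induction rule: regular.induct)
    case regular_empty
    then show ?case
      by (rule accI) (auto simp: nodes_def sigma_def)
  next
    case (regular_step B)
    note split = sigma_image_split[OF regular_step.hyps(1,2)]
    have "upsilon n x \<in> Wellfounded.acc (?R B)" if "x \<in> Wellfounded.acc (?R (shifted_section B n))" for n x
      using that
    proof (induction rule: acc_induct_rule)
      fix x
      assume IH: "\<And>y. (y, x) \<in> ?R (shifted_section B n) \<Longrightarrow> upsilon n y \<in> Wellfounded.acc (?R B)"
      show "upsilon n x \<in> Wellfounded.acc (?R B)"
      proof (rule acc.accI)
        fix z assume "(z, upsilon n x) \<in> ?R B"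
        then obtain m where m: "z = upsilon n x @ [m]" "z \<in> nodes (sigma ` B)"
          by blast
        then obtain k y where y: "z = upsilon k y"
          using headed_nodesE[OF split(1) m(2)] by auto
        have "k = n"
          using y m by (simp add: upsilon_def)
        have "upsilon k y = upsilon n x @ [m]"
          using y m by simp
        then obtain x' y' where x': "upsilon n x = upsilon k x'" "y = x' @ y'"
          by (rule upsilon_prefix[OF _ upsilon_not_Nil])
        then have "upsilon n x @ [m] = upsilon n x @ map (\<lambda>z. z + n) y'"
          using y m by (simp add: upsilon_append \<open>k = n\<close>)
        then obtain m' where "y' = [m']"
          by auto
        then have y': "y = x @ [m']"
          using x' by (simp add: upsilon_inj)
        then have "x @ [m'] \<in> nodes (sigma ` shifted_section B n)"
          using m(2) y \<open>k = n\<close> upsilon_in_nodes[OF split(1)] split(2) by simp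
        then show "z \<in> Wellfounded.acc (?R B)"
          using IH[of y] y y' \<open>k = n\<close> by auto
      qed
    qed
    then have base: "upsilon n [] \<in> Wellfounded.acc (?R B)" for n
      using regular_step.IH by blast
    show ?case
    proof (rule accI)
      fix z assume "(z, []) \<in> ?R B"
      then obtain m where "z = [m]"
        by blast
      then show "z \<in> Wellfounded.acc (?R B)"
        using base[of m] by (simp add: upsilon_def)
    qed
  qed
  then show "x \<in> Wellfounded.acc (?R B) \<or> x \<notin> nodes (sigma ` B)"
  proof (induction x rule: rev_induct)
    case (snoc m x)
    show ?case
    proof (cases "x @ [m] \<in> nodes (sigma ` B)")
      case True
      then have "x \<in> Wellfounded.acc (?R B)"
        using snoc nodes_prefix by blast
      moreover have "(x @ [m], x) \<in> ?R B"
        using True by blast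
      ultimately show ?thesis
        using acc_downward by fast
    qed simp
  qed simp
qed

lemma front_sigma:
  assumes "regular B" "B \<noteq> {{}}"
  shows "front (sigma ` B)"
proof
  show "t = []" if "s \<in> sigma ` B" "s @ t \<in> sigma ` B" for s t
    using regular_front(1)[OF assms(1)] that by blast
  have "{} \<notin> B"
    using assms by (auto elim: regular.cases)
  then show "[] \<notin> sigma ` B"
    using sigma_Nil_iff regular_finite[OF assms(1)] by (metis imageE)
  show "wf {(x @ [m], x) | x m. x @ [m] \<in> nodes (sigma ` B)}"
  proof (rule acc_wfI, rule allI)
    fix x
    show "x \<in> Wellfounded.acc {(x @ [m], x) | x m. x @ [m] \<in> nodes (sigma ` B)}"
    proof (cases "x \<in> nodes (sigma ` B)")
      case True
      then show ?thesis
        using regular_front(2)[OF assms(1), of x] by blast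
    next
      case False
      \<comment> \<open>Extensions of a non-node are non-nodes, so a non-node is accessible
        vacuously.\<close>
      then have "(y, x) \<notin> {(x @ [m], x) | x m. x @ [m] \<in> nodes (sigma ` B)}" for y
        by (auto dest: nodes_prefix)
      then show ?thesis
        using accI[of x] by blast
    qed
  qed
qed

section \<open>Rows, full approximations and the interleaving conditions\<close>

lemma infinite_index:
  fixes A :: "nat set"
  assumes "infinite A"
  shows "card {m. m < enumerate A i \<and> m \<in> A} = i"
proof -
  have "{m. m < enumerate A i \<and> m \<in> A} = enumerate A ` {..<i}"
  proof (intro equalityI subsetI)
    fix m assume "m \<in> {m. m < enumerate A i \<and> m \<in> A}"
    then obtain j where "m = enumerate A j" "enumerate A j < enumerate A i"
      using range_enumerate[OF assms] by (metis (mono_tags, lifting) mem_Collect_eq rangeE)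
    then show "m \<in> enumerate A ` {..<i}"
      using assms by (simp add: enumerate_mono_iff)
  qed (auto simp: enumerate_in_set[OF assms] enumerate_mono_iff[OF assms])
  moreover have "inj_on (enumerate A) {..<i}"
    using assms by (auto simp: inj_on_def intro: inj_enumerate[THEN injD])
  ultimately show ?thesis
    by (simp add: card_image)
qed

lemma hd_adr_append: "x \<noteq> [] \<Longrightarrow> hd (adr T (x @ y)) = hd (adr T x)"
  using take_adr_append[of x T y] length_adr[of T x] by (metis hd_append2 append_take_drop_id length_0_conv)

lemma hd_le_mx: "s \<noteq> [] \<Longrightarrow> hd s \<le> mx s"
  by (cases s) auto

lemma headed_Nil: "headed S \<Longrightarrow> [] \<notin> S"
  unfolding headed_def by (auto simp: upsilon_def)

lemma row_eq: "headed S \<Longrightarrow> row S n = upsilon n ` sec n S"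
  unfolding headed_def row_def by (force simp: upsilon_def)

lemma row_nonempty_iff: "headed S \<Longrightarrow> row S n \<noteq> {} \<longleftrightarrow> sec n S \<noteq> {}"
  by (simp only: row_eq image_is_empty)

lemma vimage_row: "headed S \<Longrightarrow> upsilon n -` row S n = sec n S"
  by (auto simp: row_eq upsilon_inj)

text \<open>The leftmost leaf above a node keeps the head and the largest entry of the address, so
  bounds on members turn into the same bounds on nodes. The predicate \<open>P\<close> serves full
  approximations and single rows at once.\<close>

lemma (in front) prefixes_of_bounded:
  assumes S: "S \<subseteq> L" "S \<noteq> {}" "fat L S"
  shows "prefixes_of {s \<in> S. P (hd (ab S s)) \<and> mx (ab S s) < k} =
    {x \<in> nodes S. x \<noteq> [] \<and> P (hd (ab S x)) \<and> mx (ab S x) < k}"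
proof (intro equalityI subsetI)
  fix x assume "x \<in> prefixes_of {s \<in> S. P (hd (ab S s)) \<and> mx (ab S s) < k}"
  then obtain s m where s: "s \<in> S" "P (hd (ab S s))" "mx (ab S s) < k" "x = take m s" "1 \<le> m" "m \<le> length s"
    by (auto simp: prefixes_of_def)
  then have x: "s = x @ drop m s" "x \<noteq> []"
    by auto
  then have "x \<in> nodes S"
    using s(1) append_in_nodes by metis
  moreover have "hd (ab S s) = hd (ab S x)"
    using hd_adr_append[OF x(2)] x(1) by metis
  moreover have "mx (ab S x) \<le> mx (ab S s)"
    using mx_adr_append x(1) by metis
  ultimately show "x \<in> {x \<in> nodes S. x \<noteq> [] \<and> P (hd (ab S x)) \<and> mx (ab S x) < k}"
    using s x by simp
next
  fix x assume x: "x \<in> {x \<in> nodes S. x \<noteq> [] \<and> P (hd (ab S x)) \<and> mx (ab S x) < k}"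
  then obtain y where y: "x @ y \<in> S" "ab S (x @ y) = ab S x @ replicate (length y) (mx (ab S x))"
    using leftmost_leaf[OF S, of x] by blast
  have "hd (ab S (x @ y)) = hd (ab S x)"
    by (rule hd_adr_append) (use x in simp)
  moreover have "mx (ab S (x @ y)) = mx (ab S x)"
    by (simp add: y(2))
  ultimately have "x @ y \<in> {s \<in> S. P (hd (ab S s)) \<and> mx (ab S s) < k}"
    using x y by simp
  moreover have "x = take (length x) (x @ y)" "1 \<le> length x" "length x \<le> length (x @ y)"
    using x by (auto simp: Suc_le_eq)
  ultimately show "x \<in> prefixes_of {s \<in> S. P (hd (ab S s)) \<and> mx (ab S s) < k}"
    unfolding prefixes_of_def by blast
qed

text \<open>Take the leftmost leaf above the child of the root with position \<open>c\<close>. This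
  supplies the intermediate members in \<open>well_interleaved_ordered\<close>.\<close>

lemma (in front) exists_leaf_mx:
  assumes S: "S \<subseteq> L" "S \<noteq> {}" "fat L S"
  shows "\<exists>t\<in>S. mx (ab S t) = c"
proof -
  let ?A = "{m. [m] \<in> nodes S}"
  have "infinite ?A"
    using fat_children[OF S(3), of "[]"] Nil_notin by simp
  then have m: "[enumerate ?A c] \<in> nodes S" "card {m. m < enumerate ?A c \<and> m \<in> ?A} = c"
    using enumerate_in_set[of ?A c] infinite_index[of ?A c] by simp_all
  have "mx (ab S [enumerate ?A c]) = c"
    using m(2) by simp
  moreover obtain y where "[enumerate ?A c] @ y \<in> S"
    "ab S ([enumerate ?A c] @ y) = ab S [enumerate ?A c] @ replicate (length y) (mx (ab S [enumerate ?A c]))"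
    using leftmost_leaf[OF S m(1)] by blast
  ultimately show ?thesis
    by (intro bexI[of _ "[enumerate ?A c] @ y"]) simp_all
qed

context
  fixes S :: "nat list set"
  assumes headed: "headed S" and inf: "infinite {n. sec n S \<noteq> {}}"
begin

lemma row_index_sec: "sec (row_index S i) S \<noteq> {}"
  using enumerate_in_set[OF inf, of i] by (simp add: row_index_def row_nonempty_iff[OF headed])

lemma hd_ab_row_index: "hd (ab S (upsilon (row_index S i) t)) = i"
proof -
  have "card {m. m < row_index S i \<and> sec m S \<noteq> {}} = i"
    using infinite_index[OF inf, of i] by (simp add: row_index_def row_nonempty_iff[OF headed])
  then show ?thesis
    using adr_upsilon[OF headed row_index_sec, of i t] by (simp add: upsilon_def)
qed

lemma mx_ab_row_index:
  "mx (ab S (upsilon (row_index S i) t)) = i + mx (ab (sec (row_index S i) S) t)"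
proof -
  have "card {m. m < row_index S i \<and> sec m S \<noteq> {}} = i"
    using infinite_index[OF inf, of i] by (simp add: row_index_def row_nonempty_iff[OF headed])
  then show ?thesis
    using adr_upsilon[OF headed row_index_sec, of i t] by simp
qed

lemma nodes_row_index:
  assumes "x \<in> nodes S" "x \<noteq> []"
  obtains t where "x = upsilon (row_index S (hd (ab S x))) t" "t \<in> nodes (sec (row_index S (hd (ab S x))) S)"
proof -
  obtain n t where t: "x = upsilon n t"
    using headed_nodesE[OF headed assms] by blast
  then have "sec n S \<noteq> {}" "t \<in> nodes (sec n S)"
    using assms upsilon_in_nodes[OF headed] by blast+
  then obtain i where "n = row_index S i"
    using range_enumerate[OF inf] unfolding row_index_def row_nonempty_iff[OF headed] by blast
  moreover from this have "hd (ab S x) = i"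
    using hd_ab_row_index t by simp
  ultimately have "n = row_index S (hd (ab S x))"
    by simp
  then show ?thesis
    using that[of t] t \<open>t \<in> nodes (sec n S)\<close> by simp
qed

lemma member_row_index:
  assumes "s \<in> S"
  obtains t where "s = upsilon (row_index S (hd (ab S s))) t" "t \<in> sec (row_index S (hd (ab S s))) S"
proof -
  have "s \<in> nodes S" "s \<noteq> []"
    using assms subset_nodes headed_Nil[OF headed] by auto
  then obtain t where t: "s = upsilon (row_index S (hd (ab S s))) t"
    by (rule nodes_row_index)
  then have "t \<in> sec (row_index S (hd (ab S s))) S"
    using assms by simp
  then show ?thesis
    using t that by blast
qed

context
  fixes B :: "nat set set"
  assumes B: "ranked B" "B \<noteq> {{}}" "B \<noteq> range (\<lambda>n. {n})"
    and rows: "\<And>n k. sec n S \<noteq> {} \<Longrightarrow>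
      full_approx (shifted_section B n) k (sec n S) = {t \<in> sec n S. mx (ab (sec n S) t) < k}"
begin

lemma row_approx_eq:
  "row_approx B (row_index S i) j (row S (row_index S i)) = {s \<in> S. hd (ab S s) = i \<and> mx (ab S s) < i + j}"
proof -
  let ?n = "row_index S i"
  have "row_approx B ?n j (row S ?n) = upsilon ?n ` {t \<in> sec ?n S. mx (ab (sec ?n S) t) < j}"
    by (simp add: row_approx_def vimage_row[OF headed] rows[OF row_index_sec])
  also have "\<dots> = {s \<in> S. hd (ab S s) = i \<and> mx (ab S s) < i + j}"
  proof (intro equalityI subsetI)
    fix s assume "s \<in> {s \<in> S. hd (ab S s) = i \<and> mx (ab S s) < i + j}"
    then have s: "s \<in> S" "hd (ab S s) = i" "mx (ab S s) < i + j"
      by simp_all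
    then obtain t where t: "s = upsilon ?n t" "t \<in> sec ?n S"
      using member_row_index[OF s(1)] by metis
    then have "mx (ab (sec ?n S) t) < j"
      using s(3) mx_ab_row_index[of i t] by simp
    then show "s \<in> upsilon ?n ` {t \<in> sec ?n S. mx (ab (sec ?n S) t) < j}"
      using t by blast
  qed (auto simp: hd_ab_row_index mx_ab_row_index)
  finally show ?thesis .
qed

text \<open>In stage \<open>k + 1\<close> row \<open>i\<close> enters with index
  \<open>k + 1 - i\<close>, so by \<open>row_approx_eq\<close> its bound is \<open>k + 1\<close> for
  every \<open>i\<close>. Rows beyond \<open>k\<close> have no members within this bound, because
  the head of an address is the row number.\<close>

lemma full_approx_eq: "full_approx B k S = {s \<in> S. mx (ab S s) < k}"
proof -
  have "full_approx B = combine (\<lambda>n k T. upsilon n ` full_approx (shifted_section B n) k (upsilon n -` T))"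
    using full_approx.psimps[OF ranked_full_approx_dom[OF B(1)]] B(2,3) by simp
  then have comb: "full_approx B = combine (row_approx B)"
    by (simp add: row_approx_def[abs_def])
  show ?thesis
    unfolding comb
  proof (induction k)
    case (Suc k)
    have "combine (row_approx B) (Suc k) S = {s \<in> S. mx (ab S s) < k} \<union>
        (\<Union>i\<le>k. {s \<in> S. hd (ab S s) = i \<and> mx (ab S s) < i + (k + 1 - i)})"
      by (simp only: combine.simps Suc row_approx_eq)
    also have "\<dots> = {s \<in> S. mx (ab S s) < Suc k}"
    proof (intro equalityI subsetI)
      fix s assume s: "s \<in> {s \<in> S. mx (ab S s) < Suc k}"
      then have "s \<noteq> []"
        using headed_Nil[OF headed] by auto
      then have "hd (ab S s) \<le> mx (ab S s)"
        by (intro hd_le_mx) (metis length_0_conv length_adr)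
      then show "s \<in> {s \<in> S. mx (ab S s) < k} \<union>
          (\<Union>i\<le>k. {s \<in> S. hd (ab S s) = i \<and> mx (ab S s) < i + (k + 1 - i)})"
        using s by auto
    qed auto
    finally show ?case .
  qed simp
qed

text \<open>The nodes new in row \<open>i\<close> at stage \<open>k + 1\<close> are those whose
  address has head \<open>i\<close> and largest entry exactly \<open>k\<close>. The first clause
  treats \<open>i = 0\<close>; the second compares such a node with all earlier stages and with the
  preceding row.\<close>

lemma well_interleaved_iff:
  assumes L: "front L" and S: "S \<subseteq> L" "fat L S"
  shows "well_interleaved B S \<longleftrightarrow> (\<forall>s\<in>S. \<forall>x\<in>nodes S. x \<noteq> [] \<longrightarrow>
    mx (ab S s) < mx (ab S x) \<or> Suc (hd (ab S s)) = hd (ab S x) \<and> mx (ab S s) \<le> mx (ab S x) \<longrightarrow> s \<prec> x)"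
    (is "_ \<longleftrightarrow> ?R")
proof -
  have ne: "S \<noteq> {}"
    using inf by (metis (mono_tags, lifting) Collect_empty_eq finite.emptyI vimage_empty)
  have pre: "prefixes_of {s \<in> S. P (hd (ab S s)) \<and> mx (ab S s) < k} =
    {x \<in> nodes S. x \<noteq> [] \<and> P (hd (ab S x)) \<and> mx (ab S x) < k}" for P k
    by (rule front.prefixes_of_bounded[OF L S(1) ne S(2)])
  have pre0: "prefixes_of {s \<in> S. mx (ab S s) < k} = {x \<in> nodes S. x \<noteq> [] \<and> mx (ab S x) < k}" for k
    using pre[of "\<lambda>_. True" k] by simp
  have prei: "prefixes_of {s \<in> S. hd (ab S s) = i \<and> mx (ab S s) < k} =
    {x \<in> nodes S. x \<noteq> [] \<and> hd (ab S x) = i \<and> mx (ab S x) < k}" for i k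
    using pre[of "\<lambda>j. j = i" k] by simp
  have "well_interleaved B S \<longleftrightarrow> (\<forall>k\<ge>1.
      (\<forall>s\<in>S. \<forall>x\<in>nodes S. x \<noteq> [] \<longrightarrow> mx (ab S s) < k \<longrightarrow> hd (ab S x) = 0 \<longrightarrow> mx (ab S x) = k \<longrightarrow> s \<prec> x) \<and>
      (\<forall>i. 1 \<le> i \<and> i \<le> k \<longrightarrow> (\<forall>s\<in>S. \<forall>x\<in>nodes S. x \<noteq> [] \<longrightarrow>
        mx (ab S s) < k \<or> hd (ab S s) = i - 1 \<and> mx (ab S s) < k + 1 \<longrightarrow>
        hd (ab S x) = i \<longrightarrow> mx (ab S x) = k \<longrightarrow> s \<prec> x)))"
    (is "_ \<longleftrightarrow> (\<forall>k\<ge>1. ?W1 k \<and> (\<forall>i. 1 \<le> i \<and> i \<le> k \<longrightarrow> ?W2 k i))")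
    unfolding well_interleaved_def Let_def row_approx_eq full_approx_eq pre0 prei
  proof (intro all_cong1 imp_cong refl conj_cong)
    fix k :: nat
    show "{s \<in> S. mx (ab S s) < k} \<prec>\<prec> {x \<in> nodes S. x \<noteq> [] \<and> hd (ab S x) = 0 \<and> mx (ab S x) < 0 + (k + 1)} -
        {x \<in> nodes S. x \<noteq> [] \<and> mx (ab S x) < k} \<longleftrightarrow> ?W1 k"
      unfolding set_less_def by (auto simp: less_Suc_eq)
    fix i assume i: "1 \<le> i \<and> i \<le> k"
    \<comment> \<open>Index \<open>k + 2 - i\<close> in row \<open>i - 1\<close> is the same stage
      as \<open>k + 1 - i\<close> in row \<open>i\<close>: the bound is \<open>k + 1\<close> in
      both.\<close>
    then have e: "i + (k + 1 - i) = k + 1" "i + (k - i) = k" "i - 1 + (k + 2 - i) = k + 1"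
      by simp_all
    show "{s \<in> S. mx (ab S s) < k} \<union> {s \<in> S. hd (ab S s) = i - 1 \<and> mx (ab S s) < i - 1 + (k + 2 - i)} \<prec>\<prec>
        {x \<in> nodes S. x \<noteq> [] \<and> hd (ab S x) = i \<and> mx (ab S x) < i + (k + 1 - i)} -
        {x \<in> nodes S. x \<noteq> [] \<and> hd (ab S x) = i \<and> mx (ab S x) < i + (k - i)} \<longleftrightarrow> ?W2 k i"
      unfolding set_less_def e by (auto simp: less_Suc_eq)
  qed
  also have "\<dots> \<longleftrightarrow> ?R"
  proof
    assume W: "\<forall>k\<ge>1. ?W1 k \<and> (\<forall>i. 1 \<le> i \<and> i \<le> k \<longrightarrow> ?W2 k i)"
    show ?R
    proof (intro ballI impI)
      fix s x assume s: "s \<in> S" and x: "x \<in> nodes S" "x \<noteq> []"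
        and c: "mx (ab S s) < mx (ab S x) \<or> Suc (hd (ab S s)) = hd (ab S x) \<and> mx (ab S s) \<le> mx (ab S x)"
      have "hd (ab S x) \<le> mx (ab S x)"
        using x(2) by (intro hd_le_mx) (metis length_0_conv length_adr)
      \<comment> \<open>So the restriction to stages \<open>k \<ge> 1\<close> loses nothing: the
        hypothesis already rules out the largest entry 0.\<close>
      then have k: "1 \<le> mx (ab S x)"
        using c by auto
      show "s \<prec> x"
      proof (cases "hd (ab S x) = 0")
        case True
        moreover have "mx (ab S s) < mx (ab S x)"
          using c True by simp
        moreover have "?W1 (mx (ab S x))"
          using W k by blast
        ultimately show ?thesis
          using s x by blast
      next
        case False
        then have "1 \<le> hd (ab S x) \<and> hd (ab S x) \<le> mx (ab S x)"
          using \<open>hd (ab S x) \<le> mx (ab S x)\<close> by simp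
        then have "?W2 (mx (ab S x)) (hd (ab S x))"
          using W k by blast
        moreover have "mx (ab S s) < mx (ab S x) \<or> hd (ab S s) = hd (ab S x) - 1 \<and> mx (ab S s) < mx (ab S x) + 1"
          using c by auto
        ultimately show ?thesis
          using s x by blast
      qed
    qed
  next
    assume R: ?R
    show "\<forall>k\<ge>1. ?W1 k \<and> (\<forall>i. 1 \<le> i \<and> i \<le> k \<longrightarrow> ?W2 k i)"
    proof (intro allI impI conjI ballI)
      fix k i s x
      assume "1 \<le> i \<and> i \<le> k" "s \<in> S" "x \<in> nodes S" "x \<noteq> []"
        "mx (ab S s) < k \<or> hd (ab S s) = i - 1 \<and> mx (ab S s) < k + 1" "hd (ab S x) = i" "mx (ab S x) = k"
      then show "s \<prec> x"
        using R by auto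
    qed (use R in auto)
  qed
  finally show ?thesis .
qed

end

text \<open>\<open>R\<close> compares members with nodes, and for equal largest entries only across
  consecutive rows. From nodes one passes to members by leftmost leaves, distant rows are linked by
  a chain of members in the rows between, and inside one row the order comes from
  \<open>rows\<close>.\<close>

lemma well_interleaved_ordered:
  assumes L: "front L" and S: "S \<subseteq> L" "fat L S"
    and R: "\<And>s x. s \<in> S \<Longrightarrow> x \<in> nodes S \<Longrightarrow> x \<noteq> [] \<Longrightarrow> mx (ab S s) < mx (ab S x) \<or>
      Suc (hd (ab S s)) = hd (ab S x) \<and> mx (ab S s) \<le> mx (ab S x) \<Longrightarrow> s \<prec> x"
    and rows: "\<And>n. sec n S \<noteq> {} \<Longrightarrow> sec n S \<in> tree_space (sec n L)"
    and front_rows: "\<And>n. n > 0 \<Longrightarrow> front (sec n L)"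
  shows "ordered S"
  unfolding ordered_def
proof (intro ballI impI)
  have ne: "S \<noteq> {}"
    using inf by (metis (mono_tags, lifting) Collect_empty_eq finite.emptyI vimage_empty)
  have chain: "s \<prec> y" if "s \<in> S" "y \<in> nodes S" "y \<noteq> []" "hd (ab S y) = Suc (hd (ab S s) + d)"
    "mx (ab S s) \<le> mx (ab S y)" for s y d
    using that
  proof (induction d arbitrary: s)
    case 0
    then show ?case
      by (intro R) simp_all
  next
    case (Suc d)
    let ?i = "Suc (hd (ab S s))"
    let ?n = "row_index S ?i"
    \<comment> \<open>The intermediate row is not the first one, so its first entry is not 0, the
      only place where the section may have rank 0.\<close>
    have "?n > 0"
      using enumerate_mono[of 0 ?i, OF _ inf]
      unfolding row_index_def row_nonempty_iff[OF headed] by auto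
    then interpret row: front "sec ?n L"
      by (rule front_rows)
    have "sec ?n S \<in> tree_space (sec ?n L)"
      by (rule rows[OF row_index_sec])
    \<comment> \<open>A member of the next row whose address in \<open>S\<close> has the same
      largest entry as that of \<open>y\<close>; the row number \<open>?i\<close> is subtracted
      because it is added again on passing to \<open>S\<close>.\<close>
    then obtain t where t: "t \<in> sec ?n S" "mx (ab (sec ?n S) t) = mx (ab S y) - ?i"
      using row.exists_leaf_mx[of "sec ?n S" "mx (ab S y) - ?i"] by (auto simp: tree_space_def)
    have "hd (ab S y) \<le> mx (ab S y)"
      using Suc.prems(3) by (intro hd_le_mx) (metis length_0_conv length_adr)
    then have mx_t: "mx (ab S (upsilon ?n t)) = mx (ab S y)"
      using t(2) Suc.prems(4) by (simp add: mx_ab_row_index)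
    have "upsilon ?n t \<in> S"
      using t(1) by simp
    have "s \<prec> upsilon ?n t"
      by (rule R) (use Suc.prems mx_t hd_ab_row_index \<open>upsilon ?n t \<in> S\<close> subset_nodes in auto)
    moreover have "upsilon ?n t \<prec> y"
      by (rule Suc.IH) (use Suc.prems mx_t hd_ab_row_index \<open>upsilon ?n t \<in> S\<close> in auto)
    ultimately show ?case
      by (rule seq_less_trans)
  qed
  fix x y assume x: "x \<in> nodes S" and y: "y \<in> nodes S" and less: "ab S x \<prec> ab S y"
  have "y \<noteq> []"
    using less by (auto simp: seq_less_def)
  show "x \<prec> y"
  proof (cases "x = []")
    case True
    then show ?thesis
      using seq_less_append[OF \<open>y \<noteq> []\<close>, of "[]"] by simp
  next
    case False
    obtain v where v: "x @ v \<in> S" "ab S (x @ v) = ab S x @ replicate (length v) (mx (ab S x))"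
      using front.leftmost_leaf[OF L S(1) ne S(2) x] by blast
    have mx_v: "mx (ab S (x @ v)) = mx (ab S x)"
      by (simp add: v(2))
    have hd_v: "hd (ab S (x @ v)) = hd (ab S x)"
      by (rule hd_adr_append[OF False])
    have ab_ne: "ab S x \<noteq> []" "ab S y \<noteq> []"
      using False \<open>y \<noteq> []\<close> by (metis length_0_conv length_adr)+
    consider "hd (ab S x) = hd (ab S y)" | "mx (ab S x) < mx (ab S y)"
      | "mx (ab S x) = mx (ab S y)" "hd (ab S x) < hd (ab S y)"
      using less ab_ne unfolding seq_less_iff by (cases "ab S x"; cases "ab S y") auto
    then show ?thesis
    proof cases
      case 1
      define n where "n = row_index S (hd (ab S x))"
      obtain x' where x': "x = upsilon n x'" "x' \<in> nodes (sec n S)"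
        using nodes_row_index[OF x False] unfolding n_def .
      obtain y' where y': "y = upsilon n y'" "y' \<in> nodes (sec n S)"
        using nodes_row_index[OF y \<open>y \<noteq> []\<close>] unfolding n_def 1 .
      have ne_n: "sec n S \<noteq> {}"
        unfolding n_def by (rule row_index_sec)
      have "ordered (sec n S)"
        using rows[OF ne_n] by (simp add: tree_space_def)
      moreover have "ab (sec n S) x' \<prec> ab (sec n S) y'"
        using less unfolding x'(1) y'(1) adr_upsilon[OF headed ne_n] by simp
      ultimately have "x' \<prec> y'"
        using x'(2) y'(2) unfolding ordered_def by blast
      then show ?thesis
        unfolding x'(1) y'(1) by simp
    next
      case 2
      then have "x @ v \<prec> y"
        using R v(1) y \<open>y \<noteq> []\<close> mx_v by simp
      then show ?thesis
        by (rule seq_prefix_less_trans)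
    next
      case 3
      then have "x @ v \<prec> y"
        using chain[OF v(1) y \<open>y \<noteq> []\<close>, of "hd (ab S y) - Suc (hd (ab S x))"] mx_v hd_v by simp
      then show ?thesis
        by (rule seq_prefix_less_trans)
    qed
  qed
qed

lemma ordered_well_interleaved:
  assumes "ordered S" "s \<in> S" "x \<in> nodes S" "x \<noteq> []"
    and c: "mx (ab S s) < mx (ab S x) \<or> Suc (hd (ab S s)) = hd (ab S x) \<and> mx (ab S s) \<le> mx (ab S x)"
  shows "s \<prec> x"
proof -
  have "s \<noteq> []" "s \<in> nodes S"
    using assms(2) headed_Nil[OF headed] subset_nodes by auto
  then have "ab S s \<noteq> []" "ab S x \<noteq> []"
    using assms(4) by (metis length_0_conv length_adr)+
  then have "ab S s \<prec> ab S x"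
    using c unfolding seq_less_iff by (cases "ab S s"; cases "ab S x") auto
  then show ?thesis
    using assms \<open>s \<in> nodes S\<close> unfolding ordered_def by blast
qed

lemma ordered_sec:
  assumes "ordered S" "sec n S \<noteq> {}"
  shows "ordered (sec n S)"
  unfolding ordered_def
proof (intro ballI impI)
  fix x y assume *: "x \<in> nodes (sec n S)" "y \<in> nodes (sec n S)" "ab (sec n S) x \<prec> ab (sec n S) y"
  then have "upsilon n x \<in> nodes S" "upsilon n y \<in> nodes S"
    using upsilon_in_nodes[OF headed] assms(2) by blast+
  moreover have "ab S (upsilon n x) \<prec> ab S (upsilon n y)"
    using * by (simp add: adr_upsilon[OF headed assms(2)])
  ultimately have "upsilon n x \<prec> upsilon n y"
    using assms(1) unfolding ordered_def by blast
  then show "x \<prec> y"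
    by simp
qed

end

section \<open>Rank one and the induction over barriers\<close>

lemma shifted_singletons:
  assumes "{} \<notin> B" "\<forall>b\<in>B. finite b"
  shows "(\<forall>n. shifted_section B n = {{}}) \<longleftrightarrow> B = range (\<lambda>n. {n})"
proof
  assume s: "\<forall>n. shifted_section B n = {{}}"
  show "B = range (\<lambda>n. {n})"
  proof (intro equalityI subsetI)
    fix b assume b: "b \<in> B"
    then have "finite b" "b \<noteq> {}"
      using assms by auto
    then obtain n c where c: "finite c" "b = insert n ((\<lambda>x. x + n + 1) ` c)"
      by (rule finite_set_split)
    then have "c \<in> shifted_section B n"
      using b by (simp add: shifted_section_iff)
    then show "b \<in> range (\<lambda>n. {n})"
      using s c by simp
  next
    fix b assume "b \<in> range (\<lambda>n::nat. {n})"
    then obtain n where "b = {n}"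
      by blast
    moreover have "{} \<in> shifted_section B n"
      using s by simp
    ultimately show "b \<in> B"
      by (simp add: shifted_section_iff)
  qed
next
  assume B: "B = range (\<lambda>n. {n})"
  have "c \<in> shifted_section B n \<longleftrightarrow> c = {}" for c n
  proof
    assume "c \<in> shifted_section B n"
    then obtain m where m: "insert n ((\<lambda>x. x + n + 1) ` c) = {m}"
      by (auto simp: shifted_section_iff B)
    then have "x + n + 1 = n" if "x \<in> c" for x
      using that by blast
    then show "c = {}"
      by auto
  qed (auto simp: shifted_section_iff B)
  then show "\<forall>n. shifted_section B n = {{}}"
    by blast
qed

lemma infinite_sec_nonempty: "infinite {n. sec n S \<noteq> {}} \<Longrightarrow> S \<noteq> {}"
  by (metis (mono_tags, lifting) Collect_empty_eq finite.emptyI vimage_empty)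

lemma tree_space_Nil: "tree_space {[]} = {{[]}}"
proof (intro equalityI subsetI)
  fix S :: "nat list set" assume "S \<in> {{[]}}"
  moreover have "nodes {[]} = {[]}"
    by (auto simp: nodes_def)
  ultimately show "S \<in> tree_space {[]}"
    by (simp add: tree_space_def fat_def ordered_def)
qed (auto simp: tree_space_def)

lemma sec_singleton:
  assumes S: "S \<subseteq> range (\<lambda>n. [n])"
  shows "sec n S = (if [n] \<in> S then {[]} else {})"
proof -
  have "upsilon n t \<in> S \<longleftrightarrow> t = [] \<and> [n] \<in> S" for t
  proof
    assume t: "upsilon n t \<in> S"
    then obtain m where "upsilon n t = [m]"
      using S by blast
    then show "t = [] \<and> [n] \<in> S"
      using t by (simp add: upsilon_def)
  qed (simp add: upsilon_def)
  then show ?thesis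
    by auto
qed

text \<open>For singletons the address of a member \<open>[n]\<close> is its position in
  \<open>S\<close>, so bounding it by \<open>k\<close> selects the first \<open>k\<close>
  members.\<close>

lemma singletons_tree_space:
  fixes L :: "nat list set"
  defines "L \<equiv> range (\<lambda>n. [n])"
  shows "S \<in> tree_space L \<longleftrightarrow> S \<subseteq> L \<and> infinite S"
    and "S \<subseteq> L \<Longrightarrow> first_members k S = {s \<in> S. mx (ab S s) < k}"
proof -
  have L: "headed L"
  proof -
    have "[n] = upsilon n []" for n
      by (simp add: upsilon_def)
    then show ?thesis
      unfolding headed_def L_def by blast
  qed
  have nodes_S: "nodes S = insert [] S" if S: "S \<subseteq> L"
  proof (intro equalityI subsetI)
    fix x assume x: "x \<in> nodes S"
    show "x \<in> insert [] S"
    proof (cases "x = []")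
      case False
      then obtain y where "x @ y \<in> S"
        using x by (auto elim: nodesE)
      moreover from this obtain n where "x @ y = [n]"
        using S unfolding L_def by blast
      ultimately show ?thesis
        using False by (cases x) auto
    qed simp
  qed (use subset_nodes in auto)
  have ab_S: "ab S [n] = [card {m. m < n \<and> [m] \<in> S}]" if "S \<subseteq> L" for n
    using nodes_S[OF that] by (simp add: upsilon_def)
  have seq: "[m] \<prec> [n] \<longleftrightarrow> m < n" for m n
    by (auto simp: seq_less_iff)
  show "first_members k S = {s \<in> S. mx (ab S s) < k}" if S: "S \<subseteq> L"
  proof -
    have "finite {t \<in> S. t \<prec> s}" "card {t \<in> S. t \<prec> s} = mx (ab S s)" if s: "s \<in> S" for s
    proof -
      obtain n where n: "s = [n]"
        using s S unfolding L_def by blast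
      have eq: "{t \<in> S. t \<prec> s} = (\<lambda>m. [m]) ` {m. m < n \<and> [m] \<in> S}"
        using S unfolding L_def n by (auto simp: seq)
      show "finite {t \<in> S. t \<prec> s}" "card {t \<in> S. t \<prec> s} = mx (ab S s)"
        unfolding eq unfolding n ab_S[OF S] by (simp_all add: card_image inj_on_def)
    qed
    then show ?thesis
      unfolding first_members_def by auto
  qed
  have fat: "fat L S \<longleftrightarrow> infinite S" if S: "S \<subseteq> L"
  proof -
    have "fat (sec n L) (sec n S)" if "sec n S \<noteq> {}" for n
    proof -
      have "sec n S = {[]}" "sec n L = {[]}"
        using that S sec_singleton[of S n] sec_singleton[of L n] by (auto simp: L_def split: if_splits)
      then show ?thesis
        using tree_space_Nil unfolding tree_space_def by auto
    qed
    moreover have "{n. sec n S \<noteq> {}} = {n. [n] \<in> S}"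
      using sec_singleton[of S] S unfolding L_def by auto
    moreover have "infinite {n. [n] \<in> S} \<longleftrightarrow> infinite S"
    proof -
      have "S = (\<lambda>n. [n]) ` {n. [n] \<in> S}"
        using S unfolding L_def by auto
      then have "finite S \<longleftrightarrow> finite ((\<lambda>n. [n]) ` {n. [n] \<in> S})"
        by simp
      then show ?thesis
        by (simp add: finite_image_iff inj_on_def)
    qed
    ultimately show ?thesis
      using fat_iff[OF L S] by simp
  qed
  have "ordered S" if S: "S \<subseteq> L"
    unfolding ordered_def
  proof (intro ballI impI)
    fix x y assume x: "x \<in> nodes S" and y: "y \<in> nodes S" and less: "ab S x \<prec> ab S y"
    have "y \<noteq> []"
      using less by (auto simp: seq_less_def)
    show "x \<prec> y"
    proof (cases "x = []")
      case True
      then show ?thesis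
        using seq_less_append[OF \<open>y \<noteq> []\<close>, of "[]"] by simp
    next
      case False
      then obtain m n where mn: "x = [m]" "y = [n]"
        using x y \<open>y \<noteq> []\<close> S unfolding nodes_S[OF S] L_def by blast
      have "\<not> n \<le> m"
      proof
        assume "n \<le> m"
        then have "card {k. k < n \<and> [k] \<in> S} \<le> card {k. k < m \<and> [k] \<in> S}"
          by (intro card_mono) auto
        then show False
          using less by (simp add: mn ab_S[OF S] seq del: adr.simps)
      qed
      then show ?thesis
        by (simp add: mn seq)
    qed
  qed
  then show "S \<in> tree_space L \<longleftrightarrow> S \<subseteq> L \<and> infinite S"
    using fat infinite_imp_nonempty[of S] by (cases "S \<subseteq> L") (simp_all add: tree_space_def, blast)
qed

text \<open>The two claims are proved together because the interleaving conditions of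
  \<open>B\<close> mention the full approximations of the rows.\<close>

theorem domain_space_eq:
  "regular B \<Longrightarrow> domain_space B = tree_space (sigma ` B) \<and>
    (\<forall>S\<in>tree_space (sigma ` B). \<forall>k. full_approx B k S = {s \<in> S. mx (ab S s) < k})"
proof (induction rule: regular.induct)
  case regular_empty
  have B: "regular {{}}"
    by (rule regular.regular_empty)
  have "domain_space {{}} = {{[]}}"
    using domain_space.psimps[OF ranked_domain_space_dom[OF regular_ranked[OF B]]] by simp
  moreover have "full_approx {{}} = (\<lambda>k S. if k = 0 then {} else {[]})"
    using full_approx.psimps[OF ranked_full_approx_dom[OF regular_ranked[OF B]]] by simp
  then have "full_approx {{}} k {[]} = {s \<in> {[]}. mx (ab {[]} s) < k}" for k
    by (cases "k = 0") auto
  moreover have "sigma ` {{}} = {[]}"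
    by (simp add: sigma_def)
  ultimately show ?case
    unfolding tree_space_Nil by (simp only: tree_space_Nil) blast
next
  case (regular_step B)
  let ?L = "sigma ` B" and ?C = "shifted_section B"
  note split = sigma_image_split[OF regular_step.hyps(1,2)]
  have B: "regular B"
    by (rule regular.regular_step) (use regular_step in auto)
  then have ranked: "ranked B"
    by (rule regular_ranked)
  have ne: "B \<noteq> {{}}"
    using regular_step.hyps(1) by auto
  show ?case
  proof (cases "B = range (\<lambda>n. {n})")
    case True
    have "sigma {n} = [n]" for n
      by (simp add: sigma_def)
    then have L: "?L = range (\<lambda>n. [n])"
      unfolding True by (simp add: image_image)
    have "domain_space B = {S. S \<subseteq> ?L \<and> infinite S}"
      using domain_space.psimps[OF ranked_domain_space_dom[OF ranked]] ne True by simp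
    then have "domain_space B = tree_space ?L"
      unfolding L using singletons_tree_space(1) by blast
    moreover have "full_approx B = first_members"
      using full_approx.psimps[OF ranked_full_approx_dom[OF ranked]] ne True by simp
    moreover have "first_members k S = {s \<in> S. mx (ab S s) < k}" if "S \<in> tree_space ?L" for S k
      by (rule singletons_tree_space(2)) (use that in \<open>simp add: L tree_space_def\<close>)
    ultimately show ?thesis
      by simp
  next
    case False
    \<comment> \<open>Beyond rank one the dichotomy in \<open>regular\<close> leaves 0 as the only
      index whose section may be \<open>{{}}\<close>, so all sections at \<open>n > 0\<close> give
      fronts.\<close>
    have "\<not> (\<forall>n. ?C n = {{}})"
      using False shifted_singletons[OF regular_step.hyps(1,2)] by simp
    with regular_step.hyps have pos: "?C n \<noteq> {{}}" if "n > 0" for n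
      using that by simp
    have IH: "domain_space (?C n) = tree_space (sec n ?L)" for n
      unfolding split(2) by (rule conjunct1[OF regular_step.IH])
    have IH': "full_approx (?C n) k S = {s \<in> S. mx (ab S s) < k}" if "S \<in> tree_space (sec n ?L)" for n S k
      using conjunct2[OF regular_step.IH, of n] that unfolding split(2) by simp
    have front_L: "front ?L"
      by (rule front_sigma[OF B ne])
    have front_rows: "front (sec n ?L)" if "n > 0" for n
      unfolding split(2) by (rule front_sigma[OF _ pos[OF that]]) (use regular_step in auto)
    have dom: "domain_space B = {S. S \<subseteq> ?L \<and> infinite {n. row S n \<noteq> {}} \<and>
        (\<forall>n. row S n \<noteq> {} \<longrightarrow> row S n \<in> (\<lambda>T. upsilon n ` T) ` domain_space (?C n)) \<and>
        well_interleaved B S}"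
      using domain_space.psimps[OF ranked_domain_space_dom[OF ranked]] ne False by simp
    have row_dom: "row S n \<in> (\<lambda>T. upsilon n ` T) ` domain_space (?C n) \<longleftrightarrow> sec n S \<in> tree_space (sec n ?L)"
      if "S \<subseteq> ?L" for S n
    proof -
      have inj: "inj (upsilon n)"
        by (simp add: inj_def upsilon_inj)
      show ?thesis
        unfolding row_eq[OF headed_subset[OF split(1) that]] IH image_iff
        by (simp add: inj_image_eq_iff[OF inj] del: image_vimage_eq)
    qed
    have rows_S: "full_approx (?C n) k (sec n S) = {t \<in> sec n S. mx (ab (sec n S) t) < k}"
      if "\<And>n. sec n S \<noteq> {} \<Longrightarrow> sec n S \<in> tree_space (sec n ?L)" "sec n S \<noteq> {}" for S n k
      by (rule IH') (rule that)+
    have space_rows: "infinite {n. sec n S \<noteq> {}}"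
      "\<And>n. sec n S \<noteq> {} \<Longrightarrow> sec n S \<in> tree_space (sec n ?L)" if S: "S \<in> tree_space ?L" for S
    proof -
      have SL: "S \<subseteq> ?L" "fat ?L S" "ordered S"
        using S by (simp_all add: tree_space_def)
      then have hS: "headed S"
        using headed_subset split(1) by blast
      have fat: "infinite {n. sec n S \<noteq> {}}" "\<And>n. sec n S \<noteq> {} \<Longrightarrow> fat (sec n ?L) (sec n S)"
        using SL(2) unfolding fat_iff[OF split(1) SL(1)] by blast+
      show "infinite {n. sec n S \<noteq> {}}"
        by (rule fat)
      show "sec n S \<in> tree_space (sec n ?L)" if n: "sec n S \<noteq> {}" for n
        using SL(1) fat(2)[OF n] n ordered_sec[OF hS fat(1) SL(3) n] unfolding tree_space_def by blast
    qed
    have "domain_space B = tree_space ?L"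
    proof (intro equalityI subsetI)
      fix S assume "S \<in> domain_space B"
      then have S: "S \<subseteq> ?L" "infinite {n. row S n \<noteq> {}}" "well_interleaved B S"
        "\<And>n. row S n \<noteq> {} \<Longrightarrow> row S n \<in> (\<lambda>T. upsilon n ` T) ` domain_space (?C n)"
        unfolding dom by blast+
      have hS: "headed S"
        using headed_subset split(1) S(1) by blast
      have inf: "infinite {n. sec n S \<noteq> {}}"
        using S(2) unfolding row_nonempty_iff[OF hS] .
      have rows: "sec n S \<in> tree_space (sec n ?L)" if "sec n S \<noteq> {}" for n
        using S(4)[of n] that unfolding row_nonempty_iff[OF hS] row_dom[OF S(1)] by blast
      have fat: "fat ?L S"
        using inf rows unfolding fat_iff[OF split(1) S(1)] tree_space_def by blast
      have "ordered S"
      proof (rule well_interleaved_ordered[OF hS inf front_L S(1) fat _ rows front_rows])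
        fix s x assume "s \<in> S" "x \<in> nodes S" "x \<noteq> []"
          "mx (ab S s) < mx (ab S x) \<or> Suc (hd (ab S s)) = hd (ab S x) \<and> mx (ab S s) \<le> mx (ab S x)"
        then show "s \<prec> x"
          using S(3) well_interleaved_iff[OF hS inf ranked ne False rows_S[OF rows] front_L S(1) fat]
          by blast
      qed
      then show "S \<in> tree_space ?L"
        using S(1) fat infinite_sec_nonempty[OF inf] unfolding tree_space_def by blast
    next
      fix S assume S: "S \<in> tree_space ?L"
      then have SL: "S \<subseteq> ?L" "fat ?L S" "ordered S"
        by (simp_all add: tree_space_def)
      then have hS: "headed S"
        using headed_subset split(1) by blast
      note inf = space_rows(1)[OF S] and rows = space_rows(2)[OF S]
      have "well_interleaved B S"
      proof (rule well_interleaved_iff[OF hS inf ranked ne False _ front_L SL(1,2), THEN iffD2])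
        show "full_approx (?C n) k (sec n S) = {t \<in> sec n S. mx (ab (sec n S) t) < k}"
          if "sec n S \<noteq> {}" for n k
          using rows that by (rule rows_S)
      qed (use ordered_well_interleaved[OF hS inf SL(3)] in blast)
      then show "S \<in> domain_space B"
        using SL(1) inf rows unfolding dom mem_Collect_eq row_nonempty_iff[OF hS] row_dom[OF SL(1)] by blast
    qed
    moreover have "full_approx B k S = {s \<in> S. mx (ab S s) < k}" if S: "S \<in> tree_space ?L" for S k
    proof -
      have "headed S"
        using S headed_subset split(1) unfolding tree_space_def by blast
      then show ?thesis
        by (rule full_approx_eq[OF _ space_rows(1)[OF S] ranked ne False rows_S[OF space_rows(2)[OF S]]])
    qed
    ultimately show ?thesis
      by blast
  qed
qed

section \<open>Uniform barriers\<close>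

text \<open>Uniformity recurses on final segments \<open>{m..}\<close> without moving them, whereas
  \<open>regular\<close> moves every section back to 0; \<open>cut m\<close> performs this
  translation, compatibly with sections by \<open>shifted_section_translate\<close>.\<close>

abbreviation cut :: "nat \<Rightarrow> nat set set \<Rightarrow> nat set set" where
  "cut m B \<equiv> (\<lambda>a. (\<lambda>x. x - m) ` a) ` {a \<in> B. finite a \<and> a \<subseteq> {m..}}"

lemma not_ordLess_empty: "(r :: 'a rel, {} :: 'b rel) \<notin> ordLess"
proof
  assume "(r, {} :: 'b rel) \<in> ordLess"
  then obtain f where f: "embedS r ({} :: 'b rel) f"
    unfolding ordLess_def by auto
  then have "f ` Field r \<subseteq> Field ({} :: 'b rel)"
    using embed_Field unfolding embedS_def by blast
  then have "Field r = {}"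
    by simp
  then show False
    using f by (simp add: embedS_def bij_betw_def)
qed

lemma uniform_on_empty: "uniform_on {} M B \<Longrightarrow> B = {{}}"
  by (erule uniform_on.cases) (auto simp: succ_of_def limit_ordinal_def not_ordLess_empty)

lemma cut_section_nonempty:
  assumes "cut (Suc m) (section_at B m) \<noteq> {}"
  shows "\<exists>b\<in>B. finite b \<and> b \<subseteq> {m..} \<and> m \<in> b"
proof -
  obtain a where "a \<in> section_at B m" "finite a" "a \<subseteq> {Suc m..}"
    using assms by blast
  then show ?thesis
    by (intro bexI[of _ "insert m a"]) (auto simp: section_at_def)
qed

lemma atLeast_diff_atMost: "{m..} - {..n + m} = {Suc (n + m)..}" for n m :: nat
  by auto

lemma uniform_on_cut_nonempty:
  "uniform_on \<alpha> M B \<Longrightarrow> M = {m..} \<Longrightarrow> cut m B \<noteq> {}"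
proof (induction arbitrary: m rule: uniform_on.induct)
  case (succ M \<beta> \<alpha> B)
  then have "cut (Suc m) (section_at B m) \<noteq> {}"
    using succ.IH[of m "Suc m"] atLeast_diff_atMost[of m 0] by auto
  from cut_section_nonempty[OF this] show ?case
    by blast
next
  case (limit M \<alpha> s B)
  then have "cut (Suc m) (section_at B m) \<noteq> {}"
    using limit.IH[of m "Suc m"] atLeast_diff_atMost[of m 0] by auto
  from cut_section_nonempty[OF this] show ?case
    by blast
qed auto

text \<open>A nonzero rank provides a uniform section at the least point \<open>m\<close>, and that
  section is nonempty. This tells nonzero ranks from rank 0 after translation.\<close>

lemma uniform_on_member:
  assumes "uniform_on \<alpha> {m..} B" "\<alpha> \<noteq> {}"
  shows "\<exists>b\<in>B. finite b \<and> b \<subseteq> {m..} \<and> m \<in> b"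
proof -
  have "\<exists>\<beta>. uniform_on \<beta> ({m..} - {..m}) (section_at B m)"
    using assms(1)
  proof (cases rule: uniform_on.cases)
    case (succ \<beta>)
    then show ?thesis
      by (intro exI[of _ \<beta>]) simp
  next
    case (limit s)
    then show ?thesis
      by (intro exI[of _ "s m"]) simp
  qed (use assms(2) in simp)
  moreover have "{m..} - {..m} = {Suc m..}"
    by auto
  ultimately have "cut (Suc m) (section_at B m) \<noteq> {}"
    using uniform_on_cut_nonempty[of _ "{Suc m..}" "section_at B m" "Suc m"] by auto
  then show ?thesis
    by (rule cut_section_nonempty)
qed

lemma uniform_on_cut_neq:
  assumes "uniform_on \<alpha> {m..} B" "\<alpha> \<noteq> {}"
  shows "cut m B \<noteq> {{}}"
proof
  assume cut: "cut m B = {{}}"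
  obtain b where b: "b \<in> B" "finite b" "b \<subseteq> {m..}" "m \<in> b"
    using uniform_on_member[OF assms] by blast
  then have "(\<lambda>x. x - m) ` b \<in> cut m B"
    by blast
  then show False
    using b unfolding cut by simp
qed

lemma section_at_antichain:
  assumes "\<forall>a\<in>B. \<forall>b\<in>B. a \<subseteq> b \<longrightarrow> a = b"
  shows "\<forall>a\<in>section_at B n. \<forall>b\<in>section_at B n. a \<subseteq> b \<longrightarrow> a = b"
proof (intro ballI impI)
  fix a b assume ab: "a \<in> section_at B n" "b \<in> section_at B n" "a \<subseteq> b"
  then have "insert n a \<in> B" "insert n b \<in> B" "insert n a \<subseteq> insert n b"
    by (auto simp: section_at_def)
  then have "insert n a = insert n b"
    using assms by simp
  moreover have "n \<notin> a" "n \<notin> b"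
    using ab unfolding section_at_def by blast+
  ultimately show "a = b"
    by (simp add: insert_ident)
qed

text \<open>At a successor all sections have the same rank, so either all or none become
  \<open>{{}}\<close>; at a limit the ranks increase strictly, so only the first can be 0.\<close>

lemma uniform_on_regular:
  "uniform_on \<alpha> M B \<Longrightarrow> M = {m..} \<Longrightarrow> \<forall>a\<in>B. \<forall>b\<in>B. a \<subseteq> b \<longrightarrow> a = b \<Longrightarrow> regular (cut m B)"
proof (induction arbitrary: m rule: uniform_on.induct)
  case (zero M)
  have "cut m {{}} = {{}}"
    by auto
  then show ?case
    using regular.regular_empty by simp
next
  case (succ M \<beta> \<alpha> B)
  have sec: "shifted_section (cut m B) n = cut (Suc (n + m)) (section_at B (n + m))" for n
    using shifted_section_translate[of m B n] by simp
  have unif: "uniform_on \<beta> {Suc (n + m)..} (section_at B (n + m))" for n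
    using succ.hyps(4)[of "n + m"] succ.prems atLeast_diff_atMost[of m n] by simp
  have reg: "regular (shifted_section (cut m B) n)" for n
    unfolding sec
    by (rule succ.IH) (simp_all add: succ.prems(1) atLeast_diff_atMost section_at_antichain[OF succ.prems(2)])
  have nil: "{} \<notin> cut m B" and fin: "\<forall>b\<in>cut m B. finite b"
    using succ.hyps by auto
  have dich: "(\<forall>n. shifted_section (cut m B) n = {{}}) \<or> (\<forall>n>0. shifted_section (cut m B) n \<noteq> {{}})"
  proof (cases "\<beta> = {}")
    case True
    have "cut (Suc (n + m)) (section_at B (n + m)) = {{}}" for n
      unfolding uniform_on_empty[OF unif[of n, unfolded True]] by auto
    then show ?thesis
      unfolding sec by blast
  next
    case False
    then show ?thesis
      unfolding sec by (intro disjI2 allI impI uniform_on_cut_neq[OF unif])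
  qed
  show ?case
    by (rule regular.regular_step[OF nil fin reg dich])
next
  case (limit M \<alpha> s B)
  have sec: "shifted_section (cut m B) n = cut (Suc (n + m)) (section_at B (n + m))" for n
    using shifted_section_translate[of m B n] by simp
  have unif: "uniform_on (s (n + m)) {Suc (n + m)..} (section_at B (n + m))" for n
    using limit.hyps(4)[of "n + m"] limit.prems atLeast_diff_atMost[of m n] by simp
  have reg: "regular (shifted_section (cut m B) n)" for n
    unfolding sec
    by (rule limit.IH) (simp_all add: limit.prems(1) atLeast_diff_atMost section_at_antichain[OF limit.prems(2)])
  \<comment> \<open>The limit clause is silent about the empty set; it is excluded because it would
    be a subset of a set containing \<open>m\<close>, against the antichain condition.\<close>
  have nil: "{} \<notin> cut m B"
  proof -
    have "cut (Suc (0 + m)) (section_at B (0 + m)) \<noteq> {}"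
      using uniform_on_cut_nonempty[OF unif[of 0]] by blast
    then obtain b where "b \<in> B" "m \<in> b"
      using cut_section_nonempty[of m B] by auto
    then have "{} \<notin> B"
      using limit.prems(2) by blast
    then show ?thesis
      by auto
  qed
  have fin: "\<forall>b\<in>cut m B. finite b"
    by auto
  have "shifted_section (cut m B) n \<noteq> {{}}" if "n > 0" for n
  proof -
    have "(s m, s (n + m)) \<in> ordLess"
      using limit.hyps(3) that limit.prems by (simp add: increases_to_def)
    then have "s (n + m) \<noteq> {}"
      using not_ordLess_empty by metis
    then show ?thesis
      unfolding sec by (rule uniform_on_cut_neq[OF unif])
  qed
  then have dich: "(\<forall>n. shifted_section (cut m B) n = {{}}) \<or> (\<forall>n>0. shifted_section (cut m B) n \<noteq> {{}})"
    by blast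
  show ?case
    by (rule regular.regular_step[OF nil fin reg dich])
qed

lemma uniform_barrier_regular:
  assumes "uniform_barrier B"
  shows "regular B" "B \<noteq> {{}}"
proof -
  have "barrier B"
    using assms by (simp add: uniform_barrier_def)
  then have B: "\<forall>b\<in>B. finite b" "\<forall>a\<in>B. \<forall>b\<in>B. a \<subseteq> b \<longrightarrow> a = b"
    unfolding barrier_def by (simp, metis)
  obtain \<alpha> where \<alpha>: "\<alpha> \<noteq> {}" "uniform_on \<alpha> {0..} B"
    using assms by (auto simp: uniform_barrier_def)
  have cut: "cut 0 B = B"
    using B(1) by auto
  show "regular B"
    using uniform_on_regular[OF \<alpha>(2) refl B(2)] unfolding cut .
  show "B \<noteq> {{}}"
    using uniform_on_cut_neq[OF \<alpha>(2,1)] unfolding cut .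
qed

section \<open>Coding by initial segments\<close>

lemma sigma_take:
  fixes b :: "nat set"
  assumes "finite b"
  shows "sigma (set (take k (sorted_list_of_set b))) = take k (sigma b)"
proof -
  let ?xs = "sorted_list_of_set b"
  have xs: "sorted_list_of_set (set (take k ?xs)) = take k ?xs"
    by (rule sorted_list_of_set.idem_if_sorted_distinct) (simp_all add: sorted_wrt_take)
  have card: "card (set (take k ?xs)) = min k (card b)"
    using distinct_card[of "take k ?xs"] by simp
  show ?thesis
    unfolding sigma_def xs card by (auto simp: take_map take_upt min_def)
qed

text \<open>If \<open>k\<close> is less than the number of elements, the least element left out is
  entry \<open>k\<close> of the sorted list; otherwise \<open>a = b\<close>.\<close>

lemma initial_segment_iff_take:
  fixes b :: "nat set"
  assumes "finite b"
  shows "initial_segment a b \<longleftrightarrow> (\<exists>k. a = set (take k (sorted_list_of_set b)))"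
proof
  let ?xs = "sorted_list_of_set b"
  have below: "{x \<in> set ys. x < y} = set (takeWhile (\<lambda>x. x < y) ys)" if "sorted ys" for ys and y :: nat
    using that by (induction ys) auto
  assume "initial_segment a b"
  then consider "a = b" | y where "a = {x \<in> b. x < y}"
    unfolding initial_segment_def by blast
  then show "\<exists>k. a = set (take k ?xs)"
  proof cases
    case 1
    then show ?thesis
      using assms by (intro exI[of _ "card b"]) simp
  next
    case 2
    then have "a = set (takeWhile (\<lambda>x. x < y) ?xs)"
      using below[of ?xs y] assms by simp
    then show ?thesis
      by (metis takeWhile_eq_take)
  qed
next
  let ?xs = "sorted_list_of_set b"
  assume "\<exists>k. a = set (take k ?xs)"
  then obtain k where k: "a = set (take k ?xs)"
    by blast
  show "initial_segment a b"
  proof (cases "k < length ?xs")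
    case True
    have sorted: "?xs ! i < ?xs ! j" if "i < j" "j < length ?xs" for i j
      using sorted_wrt_nth_less[of "(<)" ?xs i j] that by simp
    have b: "x \<in> b \<longleftrightarrow> (\<exists>i<length ?xs. x = ?xs ! i)" for x
      using in_set_conv_nth[of x ?xs] assms by auto
    have a: "a = (!) ?xs ` {..<k}"
      using k True nth_image[of k ?xs] by (simp add: lessThan_atLeast0)
    have mono: "?xs ! i < ?xs ! k \<longleftrightarrow> i < k" if "i < length ?xs" for i
      using sorted[of i k] sorted[of k i] True that by (cases i k rule: linorder_cases) auto
    have lt: "a = {x \<in> b. x < ?xs ! k}"
    proof (intro equalityI subsetI)
      fix x assume "x \<in> a"
      then obtain i where "x = ?xs ! i" "i < k"
        unfolding a by blast
      moreover from this have "?xs ! i \<in> b"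
        unfolding b using True by (intro exI[of _ i]) simp
      ultimately show "x \<in> {x \<in> b. x < ?xs ! k}"
        using mono[of i] True by simp
    next
      fix x assume "x \<in> {x \<in> b. x < ?xs ! k}"
      then obtain i where "x = ?xs ! i" "i < length ?xs" "x < ?xs ! k"
        using b by blast
      then show "x \<in> a"
        using mono[of i] unfolding a by simp
    qed
    have "(LEAST y. y \<in> b - a) = ?xs ! k"
    proof (rule Least_equality)
      have "?xs ! k \<in> set ?xs"
        using True by (rule nth_mem)
      then show "?xs ! k \<in> b - a"
        using assms unfolding lt by simp
    qed (auto simp: lt)
    then show ?thesis
      using lt unfolding initial_segment_def by simp
  next
    case False
    then show ?thesis
      using k assms unfolding initial_segment_def by simp
  qed
qed

text \<open>Thus \<open>nu B\<close> counts predecessors among nodes. The empty \<open>B\<close> has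
  to be excluded, as \<open>nodes\<close> always contains the root.\<close>

lemma sigma_initial_segments:
  assumes "B \<noteq> {}" "\<forall>b\<in>B. finite b"
  shows "sigma ` initial_segments B = nodes (sigma ` B)"
proof (intro equalityI subsetI)
  fix x assume "x \<in> sigma ` initial_segments B"
  then obtain a b where "x = sigma a" "b \<in> B" "initial_segment a b"
    unfolding initial_segments_def by blast
  then obtain k where "b \<in> B" "x = take k (sigma b)"
    using assms(2) initial_segment_iff_take sigma_take by metis
  then show "x \<in> nodes (sigma ` B)"
    using append_in_nodes[of "take k (sigma b)" "drop k (sigma b)"] by simp
next
  fix x assume x: "x \<in> nodes (sigma ` B)"
  then obtain y where "x @ y \<in> sigma ` B"
    using assms(1) by (auto simp: nodes_def)
  then obtain b where b: "b \<in> B" "x @ y = sigma b"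
    by blast
  then have "x = take (length x) (sigma b)"
    by (metis append_eq_conv_conj)
  then have "x = sigma (set (take (length x) (sorted_list_of_set b)))"
    using sigma_take assms(2) b(1) by simp
  moreover have "set (take (length x) (sorted_list_of_set b)) \<in> initial_segments B"
    using initial_segment_iff_take assms(2) b(1) unfolding initial_segments_def by blast
  ultimately show "x \<in> sigma ` initial_segments B"
    by blast
qed

text \<open>\<open>nu B\<close> is strictly increasing on nodes, so \<open>psi B s\<close>
  determines the set of nonempty prefixes of \<open>s\<close>; two sequences with the same prefixes
  are prefixes of each other.\<close>

lemma psi_inj:
  assumes B: "regular B" "B \<noteq> {{}}"
  shows "inj_on (psi B) (sigma ` B)"
proof (rule inj_onI)
  interpret front "sigma ` B"
    by (rule front_sigma[OF B])
  let ?N = "nodes (sigma ` B)"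
  have "sigma ` initial_segments B = ?N"
    using B regular_nonempty regular_finite by (intro sigma_initial_segments) blast+
  then have nu: "nu B x = card {t \<in> ?N. t \<prec> x}" for x
    by (simp add: nu_def)
  have less: "nu B x < nu B y" if "x \<in> ?N" "x \<prec> y" for x y
    unfolding nu by (rule card_node_predecessors_less[OF subset_refl that])
  have inj: "inj_on (nu B) ?N"
  proof (rule inj_onI)
    fix x y assume "x \<in> ?N" "y \<in> ?N" "nu B x = nu B y"
    then show "x = y"
      using less[of x y] less[of y x] seq_less_linear[of x y] by auto
  qed
  define P where "P s = {take m s | m. 1 \<le> m \<and> m \<le> length s}" for s :: "nat list"
  have psi: "psi B s = nu B ` P s" for s
    unfolding psi_def P_def by blast
  have P_sub: "P s \<subseteq> ?N" if "s \<in> sigma ` B" for s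
    using that append_in_nodes[of "take m s" "drop m s" for m] unfolding P_def by auto
  have self: "s \<in> P s" if "s \<in> sigma ` B" for s
  proof -
    have "s \<noteq> []"
      using that Nil_notin by blast
    then show ?thesis
      unfolding P_def by (auto intro!: exI[of _ "length s"] simp: Suc_le_eq)
  qed
  fix s t assume s: "s \<in> sigma ` B" and t: "t \<in> sigma ` B" and eq: "psi B s = psi B t"
  then have "P s = P t"
    using inj_on_image_eq_iff[OF inj P_sub P_sub] unfolding psi by blast
  then obtain m n where "s = take m t" "t = take n s"
    using self[OF s] self[OF t] unfolding P_def by blast
  then show "s = t"
    by (metis length_take min.cobounded2 take_all order_antisym min.cobounded1)
qed

theorem theorem28:
  fixes B :: "nat set set"
  assumes "uniform_barrier B"
  shows "topological_ramsey_space (ellentuck_space B) (\<subseteq>) (restriction B)"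
proof -
  note B = uniform_barrier_regular[OF assms]
  interpret front "sigma ` B"
    by (rule front_sigma[OF B])
  let ?E = "tree_space (sigma ` B)"
  have "\<Union>?E \<subseteq> sigma ` B"
    by (auto simp: tree_space_def)
  note inj = inj_on_subset[OF psi_inj[OF B] this]
  have "restriction B k (psi B ` S) = psi B ` first_members k S" if "S \<in> ?E" for k S
  proof -
    have "S \<subseteq> sigma ` B"
      using that by (simp add: tree_space_def)
    then have "{s \<in> sigma ` B. psi B s \<in> psi B ` S} = S"
      using inj_on_image_mem_iff[OF psi_inj[OF B]] by blast
    then show ?thesis
      by (simp add: restriction_def)
  qed
  then have "approximation_space ((`) (psi B) ` ?E) (restriction B)"
    by (rule approximation_space_image[OF tree_space_approximation_space inj])
  moreover have "(`) (psi B) ` ?E = ellentuck_space B"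
    using domain_space_eq[OF B(1)] by (simp add: ellentuck_space_def)
  ultimately show ?thesis
    using approximation_space.ellentuck by simp
qed

end
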